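(* For a typical transformation $T$ of the non-atomic standard Borel probability space $(X,\mathcal{F},\mu)$, for every $k=3,4,\ldots$ there exists a $k$-fold Lebesgue function for $T$. Moreover, these functions can be chosen to take only finitely many values.
   Context: A transformation $T$ is an invertible measure-preserving map of a non-atomic standard Borel probability space $(X,\mathcal{F},\mu)$; transformations are identified when they agree almost everywhere. $L^2(\mu)$ is the space of complex-valued square-integrable functions, and $\widehat{T}:L^2(\mu)\to L^2(\mu)$, $\widehat{T}f(x)=f(Tx)$. For $k\ge2$, a non-zero function $f\in L^2(\mu)$ is $k$-fold Lebesgue for $T$ if for any collection $(n_1,\ldots,n_{k-1})$ of pairwise different non-zero integers and for any $m\le k$: (i) $\widehat{T}^{n_1}f\cdot\widehat{T}^{n_2}f\cdots\widehat{T}^{n_{m-1}}f\in L^2(\mu)$; and (ii) $\int_X\widehat{T}^{n_1}f\cdot\widehat{T}^{n_2}f\cdots\widehat{T}^{n_{k-1}}f\cdot\overline{f}\,d\mu=0$. The group of all transformations of $(X,\mathcal{F},\mu)$ is a Polish group with the weak (coarse) topology, in which $T_n\to T$ iff $\mu(T_nA\,\triangle\,TA)\to0$ for every $A\in\mathcal{F}$. A typical transformation has some property if the set of transformations having the property contains a dense $G_\delta$ subset of this group. *)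

theory Defs
  imports "HOL-Probability.Probability"
begin

definition standard_borel :: "'a measure \<Rightarrow> bool" where
  "standard_borel M \<longleftrightarrow>
     (\<exists>X. completely_metrizable_space X \<and> second_countable X \<and>
          topspace X = space M \<and> sets M = sigma_sets (topspace X) {U. openin X U})"

definition non_atomic :: "'a measure \<Rightarrow> bool" where
  "non_atomic M \<longleftrightarrow>
     (\<forall>A\<in>sets M. 0 < emeasure M A \<longrightarrow>
        (\<exists>B\<in>sets M. B \<subseteq> A \<and> 0 < emeasure M B \<and> emeasure M B < emeasure M A))"

text \<open>Transformations are total functions on the underlying type; only their values on
  \<^term>\<open>space M\<close> matter, since they are identified below when they agree almost everywhere.\<close>

definition transformations :: "'a measure \<Rightarrow> ('a \<Rightarrow> 'a) set" where
  "transformations M =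
     {T. bij_betw T (space M) (space M) \<and> T \<in> measurable M M \<and>
         inv_into (space M) T \<in> measurable M M \<and> distr M M T = M}"

definition ae_eq :: "'a measure \<Rightarrow> (('a \<Rightarrow> 'a) \<times> ('a \<Rightarrow> 'a)) set" where
  "ae_eq M = {(S, T). S \<in> transformations M \<and> T \<in> transformations M \<and> (AE x in M. S x = T x)}"

text \<open>The weak topology on the group \<open>transformations M // ae_eq M\<close> is the topology of the
  pseudometrics \<open>(S, T) \<mapsto> \<mu>(S A \<triangle> T A)\<close>, where \<open>A\<close> ranges over the measurable sets: its subbase
  consists of their balls. The convergence it induces is given in
  \<open>limitin_weak_topology\<close> below.\<close>

definition weak_ball :: "'a measure \<Rightarrow> ('a \<Rightarrow> 'a) \<Rightarrow> 'a set \<Rightarrow> real \<Rightarrow> ('a \<Rightarrow> 'a) set set" where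
  "weak_ball M T A e =
     {ae_eq M `` {S} | S. S \<in> transformations M \<and> measure M (sym_diff (S ` A) (T ` A)) < e}"

definition weak_topology :: "'a measure \<Rightarrow> ('a \<Rightarrow> 'a) set topology" where
  "weak_topology M =
     topology_generated_by
       {weak_ball M T A e | T A e. T \<in> transformations M \<and> A \<in> sets M \<and> 0 < e}"

definition typical :: "'a measure \<Rightarrow> (('a \<Rightarrow> 'a) \<Rightarrow> bool) \<Rightarrow> bool" where
  "typical M P \<longleftrightarrow>
     (\<exists>G. gdelta_in (weak_topology M) G \<and>
          weak_topology M closure_of G = topspace (weak_topology M) \<and>
          (\<forall>C\<in>G. \<forall>T\<in>C. P T))"

definition L2 :: "'a measure \<Rightarrow> ('a \<Rightarrow> complex) set" where
  "L2 M = {f. f \<in> borel_measurable M \<and> integrable M (\<lambda>x. (norm (f x))\<^sup>2)}"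

definition koopman :: "('a \<Rightarrow> 'a) \<Rightarrow> ('a \<Rightarrow> complex) \<Rightarrow> 'a \<Rightarrow> complex" where
  "koopman T f = (\<lambda>x. f (T x))"

definition koopman_power :: "'a measure \<Rightarrow> ('a \<Rightarrow> 'a) \<Rightarrow> int \<Rightarrow> ('a \<Rightarrow> complex) \<Rightarrow> 'a \<Rightarrow> complex" where
  "koopman_power M T n =
     (if 0 \<le> n then koopman T ^^ nat n else koopman (inv_into (space M) T) ^^ nat (- n))"

text \<open>For \<open>m = 1\<close> the product in the first condition is empty, i.e. the constant function 1.\<close>

definition k_fold_lebesgue :: "'a measure \<Rightarrow> ('a \<Rightarrow> 'a) \<Rightarrow> nat \<Rightarrow> ('a \<Rightarrow> complex) \<Rightarrow> bool" where
  "k_fold_lebesgue M T k f \<longleftrightarrow>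
     2 \<le> k \<and> f \<in> L2 M \<and> \<not> (AE x in M. f x = 0) \<and>
     (\<forall>n :: nat \<Rightarrow> int. inj_on n {1..k-1} \<and> (\<forall>i\<in>{1..k-1}. n i \<noteq> 0) \<longrightarrow>
        (\<forall>m\<in>{1..k}. (\<lambda>x. \<Prod>i=1..m-1. koopman_power M T (n i) f x) \<in> L2 M) \<and>
        (LINT x|M. (\<Prod>i=1..k-1. koopman_power M T (n i) f x) * cnj (f x)) = 0)"

lemma equiv_ae_eq: "equiv (transformations M) (ae_eq M)"
proof (rule equivI)
  show "trans (ae_eq M)"
    by (rule transI) (auto simp: ae_eq_def)
qed (auto simp: ae_eq_def refl_on_def sym_def)

lemma transformation_image_sets:
  assumes "T \<in> transformations M" "A \<in> sets M"
  shows "T ` A \<in> sets M"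
proof -
  have b: "bij_betw T (space M) (space M)" and m: "inv_into (space M) T \<in> measurable M M"
    using assms by (auto simp: transformations_def)
  have "A \<subseteq> space M" using assms(2) by (rule sets.sets_into_space)
  then have "T ` A = inv_into (space M) T -` A \<inter> space M"
    using b by (force simp: bij_betw_def inv_into_f_f f_inv_into_f)
  then show ?thesis using measurable_sets[OF m assms(2)] by simp
qed

lemma transformation_vimage:
  assumes "T \<in> transformations M" "A \<in> sets M"
  shows "emeasure M (T -` A \<inter> space M) = emeasure M A"
  using assms emeasure_distr[of T M M A] by (auto simp: transformations_def)

lemma AE_image_eq:
  assumes S: "S \<in> transformations M" and R: "R \<in> transformations M"
    and ae: "AE x in M. S x = R x" and A: "A \<in> sets M"
  shows "AE y in M. y \<in> S ` A \<longleftrightarrow> y \<in> R ` A"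
proof -
  obtain N where N: "N \<in> null_sets M" "{x \<in> space M. S x \<noteq> R x} \<subseteq> N"
    using ae by (auto simp: eventually_ae_filter)
  have null: "T ` N \<in> null_sets M" if T: "T \<in> transformations M" for T
  proof -
    have Ns: "N \<in> sets M" "N \<subseteq> space M"
      using N by (auto dest: null_setsD2 sets.sets_into_space)
    have "T -` (T ` N) \<inter> space M = N"
      using T Ns by (auto simp: transformations_def bij_betw_def inj_on_def)
    then show ?thesis
      using transformation_vimage[OF T transformation_image_sets[OF T Ns(1)]] N
        transformation_image_sets[OF T Ns(1)]
      by (auto simp: null_sets_def)
  qed
  have "AE y in M. y \<notin> S ` N" "AE y in M. y \<notin> R ` N"
    using null[OF S] null[OF R] by (auto intro: AE_not_in)
  then show ?thesis
  proof eventually_elim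
    case (elim y)
    then show ?case
      using N(2) sets.sets_into_space[OF A] by (fastforce simp: image_iff subset_iff)
  qed
qed

lemma in_weak_ball_iff:
  assumes S: "S \<in> transformations M" and T: "T \<in> transformations M" and A: "A \<in> sets M"
  shows "ae_eq M `` {S} \<in> weak_ball M T A e \<longleftrightarrow> measure M (sym_diff (S ` A) (T ` A)) < e"
proof
  assume "ae_eq M `` {S} \<in> weak_ball M T A e"
  then obtain R where R: "R \<in> transformations M" "ae_eq M `` {S} = ae_eq M `` {R}"
    and lt: "measure M (sym_diff (R ` A) (T ` A)) < e"
    by (auto simp: weak_ball_def)
  have "(S, R) \<in> ae_eq M"
    using R S eq_equiv_class_iff[OF equiv_ae_eq] by blast
  then have "AE y in M. y \<in> S ` A \<longleftrightarrow> y \<in> R ` A"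
    using AE_image_eq[OF S R(1) _ A] by (auto simp: ae_eq_def)
  then have "measure M (sym_diff (S ` A) (T ` A)) = measure M (sym_diff (R ` A) (T ` A))"
    using transformation_image_sets A S T R(1)
    by (intro measure_eq_AE) (auto elim!: eventually_mono)
  with lt show "measure M (sym_diff (S ` A) (T ` A)) < e" by simp
qed (use S in \<open>auto simp: weak_ball_def\<close>)

lemma topspace_weak_topology: "topspace (weak_topology M) = transformations M // ae_eq M"
proof
  show "topspace (weak_topology M) \<subseteq> transformations M // ae_eq M"
    by (auto simp: weak_topology_def weak_ball_def quotient_def)
  show "transformations M // ae_eq M \<subseteq> topspace (weak_topology M)"
  proof
    fix C assume "C \<in> transformations M // ae_eq M"
    then obtain S where S: "S \<in> transformations M" "C = ae_eq M `` {S}"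
      by (auto simp: quotient_def)
    then have "C \<in> weak_ball M S {} 1"
      by (auto simp: in_weak_ball_iff)
    moreover have "weak_ball M S {} 1 \<in>
        {weak_ball M T A e | T A e. T \<in> transformations M \<and> A \<in> sets M \<and> 0 < e}"
      using S sets.empty_sets zero_less_one by blast
    ultimately show "C \<in> topspace (weak_topology M)"
      by (auto simp: weak_topology_def)
  qed
qed

lemma limitin_weak_topology:
  assumes "prob_space M" and S: "\<And>n. S n \<in> transformations M" and T: "T \<in> transformations M"
  shows "limitin (weak_topology M) (\<lambda>n. ae_eq M `` {S n}) (ae_eq M `` {T}) F \<longleftrightarrow>
         (\<forall>A\<in>sets M. ((\<lambda>n. measure M (sym_diff (S n ` A) (T ` A))) \<longlongrightarrow> 0) F)"
    (is "?L \<longleftrightarrow> ?R")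
proof
  assume L: ?L
  show ?R
  proof (intro ballI tendstoI)
    fix A and e :: real assume A: "A \<in> sets M" and e: "0 < e"
    have "openin (weak_topology M) (weak_ball M T A e)"
      unfolding weak_topology_def
      by (rule topology_generated_by_Basis) (use T A e in blast)
    moreover have "ae_eq M `` {T} \<in> weak_ball M T A e"
      using T A e by (simp add: in_weak_ball_iff)
    ultimately have "\<forall>\<^sub>F n in F. ae_eq M `` {S n} \<in> weak_ball M T A e"
      using L by (auto simp: limitin_def)
    then show "\<forall>\<^sub>F n in F. dist (measure M (sym_diff (S n ` A) (T ` A))) 0 < e"
      by eventually_elim (simp add: in_weak_ball_iff[OF S T A])
  qed
next
  assume R: ?R
  interpret prob_space M by fact
  let ?B = "{weak_ball M T A e | T A e. T \<in> transformations M \<and> A \<in> sets M \<and> 0 < e}"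
  have "\<forall>\<^sub>F n in F. ae_eq M `` {S n} \<in> U"
    if "generate_topology_on ?B U" "ae_eq M `` {T} \<in> U" for U
    using that
  proof (induction)
    case (Int a b)
    then show ?case by (auto simp: eventually_conj_iff)
  next
    case (UN K)
    then obtain k where "k \<in> K" "ae_eq M `` {T} \<in> k" by auto
    with UN.IH have "\<forall>\<^sub>F n in F. ae_eq M `` {S n} \<in> k" by blast
    then show ?case by (rule eventually_mono) (use \<open>k \<in> K\<close> in auto)
  next
    case (Basis s)
    then obtain Q A e where Q: "Q \<in> transformations M" "A \<in> sets M" "0 < e"
      and s: "s = weak_ball M Q A e" by blast
    define d where "d = e - measure M (sym_diff (T ` A) (Q ` A))"
    have "0 < d" using Basis.prems by (simp add: s d_def in_weak_ball_iff[OF T Q(1,2)])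
    then have "\<forall>\<^sub>F n in F. measure M (sym_diff (S n ` A) (T ` A)) < d"
      using R Q(2) by (auto intro: order_tendstoD)
    then show ?case
    proof eventually_elim
      case (elim n)
      have sets: "S n ` A \<in> sets M" "T ` A \<in> sets M" "Q ` A \<in> sets M"
        using transformation_image_sets Q S T by auto
      have "measure M (sym_diff (S n ` A) (Q ` A))
          \<le> measure M (sym_diff (S n ` A) (T ` A) \<union> sym_diff (T ` A) (Q ` A))"
        using sets by (intro finite_measure_mono) auto
      also have "\<dots> \<le> measure M (sym_diff (S n ` A) (T ` A)) + measure M (sym_diff (T ` A) (Q ` A))"
        using sets by (intro measure_Un_le) auto
      also have "\<dots> < e" using elim by (simp add: d_def)
      finally show ?case by (simp add: s in_weak_ball_iff[OF S Q(1,2)])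
    qed
  qed simp
  then show ?L
    using T unfolding limitin_def topspace_weak_topology
    by (auto simp: weak_topology_def openin_topology_generated_by_iff intro: quotientI)
qed

end

theory Submission
  imports Defs
begin

text \<open>Let \<open>v\<close> be a primitive root of unity of order \<open>q = k - 1\<close>. If a bounded non-zero function \<open>f\<close> satisfied
\<open>f \<circ> S = v * f\<close> for some measure-preserving \<open>S\<close> commuting with \<open>T\<close>, then composing the integrand of the
second condition with \<open>S\<close> would multiply its integral by \<open>v ^ (k - 1) * cnj v = cnj v \<noteq> 1\<close> without changing
it, so all these integrals would vanish. A limit of powers of \<open>T\<close> can serve as \<open>S\<close>, and the limit
need not even be constructed: it suffices that \<open>f \<circ> T ^^ m j \<noteq> v * f\<close> only on sets whose measure tends to \<open>0\<close>
(\<open>rigid_eigenfunction_lebesgue\<close>).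

Such an \<open>f\<close> is obtained from one fixed set \<open>A\<close> with \<open>0 < \<mu> A < 1\<close>. If along a sequence \<open>m j\<close> the set
\<open>T ^^ (q * m j) A\<close> converges to \<open>A\<close> and \<open>T ^^ (i * m j) A\<close> converges to some set \<open>B i\<close> for each \<open>i < q\<close>, then
\<open>\<Sum>i<q. v ^ i * indicator (B i)\<close> has the required property, because \<open>T ^^ m j\<close> nearly moves \<open>B i\<close> to
\<open>B (Suc i mod q)\<close>. The sequence exists whenever \<open>T\<close> lies in countably many weakly open sets: those of
\<open>refinement_step\<close> say that a power \<open>T ^^ m\<close> which is nearly of order \<open>q\<close> on \<open>A\<close> can be replaced by another
power that is closer to order \<open>q\<close> and acts on \<open>A\<close> almost as \<open>T ^^ m\<close> does, and those of \<open>initial_step\<close>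
provide a first power whose combination is visibly not zero (\<open>lebesgue_function_exists\<close>).

Density of these sets is the heart of the matter. Near a given \<open>T\<close> a periodic transformation is built in
which a power is exactly of order \<open>q\<close>. On the product of a probability space \<open>Z\<close> with a cycle of length
\<open>n\<close>, rotating the cycle is measure-preserving and of period \<open>n\<close>; a point \<open>(z, j)\<close> is labelled by the letter \<open>l j z\<close>
in \<open>M\<close>. By \<open>cyclic_realization\<close> this rotation can be transported to \<open>M\<close> so that, as far as finitely
many given sets can tell, a point sits at the place of its letter. Hence the transported map is weakly close to
\<open>T\<close> as soon as the letters follow \<open>T\<close> at most times (\<open>letters_near\<close>), while its other correlations can be
prescribed by the choice of letters. The transport uses a version of the isomorphism theorem
for atomless standard probability spaces that respects a finite labelling (\<open>labelled_isomorphism\<close>).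

Finally, the weak topology has the Baire property (\<open>weak_Baire\<close>). A sequence of transformations that is
Cauchy together with its inverses on a countable generating family of sets converges pointwise in
the coordinates given by that family, and the limit is again a transformation (\<open>weak_complete\<close>).\<close>

section \<open>Measurable spaces coded by sequences of bits\<close>

definition coins :: "(nat \<Rightarrow> bool) measure" where
  "coins = PiM UNIV (\<lambda>_. count_space UNIV)"

definition code :: "(nat \<Rightarrow> 'a set) \<Rightarrow> 'a \<Rightarrow> nat \<Rightarrow> bool" where
  "code U x = (\<lambda>i. x \<in> U i)"

text \<open>Only the \<sigma>-algebra of \<open>N\<close> enters: a countable family of measurable sets separates points, and a point
can be recovered measurably from its sequence of memberships. The decoder is total on sequences of
bits, which is what makes it applicable to a sequence that arises only as a limit of codes. For a
standard Borel space this is the sole consequence of completeness that is used.\<close>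

definition coded :: "'a measure \<Rightarrow> (nat \<Rightarrow> 'a set) \<Rightarrow> ((nat \<Rightarrow> bool) \<Rightarrow> 'a) \<Rightarrow> bool" where
  "coded N U \<psi> \<longleftrightarrow>
     range U \<subseteq> sets N \<and> \<psi> \<in> coins \<rightarrow>\<^sub>M N \<and> (\<forall>x\<in>space N. \<psi> (code U x) = x)"

lemma space_coins [simp]: "space coins = UNIV"
  by (simp add: coins_def space_PiM)

lemma measurable_coin [measurable]: "(\<lambda>s. s i) \<in> coins \<rightarrow>\<^sub>M count_space UNIV"
  unfolding coins_def by measurable

lemma measurable_into_coins:
  assumes "\<And>i. Measurable.pred N (\<lambda>x. f x i)"
  shows "f \<in> N \<rightarrow>\<^sub>M coins"
  unfolding coins_def using assms
  by (intro measurable_PiM_single') auto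

lemma measurable_code:
  assumes "coded N U \<psi>"
  shows "code U \<in> N \<rightarrow>\<^sub>M coins"
proof (rule measurable_into_coins)
  fix i
  have [measurable]: "U i \<in> sets N" using assms by (auto simp: coded_def)
  show "Measurable.pred N (\<lambda>x. code U x i)"
    unfolding code_def by measurable
qed

text \<open>A point is the only one with its code, so its singleton is a countable intersection of coding sets
and their complements.\<close>

lemma coded_singleton:
  assumes cod: "coded M U \<psi>" and x: "x \<in> space M"
  shows "{x} \<in> sets M"
proof -
  have [measurable]: "U i \<in> sets M" for i using cod by (auto simp: coded_def)
  have "y = x" if "y \<in> space M" "\<forall>i. y \<in> U i \<longleftrightarrow> x \<in> U i" for y
  proof -
    have "code U y = code U x" using that by (simp add: code_def)
    then show ?thesis using cod x that(1) unfolding coded_def by metis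
  qed
  then have "{x} = {y\<in>space M. \<forall>i. y \<in> U i \<longleftrightarrow> x \<in> U i}" using x by auto
  also have "\<dots> \<in> sets M" by measurable
  finally show ?thesis .
qed

lemma coded_cong:
  assumes "sets N = sets N'" and "coded N U \<psi>"
  shows "coded N' U \<psi>"
  using assms measurable_cong_sets[of coins coins N N'] sets_eq_imp_space_eq[of N N']
  by (simp add: coded_def)

text \<open>The codes of the two coordinates are interleaved.\<close>

lemma coded_pair:
  assumes "coded N U \<psi>" and "coded N' U' \<psi>'"
  shows "\<exists>V \<xi>. coded (N \<Otimes>\<^sub>M N') V \<xi>"
proof -
  have [measurable]: "U i \<in> sets N" "U' i \<in> sets N'" for i
    using assms by (auto simp: coded_def)
  have [measurable]: "\<psi> \<in> coins \<rightarrow>\<^sub>M N" "\<psi>' \<in> coins \<rightarrow>\<^sub>M N'"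
    using assms by (auto simp: coded_def)
  define V where "V i = (if even i then U (i div 2) \<times> space N' else space N \<times> U' (i div 2))" for i
  define \<xi> where "\<xi> s = (\<psi> (\<lambda>i. s (2 * i)), \<psi>' (\<lambda>i. s (Suc (2 * i))))" for s
  have 1: "V i \<in> sets (N \<Otimes>\<^sub>M N')" for i
    by (auto simp: V_def)
  have [measurable]: "(\<lambda>s i. s (2 * i)) \<in> coins \<rightarrow>\<^sub>M coins" "(\<lambda>s i. s (Suc (2 * i))) \<in> coins \<rightarrow>\<^sub>M coins"
    by (auto intro!: measurable_into_coins)
  have 2: "\<xi> \<in> coins \<rightarrow>\<^sub>M N \<Otimes>\<^sub>M N'"
    unfolding \<xi>_def by measurable
  have "\<xi> (code V z) = z" if "z \<in> space (N \<Otimes>\<^sub>M N')" for z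
  proof -
    have "(\<lambda>i. code V z (2 * i)) = code U (fst z)" "(\<lambda>i. code V z (Suc (2 * i))) = code U' (snd z)"
      using that by (auto simp: code_def V_def space_pair_measure)
    then show ?thesis
      using that assms by (auto simp: \<xi>_def coded_def space_pair_measure)
  qed
  then show ?thesis
    using 1 2 unfolding coded_def by blast
qed

lemma coded_count_space:
  assumes "0 < n"
  shows "\<exists>U \<psi>. coded (count_space {..<n::nat}) U \<psi>"
proof -
  define U where "U i = (if i < n then {i} else {})" for i
  define \<psi> where "\<psi> s = (LEAST i. s i \<or> i = n - 1)" for s :: "nat \<Rightarrow> bool"
  have le: "\<psi> s \<le> n - 1" for s
    unfolding \<psi>_def by (rule Least_le) simp
  have "\<psi> \<in> coins \<rightarrow>\<^sub>M count_space UNIV"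
    unfolding \<psi>_def by measurable
  moreover have "\<psi> s < n" for s
    using le[of s] assms by simp
  ultimately have "\<psi> \<in> coins \<rightarrow>\<^sub>M count_space {..<n}"
    by (auto simp: measurable_def vimage_def)
  moreover have "\<psi> (code U x) = x" if "x < n" for x
    unfolding \<psi>_def code_def U_def using that
    by (intro Least_equality) (auto split: if_splits)
  ultimately have "coded (count_space {..<n}) U \<psi>"
    by (auto simp: coded_def U_def)
  then show ?thesis by blast
qed

text \<open>The bits record membership in the balls of radius \<open>2\<^sup>-\<^sup>n\<close> around a countable dense sequence. The decoder
takes, at every scale, the first ball that is claimed to contain the point and returns the limit of the
centres of these balls if they form a Cauchy sequence; here completeness is needed. It is measurable because
distances to a fixed point depend measurably on the sequence of bits.\<close>

lemma standard_borel_imp_coded: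
  assumes "standard_borel M" and ne: "space M \<noteq> {}"
  shows "\<exists>U \<psi>. coded M U \<psi>"
proof -
  obtain X where X: "completely_metrizable_space X" "second_countable X"
    and sp: "topspace X = space M" and setsM: "sets M = sigma_sets (topspace X) {U. openin X U}"
    using assms(1) unfolding standard_borel_def by blast
  obtain S d where "Metric_space S d" and comp: "Metric_space.mcomplete S d"
    and XS: "X = Metric_space.mtopology S d"
    using X(1) by (auto simp: completely_metrizable_space_def)
  then interpret Metric_space S d by simp
  have S: "S = space M" using sp XS by simp
  obtain D where D: "countable D" "D \<subseteq> S" "mtopology closure_of D = S"
    using second_countable_imp_separable_space[OF X(2)] XS by (auto simp: separable_space_def)
  have "D \<noteq> {}" using D ne S by auto
  define a where "a = from_nat_into D"
  have aS: "a i \<in> S" for i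
    using from_nat_into[OF \<open>D \<noteq> {}\<close>] D by (auto simp: a_def)
  have dense: "\<exists>i. d (a i) x < e" if x: "x \<in> S" and e: "0 < e" for x e
  proof -
    have "x \<in> mtopology closure_of D" using D that by simp
    then obtain y where "y \<in> D" "y \<in> mball x e"
      using e unfolding metric_closure_of by blast
    moreover have "\<exists>i. y = a i"
      using from_nat_into_surj[OF D(1) \<open>y \<in> D\<close>] unfolding a_def by metis
    ultimately show ?thesis by (auto simp: commute)
  qed
  define U where "U k = (case prod_decode k of (n, i) \<Rightarrow> mball (a i) ((1/2)^n))" for k
  have open_sets: "W \<in> sets M" if "openin mtopology W" for W
    using that setsM XS by auto
  have U: "U k \<in> sets M" for k
    by (auto simp: U_def intro!: open_sets split: prod.split)
  define idx where "idx n s = (LEAST i. s (prod_encode (n, i)))" for n and s :: "nat \<Rightarrow> bool"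
  have idx [measurable]: "idx n \<in> coins \<rightarrow>\<^sub>M count_space UNIV" for n
    unfolding idx_def by measurable
  define conv where "conv s \<longleftrightarrow> (\<forall>k. \<exists>N. \<forall>n\<ge>N. \<forall>m\<ge>N. d (a (idx n s)) (a (idx m s)) < 1 / Suc k)" for s
  have dm [measurable]: "(\<lambda>s. d (a (idx n s)) (a (idx m s))) \<in> borel_measurable coins" for n m
  proof -
    have "(\<lambda>(i, j). d (a i) (a j)) \<in> borel_measurable (count_space UNIV \<Otimes>\<^sub>M count_space UNIV)"
      by (simp add: pair_measure_countable)
    then show ?thesis by measurable
  qed
  have conv_m [measurable]: "Measurable.pred coins conv"
    unfolding conv_def by measurable
  define p where "p n s = (if conv s then a (idx n s) else a 0)" for n s
  have pS: "p n s \<in> S" for n s using aS by (simp add: p_def)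
  have "\<exists>y. limitin mtopology (\<lambda>n. p n s) y sequentially" for s
  proof -
    have "MCauchy (\<lambda>n. p n s)"
    proof (cases "conv s")
      case True
      show ?thesis unfolding MCauchy_def
      proof (intro conjI allI impI)
        fix e :: real assume "0 < e"
        then obtain k where k: "1 / Suc k < e"
          using nat_approx_posE by blast
        obtain N where "\<forall>n\<ge>N. \<forall>m\<ge>N. d (a (idx n s)) (a (idx m s)) < 1 / Suc k"
          using True unfolding conv_def by blast
        then show "\<exists>N. \<forall>n n'. N \<le> n \<longrightarrow> N \<le> n' \<longrightarrow> d (p n s) (p n' s) < e"
          using k True by (fastforce simp: p_def)
      qed (use pS in auto)
    next
      case False
      then show ?thesis using aS by (auto simp: MCauchy_def p_def)
    qed
    then show ?thesis using comp unfolding mcomplete_def by blast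
  qed
  then obtain \<psi> where \<psi>: "\<And>s. limitin mtopology (\<lambda>n. p n s) (\<psi> s) sequentially" by metis
  have \<psi>S: "\<psi> s \<in> S" for s
    using \<psi>[of s] by (auto simp: limitin_def)
  have dist_lim: "(\<lambda>n. d (p n s) c) \<longlonglongrightarrow> d (\<psi> s) c" if "c \<in> S" for s c
  proof (rule real_tendsto_sandwich[of "\<lambda>n. d (\<psi> s) c - d (p n s) (\<psi> s)" _ _ "\<lambda>n. d (\<psi> s) c + d (p n s) (\<psi> s)"])
    have z: "(\<lambda>n. d (p n s) (\<psi> s)) \<longlonglongrightarrow> 0"
      using \<psi>[of s] by (simp add: limitin_metric_dist_null)
    show "(\<lambda>n. d (\<psi> s) c - d (p n s) (\<psi> s)) \<longlonglongrightarrow> d (\<psi> s) c"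
      using tendsto_diff[OF tendsto_const z, of "d (\<psi> s) c"] by simp
    show "(\<lambda>n. d (\<psi> s) c + d (p n s) (\<psi> s)) \<longlonglongrightarrow> d (\<psi> s) c"
      using tendsto_add[OF tendsto_const z, of "d (\<psi> s) c"] by simp
    show "\<forall>\<^sub>F n in sequentially. d (\<psi> s) c - d (p n s) (\<psi> s) \<le> d (p n s) c"
      using triangle[OF \<psi>S pS that] by (auto simp: commute algebra_simps intro!: always_eventually)
    show "\<forall>\<^sub>F n in sequentially. d (p n s) c \<le> d (\<psi> s) c + d (p n s) (\<psi> s)"
      using triangle[OF pS \<psi>S that] by (auto simp: commute algebra_simps intro!: always_eventually)
  qed
  have dc [measurable]: "(\<lambda>s. d (\<psi> s) c) \<in> borel_measurable coins" if "c \<in> S" for c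
  proof (rule borel_measurable_LIMSEQ_real[OF dist_lim[OF that]])
    fix n
    have [measurable]: "(\<lambda>i. d (a i) c) \<in> borel_measurable (count_space UNIV)" by simp
    have "(\<lambda>s. d (p n s) c) = (\<lambda>s. if conv s then d (a (idx n s)) c else d (a 0) c)"
      by (auto simp: p_def)
    then show "(\<lambda>s. d (p n s) c) \<in> borel_measurable coins" by simp
  qed
  have "\<psi> \<in> coins \<rightarrow>\<^sub>M M"
  proof (rule measurable_sigma_sets[OF setsM])
    show "{U. openin X U} \<subseteq> Pow (topspace X)" by (auto dest: openin_subset)
    show "\<psi> \<in> space coins \<rightarrow> topspace X" using \<psi>S XS by auto
    fix W assume "W \<in> {U. openin X U}"
    then have W: "openin mtopology W" using XS by simp
    define K where "K = {(i, n). mball (a i) ((1/2)^n) \<subseteq> W}"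
    have "x \<in> W \<longleftrightarrow> (\<exists>(i, n)\<in>K. d x (a i) < (1/2)^n)" if x: "x \<in> S" for x
    proof
      assume "x \<in> W"
      then obtain e where e: "0 < e" "mball x e \<subseteq> W"
        using W by (auto simp: openin_mtopology)
      obtain n where n: "(1/2)^n < e / 2"
        using real_arch_pow_inv[of "e/2" "1/2"] e by auto
      obtain i where i: "d (a i) x < (1/2)^n" using dense[OF x, of "(1/2)^n"] by auto
      have "mball (a i) ((1/2)^n) \<subseteq> mball x e"
      proof
        fix y assume y: "y \<in> mball (a i) ((1/2)^n)"
        have "d x y \<le> d x (a i) + d (a i) y" using triangle[of x "a i" y] that aS y by auto
        also have "\<dots> < e" using i n y by (auto simp: commute)
        finally show "y \<in> mball x e" using that y by auto
      qed
      then show "\<exists>(i, n)\<in>K. d x (a i) < (1/2)^n"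
        using e i by (auto simp: K_def commute intro!: bexI[of _ "(i, n)"])
    next
      assume "\<exists>(i, n)\<in>K. d x (a i) < (1/2)^n"
      then obtain i n where in_: "mball (a i) ((1/2)^n) \<subseteq> W" "d x (a i) < (1/2)^n"
        by (auto simp: K_def)
      then have "x \<in> mball (a i) ((1/2)^n)" using that aS by (auto simp: commute)
      then show "x \<in> W" using in_ by auto
    qed
    then have "\<psi> -` W \<inter> space coins = (\<Union>(i, n)\<in>K. {s\<in>space coins. d (\<psi> s) (a i) < (1/2)^n})"
      using \<psi>S by auto
    also have "\<dots> \<in> sets coins"
    proof (intro sets.countable_UN' image_subsetI)
      fix k assume "k \<in> K"
      have [measurable]: "(\<lambda>s. d (\<psi> s) (a (fst k))) \<in> borel_measurable coins"
        using dc aS by simp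
      have "{s \<in> space coins. d (\<psi> s) (a (fst k)) < (1/2)^snd k} \<in> sets coins"
        by measurable
      then show "(case k of (i, n) \<Rightarrow> {s \<in> space coins. d (\<psi> s) (a i) < (1/2)^n}) \<in> sets coins"
        by (simp add: case_prod_beta)
    qed auto
    finally show "\<psi> -` W \<inter> space coins \<in> sets coins" .
  qed
  moreover have "\<psi> (code U x) = x" if "x \<in> space M" for x
  proof -
    have x: "x \<in> S" using that S by simp
    have near: "d (a (idx n (code U x))) x < (1/2)^n" for n
    proof -
      have "\<exists>i. code U x (prod_encode (n, i))"
        using dense[OF x, of "(1/2)^n"] x aS by (auto simp: code_def U_def)
      then have "code U x (prod_encode (n, idx n (code U x)))"
        unfolding idx_def by (rule LeastI_ex)
      then show ?thesis by (auto simp: code_def U_def)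
    qed
    have "conv (code U x)" unfolding conv_def
    proof
      fix k
      define e :: real where "e = 1 / Suc k"
      obtain N where N: "(1/2)^N < e / 2"
        using real_arch_pow_inv[of "e / 2" "1/2"] by (auto simp: e_def)
      show "\<exists>N. \<forall>n\<ge>N. \<forall>m\<ge>N. d (a (idx n (code U x))) (a (idx m (code U x))) < 1 / Suc k"
      proof (intro exI allI impI)
        fix n m assume "N \<le> n" "N \<le> m"
        then have "(1/2::real)^n \<le> (1/2)^N" "(1/2::real)^m \<le> (1/2)^N"
          by (auto intro!: power_decreasing)
        then show "d (a (idx n (code U x))) (a (idx m (code U x))) < 1 / Suc k"
          using triangle[OF aS x aS, of "idx n (code U x)" "idx m (code U x)"]
            near[of n] near[of m] N commute[of x "a (idx m (code U x))"]
          unfolding e_def[symmetric] by linarith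
      qed
    qed
    then have "limitin mtopology (\<lambda>n. a (idx n (code U x))) (\<psi> (code U x)) sequentially"
      using \<psi>[of "code U x"] by (simp add: p_def)
    moreover have "limitin mtopology (\<lambda>n. a (idx n (code U x))) x sequentially"
      unfolding limitin_metric_dist_null
    proof (intro conjI)
      show "(\<lambda>n. d (a (idx n (code U x))) x) \<longlonglongrightarrow> 0"
      proof (rule real_tendsto_sandwich[of "\<lambda>_. 0" _ _ "\<lambda>n. (1/2)^n"])
        show "\<forall>\<^sub>F n in sequentially. d (a (idx n (code U x))) x \<le> (1 / 2) ^ n"
          using near less_imp_le by (intro always_eventually) blast
      qed (auto intro: LIMSEQ_realpow_zero)
    qed (use x aS in auto)
    ultimately show ?thesis
      by (meson limitin_metric_unique trivial_limit_sequentially)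
  qed
  ultimately have "coded M U \<psi>" using U by (auto simp: coded_def)
  then show ?thesis by blast
qed

section \<open>Isomorphisms that respect a labelling\<close>

definition tern :: "(nat \<Rightarrow> bool) \<Rightarrow> real" where
  "tern s = (\<Sum>i. of_bool (s i) * (1/3)^i)"

fun tern_rest :: "real \<Rightarrow> nat \<Rightarrow> real" where
  "tern_rest r 0 = r"
| "tern_rest r (Suc i) = 3 * (tern_rest r i - of_bool (1 \<le> tern_rest r i))"

lemma summable_tern: "summable (\<lambda>i. of_bool (s i) * (1/3::real)^i)"
  by (rule summable_comparison_test[of _ "\<lambda>i. (1/3)^i"]) (auto intro!: exI[of _ 0])

lemma tern_bounds: "0 \<le> tern s" "tern s \<le> 3/2"
proof -
  show "0 \<le> tern s"
    unfolding tern_def by (rule suminf_nonneg[OF summable_tern]) auto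
  have "tern s \<le> (\<Sum>i. (1/3)^i)"
    unfolding tern_def by (rule suminf_le[OF _ summable_tern]) auto
  then show "tern s \<le> 3/2" by (simp add: suminf_geometric)
qed

lemma tern_step: "tern s = of_bool (s 0) + tern (\<lambda>i. s (Suc i)) / 3"
proof -
  have "tern s = of_bool (s 0) + (\<Sum>i. of_bool (s (Suc i)) * (1/3)^Suc i)"
    unfolding tern_def using suminf_split_head[OF summable_tern, of s] by simp
  also have "(\<Sum>i. of_bool (s (Suc i)) * (1/3::real)^Suc i) = (\<Sum>i. (of_bool (s (Suc i)) * (1/3)^i) / 3)"
    by (simp add: field_simps)
  also have "\<dots> = tern (\<lambda>i. s (Suc i)) / 3"
    unfolding tern_def by (rule suminf_divide[OF summable_tern])
  finally show ?thesis .
qed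

lemma first_digit: "1 \<le> tern s \<longleftrightarrow> s 0"
  using tern_step[of s] tern_bounds[of "\<lambda>i. s (Suc i)"] by (auto simp: of_bool_def split: if_splits)

text \<open>Ternary expansions with digits \<open>0\<close> and \<open>1\<close> are unique, so stripping leading digits recovers the bits. With
base two the ambiguity of dyadic rationals would spoil the decoder.\<close>

lemma tern_rest_tern: "tern_rest (tern s) i = tern (\<lambda>j. s (i + j))"
proof (induction i)
  case (Suc i)
  have "tern (\<lambda>j. s (i + j)) = of_bool (s i) + tern (\<lambda>j. s (Suc i + j)) / 3"
    using tern_step[of "\<lambda>j. s (i + j)"] by simp
  then show ?case
    using Suc first_digit[of "\<lambda>j. s (i + j)"] by (simp add: of_bool_def)
qed simp

lemma measurable_tern [measurable]: "tern \<in> borel_measurable coins"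
  unfolding tern_def of_bool_def by measurable

lemma measurable_tern_rest [measurable]: "(\<lambda>r. tern_rest r i) \<in> borel_measurable borel"
  by (induction i) (simp_all add: of_bool_def)

lemma coded_real:
  assumes "coded N U \<psi>"
  obtains \<phi> \<xi> where "\<phi> \<in> borel_measurable N" "\<xi> \<in> borel \<rightarrow>\<^sub>M N"
    and "\<forall>x. 0 \<le> \<phi> x \<and> \<phi> x \<le> (3/2::real)" "\<forall>x\<in>space N. \<xi> (\<phi> x) = x"
proof
  note [measurable] = measurable_code[OF assms]
  have [measurable]: "\<psi> \<in> coins \<rightarrow>\<^sub>M N" using assms by (simp add: coded_def)
  show "(\<lambda>x. tern (code U x)) \<in> borel_measurable N" by measurable
  have [measurable]: "(\<lambda>r i. 1 \<le> tern_rest r i) \<in> borel \<rightarrow>\<^sub>M coins"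
    by (rule measurable_into_coins) measurable
  show "(\<lambda>r. \<psi> (\<lambda>i. 1 \<le> tern_rest r i)) \<in> borel \<rightarrow>\<^sub>M N" by measurable
  show "\<forall>x\<in>space N. \<psi> (\<lambda>i. 1 \<le> tern_rest (tern (code U x)) i) = x"
    using assms by (simp add: tern_rest_tern first_digit coded_def)
  show "\<forall>x. 0 \<le> tern (code U x) \<and> tern (code U x) \<le> 3/2"
    using tern_bounds by blast
qed

definition unit_uniform :: "real measure" where
  "unit_uniform = distr (restrict_space lborel {0<..<1}) borel (\<lambda>u. u)"

lemma measurable_id_unit: "(\<lambda>u. u) \<in> restrict_space lborel {0<..<1::real} \<rightarrow>\<^sub>M borel"
  by (simp add: measurable_restrict_space1)

lemma sets_unit_uniform [measurable_cong, simp]: "sets unit_uniform = sets borel"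
  by (simp add: unit_uniform_def)

lemma AE_unit_uniform: "AE u in unit_uniform. 0 < u \<and> u < 1"
  unfolding unit_uniform_def
  by (subst AE_distr_iff[OF measurable_id_unit]) (simp, rule AE_I2, simp add: space_restrict_space)

lemma AE_unit_uniform_neq: "AE u in unit_uniform. u \<noteq> c"
proof -
  have "AE u in lborel. u \<in> {0<..<1} \<longrightarrow> u \<noteq> c"
    using AE_lborel_singleton[of c] by eventually_elim simp
  then have "AE u in restrict_space lborel {0<..<1}. u \<noteq> c"
    by (subst AE_restrict_space_iff) auto
  then show ?thesis
    unfolding unit_uniform_def by (subst AE_distr_iff[OF measurable_id_unit]) auto
qed

text \<open>For an atomless distribution the quantile function pushes the uniform distribution forward to \<open>M\<close>, and continuity
of the distribution function makes it an exact right inverse.\<close>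

lemma (in cdf_distribution) quantile_transform:
  assumes atomless: "\<And>r. measure M {r} = 0"
  obtains G where "G \<in> borel_measurable borel" "distr unit_uniform borel G = M"
    "\<And>u. 0 < u \<Longrightarrow> u < 1 \<Longrightarrow> C (G u) = u"
proof
  let ?G = "\<lambda>u. if u \<in> {0<..<1} then I u else 0"
  show G: "?G \<in> borel_measurable borel"
    using measurable_CI by (subst (asm) measurable_restrict_space_iff) auto
  have "distr unit_uniform borel ?G = distr (restrict_space lborel {0<..<1}) borel (?G \<circ> (\<lambda>u. u))"
    unfolding unit_uniform_def by (rule distr_distr[OF G measurable_id_unit])
  also have "\<dots> = distr (restrict_space lborel {0<..<1}) borel I"
    by (rule distr_cong) (auto simp: space_restrict_space)
  also have "\<dots> = M" by (rule distr_I_eq_M)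
  finally show "distr unit_uniform borel ?G = M" .
  fix u :: real assume u: "0 < u" "u < 1"
  have "u \<le> C (I u)" using pseudoinverse[OF u] by blast
  moreover have "C (I u) \<le> u"
  proof (rule tendsto_upperbound)
    show "(C \<longlongrightarrow> C (I u)) (at_left (I u))"
      using isCont_cdf[of "I u"] atomless by (simp add: isCont_def filterlim_at_split)
    show "\<forall>\<^sub>F x in at_left (I u). C x \<le> u"
    proof (rule eventually_at_leftI[of "I u - 1"])
      fix x assume "x \<in> {I u - 1<..<I u}"
      then have "\<not> u \<le> C x" using pseudoinverse[OF u, of x] by simp
      then show "C x \<le> u" by simp
    qed simp
  qed simp
  ultimately show "C (?G u) = u" using u by simp
qed

text \<open>Adding the label to a real coordinate that varies within \<open>[1/2, 7/8]\<close> gives a real embedding whose integer part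
is the label. Its distribution function maps \<open>N\<close> isomorphically, up to null sets, onto the uniform distribution,
and by monotonicity it takes the points with labels below \<open>k\<close> to an initial interval. The end of this interval depends on the
distribution of the labels only, which is what allows two such isomorphisms to be composed below.\<close>

lemma uniformization:
  fixes b :: "'a \<Rightarrow> nat"
  assumes "prob_space N" and coded: "coded N U \<psi>" and atomless: "\<And>x. x \<in> space N \<Longrightarrow> measure N {x} = 0"
    and b [measurable]: "b \<in> N \<rightarrow>\<^sub>M count_space UNIV"
  obtains \<alpha> \<gamma> where "\<alpha> \<in> borel_measurable N" "\<gamma> \<in> borel \<rightarrow>\<^sub>M N" "distr N borel \<alpha> = unit_uniform"
    "AE x in N. \<gamma> (\<alpha> x) = x"
    "\<forall>k. AE x in N. b x < k \<longleftrightarrow> \<alpha> x < measure N {x\<in>space N. b x < k}"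
proof -
  interpret prob_space N by fact
  obtain \<phi> \<xi> where [measurable]: "\<phi> \<in> borel_measurable N" "\<xi> \<in> borel \<rightarrow>\<^sub>M N"
    and \<phi>': "\<forall>x. 0 \<le> \<phi> x \<and> \<phi> x \<le> (3/2::real)" "\<forall>x\<in>space N. \<xi> (\<phi> x) = x"
    by (rule coded_real[OF coded])
  have \<phi>: "0 \<le> \<phi> x" "\<phi> x \<le> 3/2" "x \<in> space N \<Longrightarrow> \<xi> (\<phi> x) = x" for x
    using \<phi>' by auto
  \<comment> \<open>The offset keeps the fractional part of \<open>f\<close> away from \<open>0\<close>, so that \<open>f x \<le> k\<close> is equivalent to \<open>b x < k\<close>.\<close>
  define f where "f x = real (b x) + \<phi> x / 4 + 1/2" for x
  have [measurable]: "f \<in> borel_measurable N" unfolding f_def by measurable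
  define g where "g r = \<xi> (4 * (r - of_int \<lfloor>r\<rfloor> - 1/2))" for r :: real
  have [measurable]: "g \<in> borel \<rightarrow>\<^sub>M N" unfolding g_def by measurable
  have floor_f: "\<lfloor>f x\<rfloor> = int (b x)" for x
    using \<phi>(1,2)[of x] by (intro floor_unique) (auto simp: f_def)
  have gf: "g (f x) = x" if "x \<in> space N" for x
    using \<phi>(3)[OF that] unfolding g_def floor_f by (simp add: f_def)
  define \<rho> where "\<rho> = distr N borel f"
  interpret \<rho>: real_distribution \<rho>
    unfolding \<rho>_def by (rule real_distribution_distr) measurable
  interpret \<rho>: cdf_distribution \<rho> by standard
  have "measure \<rho> {r} = 0" for r
  proof (cases "\<exists>x\<in>space N. f x = r")
    case True
    then obtain x where x: "x \<in> space N" "f x = r" by blast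
    have "f -` {r} \<inter> space N = {x}"
    proof (intro equalityI subsetI)
      fix y assume "y \<in> f -` {r} \<inter> space N"
      then show "y \<in> {x}" using gf[of y] gf[of x] x by simp
    qed (use x in simp)
    then show ?thesis using atomless[OF x(1)] by (simp add: \<rho>_def measure_distr)
  next
    case False
    then have "f -` {r} \<inter> space N = {}" by auto
    then show ?thesis by (simp add: \<rho>_def measure_distr)
  qed
  then obtain G where [measurable]: "G \<in> borel_measurable borel" and G: "distr unit_uniform borel G = \<rho>"
    and CG: "\<And>u. 0 < u \<Longrightarrow> u < 1 \<Longrightarrow> \<rho>.C (G u) = u"
    using \<rho>.quantile_transform by blast
  show thesis
  proof
    show "(\<lambda>x. \<rho>.C (f x)) \<in> borel_measurable N" "(\<lambda>u. g (G u)) \<in> borel \<rightarrow>\<^sub>M N" by measurable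
    have "distr N borel (\<lambda>x. \<rho>.C (f x)) = distr (distr N borel f) borel \<rho>.C"
      by (subst distr_distr) (measurable, simp add: comp_def)
    also have "distr N borel f = distr unit_uniform borel G"
      by (simp add: G \<rho>_def)
    also have "distr (distr unit_uniform borel G) borel \<rho>.C = distr unit_uniform borel (\<lambda>u. \<rho>.C (G u))"
      by (subst distr_distr) (measurable, simp add: comp_def)
    also have "\<dots> = distr unit_uniform unit_uniform (\<lambda>u. u)"
      using AE_unit_uniform by (intro distr_cong_AE) (auto simp: CG)
    finally show dist: "distr N borel (\<lambda>x. \<rho>.C (f x)) = unit_uniform" by simp
    have "AE u in unit_uniform. G (\<rho>.C (G u)) = G u"
      using AE_unit_uniform by eventually_elim (simp add: CG)
    then have "AE r in distr unit_uniform borel G. G (\<rho>.C r) = r"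
      by (subst AE_distr_iff) measurable
    then have "AE r in distr N borel f. G (\<rho>.C r) = r"
      by (simp only: G flip: \<rho>_def)
    then have "AE x in N. G (\<rho>.C (f x)) = f x"
      by (rule AE_distrD[rotated]) measurable
    then show "AE x in N. g (G (\<rho>.C (f x))) = x"
      using AE_space by eventually_elim (simp add: gf)
    show "\<forall>k. AE x in N. b x < k \<longleftrightarrow> \<rho>.C (f x) < measure N {x\<in>space N. b x < k}"
    proof
    fix k
    have fk: "f x \<le> real k \<longleftrightarrow> b x < k" for x
      using \<phi>(1,2)[of x] by (cases "b x < k") (auto simp: f_def)
    have "f -` {..real k} \<inter> space N = {x\<in>space N. b x < k}"
      using fk by auto
    then have Ck: "\<rho>.C (real k) = measure N {x\<in>space N. b x < k}"
      unfolding cdf_def unfolding \<rho>_def by (simp add: measure_distr)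
    have "AE x in unit_uniform. x \<noteq> \<rho>.C (real k)" by (rule AE_unit_uniform_neq)
    then have "AE x in distr N borel (\<lambda>x. \<rho>.C (f x)). x \<noteq> \<rho>.C (real k)" by (simp only: dist)
    then have "AE x in N. \<rho>.C (f x) \<noteq> \<rho>.C (real k)"
      by (rule AE_distrD[rotated]) measurable
    then show "AE x in N. b x < k \<longleftrightarrow> \<rho>.C (f x) < measure N {x\<in>space N. b x < k}"
    proof eventually_elim
      case (elim x)
      show ?case
      proof (cases "b x < k")
        case True
        then have "\<rho>.C (f x) \<le> \<rho>.C (real k)" using fk by (intro \<rho>.cdf_nondecreasing) simp
        then show ?thesis using True elim Ck by simp
      next
        case False
        then have "\<rho>.C (real k) \<le> \<rho>.C (f x)" using fk[of x] by (intro \<rho>.cdf_nondecreasing) simp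
        then show ?thesis using False elim Ck by simp
      qed
    qed
    qed
  qed
qed

lemma uniformizing_inverse:
  assumes [measurable]: "f \<in> borel_measurable K" "g \<in> borel \<rightarrow>\<^sub>M K"
    and f: "distr K borel f = unit_uniform" "AE x in K. g (f x) = x"
  shows "distr unit_uniform K g = K" "AE u in unit_uniform. f (g u) = u"
proof -
  have "distr unit_uniform K g = distr (distr K borel f) K g"
    by (simp add: f(1))
  also have "\<dots> = distr K K (\<lambda>x. g (f x))"
    by (subst distr_distr) (measurable, simp add: comp_def)
  also have "\<dots> = distr K K (\<lambda>x. x)"
    using f(2) by (intro distr_cong_AE) auto
  finally show "distr unit_uniform K g = K" by simp
  have "AE x in K. f (g (f x)) = f x"
    using f(2) by eventually_elim simp
  then have "AE u in distr K borel f. f (g u) = u"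
    by (subst AE_distr_iff) measurable
  then show "AE u in unit_uniform. f (g u) = u" by (simp only: f(1))
qed

text \<open>Two atomless coded probability spaces whose labels are equally distributed are isomorphic up to null
sets by a map that preserves labels: pass through the uniform distribution.\<close>

lemma labelled_isomorphism:
  fixes bM :: "'a \<Rightarrow> nat" and bN :: "'b \<Rightarrow> nat"
  assumes M: "prob_space M" "coded M U \<psi>" "\<And>x. x \<in> space M \<Longrightarrow> measure M {x} = 0"
    and N: "prob_space N" "coded N V \<xi>" "\<And>x. x \<in> space N \<Longrightarrow> measure N {x} = 0"
    and b [measurable]: "bM \<in> M \<rightarrow>\<^sub>M count_space UNIV" "bN \<in> N \<rightarrow>\<^sub>M count_space UNIV"
    and same: "\<And>k. measure M {x\<in>space M. bM x < k} = measure N {x\<in>space N. bN x < k}"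
  obtains \<beta> \<beta>' where "\<beta> \<in> N \<rightarrow>\<^sub>M M" "\<beta>' \<in> M \<rightarrow>\<^sub>M N" "distr N M \<beta> = M" "distr M N \<beta>' = N"
    "AE y in N. \<beta>' (\<beta> y) = y" "AE x in M. \<beta> (\<beta>' x) = x" "AE y in N. bM (\<beta> y) = bN y"
proof -
  obtain \<alpha> \<gamma> where [measurable]: "\<alpha> \<in> borel_measurable M" "\<gamma> \<in> borel \<rightarrow>\<^sub>M M"
    and \<alpha>: "distr M borel \<alpha> = unit_uniform" "AE x in M. \<gamma> (\<alpha> x) = x"
    "\<forall>k. AE x in M. bM x < k \<longleftrightarrow> \<alpha> x < measure M {x\<in>space M. bM x < k}"
    by (rule uniformization[OF M b(1)])
  obtain \<alpha>' \<gamma>' where [measurable]: "\<alpha>' \<in> borel_measurable N" "\<gamma>' \<in> borel \<rightarrow>\<^sub>M N"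
    and \<alpha>': "distr N borel \<alpha>' = unit_uniform" "AE x in N. \<gamma>' (\<alpha>' x) = x"
    "\<forall>k. AE x in N. bN x < k \<longleftrightarrow> \<alpha>' x < measure N {x\<in>space N. bN x < k}"
    by (rule uniformization[OF N b(2)])
  note \<gamma> = uniformizing_inverse[OF _ _ \<alpha>(1,2), simplified]
    and \<gamma>' = uniformizing_inverse[OF _ _ \<alpha>'(1,2), simplified]
  have pull: "AE y in N. P (\<alpha>' y)" if "AE u in unit_uniform. P u" for P
  proof -
    have "AE u in distr N borel \<alpha>'. P u" using that by (simp only: \<alpha>'(1))
    then show ?thesis by (rule AE_distrD[rotated]) measurable
  qed
  have pull': "AE x in M. P (\<alpha> x)" if "AE u in unit_uniform. P u" for P
  proof -
    have "AE u in distr M borel \<alpha>. P u" using that by (simp only: \<alpha>(1))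
    then show ?thesis by (rule AE_distrD[rotated]) measurable
  qed
  show thesis
  proof
    show "(\<lambda>y. \<gamma> (\<alpha>' y)) \<in> N \<rightarrow>\<^sub>M M" "(\<lambda>x. \<gamma>' (\<alpha> x)) \<in> M \<rightarrow>\<^sub>M N" by measurable
    have "distr N M (\<lambda>y. \<gamma> (\<alpha>' y)) = distr (distr N borel \<alpha>') M \<gamma>"
      by (subst distr_distr) (auto simp: comp_def)
    then show "distr N M (\<lambda>y. \<gamma> (\<alpha>' y)) = M" using \<gamma>(1) \<alpha>'(1) by simp
    have "distr M N (\<lambda>x. \<gamma>' (\<alpha> x)) = distr (distr M borel \<alpha>) N \<gamma>'"
      by (subst distr_distr) (auto simp: comp_def)
    then show "distr M N (\<lambda>x. \<gamma>' (\<alpha> x)) = N" using \<gamma>'(1) \<alpha>(1) by simp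
    show "AE y in N. \<gamma>' (\<alpha> (\<gamma> (\<alpha>' y))) = y"
      using pull[OF \<gamma>(2)] \<alpha>'(2) by eventually_elim simp
    show "AE x in M. \<gamma> (\<alpha>' (\<gamma>' (\<alpha> x))) = x"
      using pull'[OF \<gamma>'(2)] \<alpha>(2) by eventually_elim simp
    have "AE x in M. \<forall>k. bM x < k \<longleftrightarrow> \<alpha> x < measure M {x\<in>space M. bM x < k}"
      using \<alpha>(3) by (simp add: AE_all_countable)
    with \<alpha>(2) have "AE x in M. \<forall>k. bM (\<gamma> (\<alpha> x)) < k \<longleftrightarrow> \<alpha> x < measure M {x\<in>space M. bM x < k}"
      by eventually_elim simp
    then have "AE u in distr M borel \<alpha>. \<forall>k. bM (\<gamma> u) < k \<longleftrightarrow> u < measure M {x\<in>space M. bM x < k}"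
      by (subst AE_distr_iff) measurable
    then have "AE u in unit_uniform. \<forall>k. bM (\<gamma> u) < k \<longleftrightarrow> u < measure M {x\<in>space M. bM x < k}"
      by (simp only: \<alpha>(1))
    from pull[OF this]
    have 1: "AE y in N. \<forall>k. bM (\<gamma> (\<alpha>' y)) < k \<longleftrightarrow> \<alpha>' y < measure M {x\<in>space M. bM x < k}" .
    have "AE y in N. \<forall>k. bN y < k \<longleftrightarrow> \<alpha>' y < measure N {x\<in>space N. bN x < k}"
      using \<alpha>'(3) by (simp add: AE_all_countable)
    with 1 show "AE y in N. bM (\<gamma> (\<alpha>' y)) = bN y"
    proof eventually_elim
      case (elim y)
      then have "bM (\<gamma> (\<alpha>' y)) < k \<longleftrightarrow> bN y < k" for k by (simp add: same)
      from this[of "bN y"] this[of "bM (\<gamma> (\<alpha>' y))"] show ?case by auto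
    qed
  qed
qed

section \<open>Transformations realizing a cyclic pattern\<close>

context
  fixes M :: "'a measure" and T :: "'a \<Rightarrow> 'a"
  assumes T: "T \<in> transformations M"
begin

lemma transformation_bij: "bij_betw T (space M) (space M)"
  and transformation_measurable: "T \<in> M \<rightarrow>\<^sub>M M"
  and transformation_inv_measurable: "inv_into (space M) T \<in> M \<rightarrow>\<^sub>M M"
  and transformation_distr: "distr M M T = M"
  using T by (auto simp: transformations_def)

lemma transformation_inj: "inj_on T (space M)"
  using transformation_bij by (simp add: bij_betw_def)

lemma transformation_space: "x \<in> space M \<Longrightarrow> T x \<in> space M"
  using transformation_bij by (auto simp: bij_betw_def)

lemma transformation_inv_left: "x \<in> space M \<Longrightarrow> inv_into (space M) T (T x) = x"
  using transformation_inj by (rule inv_into_f_f)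

lemma transformation_inv_right: "x \<in> space M \<Longrightarrow> T (inv_into (space M) T x) = x"
  using transformation_bij by (simp add: bij_betw_def f_inv_into_f)

lemma transformation_mem_image_iff:
  "A \<subseteq> space M \<Longrightarrow> x \<in> space M \<Longrightarrow> T x \<in> T ` A \<longleftrightarrow> x \<in> A"
  using transformation_inj by (simp add: inj_on_image_mem_iff)

lemma transformation_image_vimage:
  "A \<subseteq> space M \<Longrightarrow> T ` A = inv_into (space M) T -` A \<inter> space M"
  using transformation_inv_left transformation_inv_right transformation_space
  by (force simp: subset_iff)

lemma transformation_image_emeasure:
  assumes A: "A \<in> sets M"
  shows "emeasure M (T ` A) = emeasure M A"
proof -
  have "T -` (T ` A) \<inter> space M = A"
    using transformation_mem_image_iff[OF sets.sets_into_space[OF A]] sets.sets_into_space[OF A] by auto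
  then show ?thesis
    using transformation_vimage[OF T transformation_image_sets[OF T A]] by simp
qed

lemma transformation_image_measure: "A \<in> sets M \<Longrightarrow> measure M (T ` A) = measure M A"
  by (simp add: measure_def transformation_image_emeasure)

lemma transformation_image_sym_diff:
  assumes "A \<subseteq> space M" "B \<subseteq> space M"
  shows "sym_diff (T ` A) (T ` B) = T ` sym_diff A B"
proof -
  have "A - B \<subseteq> space M" "B - A \<subseteq> space M" using assms by auto
  then show ?thesis
    using assms inj_on_image_set_diff[OF transformation_inj, of A B]
      inj_on_image_set_diff[OF transformation_inj, of B A] by (simp add: image_Un)
qed

lemma transformation_inv: "inv_into (space M) T \<in> transformations M"
proof -
  let ?S = "inv_into (space M) T"
  have bij: "bij_betw ?S (space M) (space M)"
    using transformation_bij by (rule bij_betw_inv_into)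
  have "inv_into (space M) ?S \<in> M \<rightarrow>\<^sub>M M"
  proof (subst measurable_cong)
    fix x assume x: "x \<in> space M"
    show "inv_into (space M) ?S x = T x"
      using transformation_inv_left[OF x] transformation_space[OF x] bij
      by (metis bij_betw_def inv_into_f_f)
  qed (rule transformation_measurable)
  moreover have "distr M M ?S = M"
  proof (rule measure_eqI)
    fix A assume "A \<in> sets (distr M M ?S)"
    then have A: "A \<in> sets M" by simp
    then show "emeasure (distr M M ?S) A = emeasure M A"
      using transformation_image_vimage[OF sets.sets_into_space[OF A]] transformation_image_emeasure[OF A]
      by (simp add: emeasure_distr[OF transformation_inv_measurable])
  qed simp
  ultimately show ?thesis
    using bij transformation_inv_measurable by (simp add: transformations_def)
qed

end

lemma transformation_id: "(\<lambda>x. x) \<in> transformations M"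
proof -
  have "inv_into (space M) (\<lambda>x. x) \<in> M \<rightarrow>\<^sub>M M"
    by (subst measurable_cong[where g="\<lambda>x. x"]) (auto simp: inv_into_f_f[where f="\<lambda>x. x", simplified])
  then show ?thesis by (simp add: transformations_def bij_betw_def)
qed

lemma transformation_comp:
  assumes S: "S \<in> transformations M" and T: "T \<in> transformations M"
  shows "S \<circ> T \<in> transformations M"
proof -
  note [measurable] = transformation_measurable[OF S] transformation_measurable[OF T]
    transformation_inv_measurable[OF S] transformation_inv_measurable[OF T]
  have bij: "bij_betw (S \<circ> T) (space M) (space M)"
    using transformation_bij[OF S] transformation_bij[OF T] by (rule bij_betw_trans[rotated])
  have "inv_into (space M) (S \<circ> T) \<in> M \<rightarrow>\<^sub>M M"
  proof (subst measurable_cong)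
    fix x assume x: "x \<in> space M"
    let ?y = "inv_into (space M) T (inv_into (space M) S x)"
    have y: "?y \<in> space M" "(S \<circ> T) ?y = x"
      using transformation_space[OF transformation_inv[OF S] x]
        transformation_space[OF transformation_inv[OF T]] x
      by (simp_all add: transformation_inv_right[OF S] transformation_inv_right[OF T])
    show "inv_into (space M) (S \<circ> T) x = ?y"
      using inv_into_f_f[OF bij_betw_imp_inj_on[OF bij] y(1)] y(2) by simp
  qed measurable
  moreover have "distr M M (S \<circ> T) = M"
    using distr_distr[of S M M T M] transformation_distr[OF S] transformation_distr[OF T] by simp
  moreover have "S \<circ> T \<in> M \<rightarrow>\<^sub>M M" by measurable
  ultimately show ?thesis using bij by (simp add: transformations_def)
qed

lemma transformation_pow: "T \<in> transformations M \<Longrightarrow> T ^^ n \<in> transformations M"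
  by (induction n) (auto simp: transformation_comp transformation_id[unfolded id_def[symmetric]] id_def[symmetric])

lemma preserving_pow:
  assumes "f \<in> M \<rightarrow>\<^sub>M M" "distr M M f = M"
  shows "f ^^ n \<in> M \<rightarrow>\<^sub>M M \<and> distr M M (f ^^ n) = M"
proof (induction n)
  case (Suc n)
  then have "f \<circ> f ^^ n \<in> M \<rightarrow>\<^sub>M M"
    using measurable_comp[of "f ^^ n" M M f M] assms by blast
  moreover have "distr M M (f \<circ> f ^^ n) = M"
    using distr_distr[of f M M "f ^^ n" M] assms Suc by simp
  ultimately show ?case by (simp only: funpow.simps)
qed (simp add: id_def)

lemma AE_preserving:
  assumes "AE x in N. P x" "f \<in> M \<rightarrow>\<^sub>M N" "distr M N f = N"
  shows "AE x in M. P (f x)"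
proof -
  have "AE x in distr M N f. P x" using assms by (simp only:)
  then show ?thesis by (rule AE_distrD[OF assms(2)])
qed

text \<open>An almost everywhere invertible map becomes a bijection after being replaced by the identity off the set
\<open>K\<close> of points whose forward and backward orbits avoid the null set where the inverse relations fail.
This set is conull and is mapped onto itself.\<close>

lemma AE_invertible_imp_transformation:
  assumes f: "f \<in> M \<rightarrow>\<^sub>M M" "distr M M f = M" and g: "g \<in> M \<rightarrow>\<^sub>M M" "distr M M g = M"
    and gf: "AE x in M. g (f x) = x" and fg: "AE x in M. f (g x) = x"
  obtains T where "T \<in> transformations M" "AE x in M. T x = f x"
proof -
  have "AE x in M. g (f x) = x \<and> f (g x) = x" using gf fg by eventually_elim simp
  then obtain Z where Z: "Z \<in> null_sets M" "{x\<in>space M. \<not> (g (f x) = x \<and> f (g x) = x)} \<subseteq> Z"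
    by (auto simp: eventually_ae_filter)
  define E where "E = space M - Z"
  have [measurable]: "E \<in> sets M" using Z by (auto simp: E_def)
  have E: "g (f x) = x" "f (g x) = x" if "x \<in> E" for x using that Z by (auto simp: E_def)
  have AE_E: "AE x in M. x \<in> E"
    using AE_not_in[OF Z(1)] AE_space by eventually_elim (simp add: E_def)
  have [measurable]: "f ^^ n \<in> M \<rightarrow>\<^sub>M M" "g ^^ n \<in> M \<rightarrow>\<^sub>M M" for n
    using preserving_pow f g by blast+
  note [measurable] = f(1) g(1)
  define K where "K = {x\<in>space M. \<forall>n. (f ^^ n) x \<in> E \<and> (g ^^ n) x \<in> E}"
  have K [measurable]: "K \<in> sets M" unfolding K_def by measurable
  have AE_K: "AE x in M. x \<in> K"
  proof -
    have "AE x in M. (f ^^ n) x \<in> E" "AE x in M. (g ^^ n) x \<in> E" for n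
      using AE_preserving[OF AE_E] preserving_pow[OF f] preserving_pow[OF g] by blast+
    then have "AE x in M. \<forall>n. (f ^^ n) x \<in> E \<and> (g ^^ n) x \<in> E"
      by (simp add: AE_all_countable)
    then show ?thesis using AE_space by eventually_elim (simp add: K_def)
  qed
  have KE: "x \<in> E" if "x \<in> K" for x
    using that by (auto simp: K_def dest: spec[of _ 0])
  have step: "a x \<in> K"
    if x: "x \<in> K" and ab: "(a = f \<and> b = g) \<or> (a = g \<and> b = f)" for a b x
  proof -
    have orb: "(a ^^ n) x \<in> E" "(b ^^ n) x \<in> E" for n
      using x ab by (auto simp: K_def)
    have "a x \<in> space M"
      using orb(1)[of 1] by (auto simp: E_def)
    moreover have "(a ^^ n) (a x) \<in> E" for n
      using orb(1)[of "Suc n"] by (simp add: funpow_swap1)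
    moreover have "(b ^^ n) (a x) \<in> E" for n
    proof (cases n)
      case 0
      then show ?thesis using orb(1)[of 1] by simp
    next
      case (Suc k)
      have "b (a x) = x" using E KE[OF x] ab by auto
      then have "(b ^^ n) (a x) = (b ^^ k) x" using Suc by (simp add: funpow_swap1)
      then show ?thesis using orb by simp
    qed
    ultimately show ?thesis using ab by (auto simp: K_def)
  qed
  have KK: "f x \<in> K" "g x \<in> K" "g (f x) = x" "f (g x) = x" if "x \<in> K" for x
    using step[OF that] E KE[OF that] by auto
  have Ksp: "x \<in> space M" if "x \<in> K" for x using that by (simp add: K_def)
  define T where "T x = (if x \<in> K then f x else x)" for x
  define S where "S x = (if x \<in> K then g x else x)" for x
  have T [measurable]: "T \<in> M \<rightarrow>\<^sub>M M" and S [measurable]: "S \<in> M \<rightarrow>\<^sub>M M"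
    unfolding T_def S_def by measurable
  have TS: "S (T x) = x" "T (S x) = x" for x
    using KK by (auto simp: T_def S_def)
  have sp: "T x \<in> space M" "S x \<in> space M" if "x \<in> space M" for x
    using that measurable_space[OF T] measurable_space[OF S] by auto
  have bij: "bij_betw T (space M) (space M)"
    by (rule bij_betw_byWitness[of _ S]) (use TS sp in auto)
  have inv: "inv_into (space M) T \<in> M \<rightarrow>\<^sub>M M"
  proof (subst measurable_cong)
    fix x assume "x \<in> space M"
    then show "inv_into (space M) T x = S x"
      using inv_into_f_f[OF bij_betw_imp_inj_on[OF bij], of "S x"] sp TS by simp
  qed (rule S)
  have AE_T: "AE x in M. T x = f x"
    using AE_K by eventually_elim (simp add: T_def)
  have "distr M M T = distr M M f"
    by (rule distr_cong_AE) (use AE_T f T in auto)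
  then have "T \<in> transformations M" using bij inv T f by (simp add: transformations_def)
  then show thesis using AE_T by (rule that)
qed

text \<open>The label of a point encodes which of the finitely many sets contain it.\<close>

lemma set_label:
  fixes M :: "'a measure"
  assumes "finite \<F>" "\<F> \<subseteq> sets M"
  obtains b :: "'a \<Rightarrow> nat" where "b \<in> M \<rightarrow>\<^sub>M count_space UNIV"
    "\<forall>A\<in>\<F>. \<forall>x\<in>space M. \<forall>y\<in>space M. b x = b y \<longrightarrow> (x \<in> A \<longleftrightarrow> y \<in> A)"
proof -
  obtain h :: "nat \<Rightarrow> 'a set" and n where h: "\<F> = h ` {i. i < n}"
    using finite_imp_nat_seg_image_inj_on[OF assms(1)] by blast
  define b where "b x = set_encode {i\<in>{..<n}. x \<in> h i}" for x
  have b_eq: "b x = (\<Sum>i<n. if x \<in> h i then 2 ^ i else 0)" for x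
    unfolding b_def set_encode_def by (rule sum.inter_filter) simp
  have "(\<lambda>x. \<Sum>i<n. if x \<in> h i then 2 ^ i else (0::nat)) \<in> M \<rightarrow>\<^sub>M count_space UNIV"
  proof (rule measurable_sum_nat)
    fix i assume "i \<in> {..<n}"
    then have [measurable]: "h i \<in> sets M" using assms h by auto
    show "(\<lambda>x. if x \<in> h i then 2 ^ i else (0::nat)) \<in> M \<rightarrow>\<^sub>M count_space UNIV" by measurable
  qed
  then have "b \<in> M \<rightarrow>\<^sub>M count_space UNIV" unfolding b_eq[symmetric] .
  moreover have lab: "x \<in> h i \<longleftrightarrow> y \<in> h i" if "b x = b y" "i < n" for x y i
  proof -
    have "{i\<in>{..<n}. x \<in> h i} = {i\<in>{..<n}. y \<in> h i}"
      using that(1) by (simp add: b_def set_encode_eq)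
    then show ?thesis using that(2) by blast
  qed
  moreover have "\<forall>A\<in>\<F>. \<forall>x\<in>space M. \<forall>y\<in>space M. b x = b y \<longrightarrow> (x \<in> A \<longleftrightarrow> y \<in> A)"
    unfolding h using lab by blast
  ultimately show thesis using that by blast
qed

text \<open>Let \<open>R\<close> act on \<open>N\<close> and let \<open>p\<close> be any measure-preserving map to \<open>M\<close>, however far from injective. The
labels on \<open>M\<close> that describe membership in the sets of \<open>\<F>\<close> and their pullbacks along \<open>p\<close> are equally distributed, so some isomorphism \<open>\<beta>\<close>
agrees with \<open>p\<close> as far as \<open>\<F>\<close> can tell. Conjugating \<open>R\<close> by \<open>\<beta>\<close> yields \<open>T\<close>.\<close>

lemma realization:
  fixes M :: "'a measure" and N :: "'b measure"
  assumes M: "prob_space M" "coded M U \<psi>" "\<And>x. x \<in> space M \<Longrightarrow> measure M {x} = 0"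
    and N: "prob_space N" "coded N V \<xi>" "\<And>x. x \<in> space N \<Longrightarrow> measure N {x} = 0"
    and R: "R \<in> transformations N"
    and p: "p \<in> N \<rightarrow>\<^sub>M M" "distr N M p = M"
    and F: "finite \<F>" "\<F> \<subseteq> sets M"
  obtains T \<beta> where "T \<in> transformations M" "\<beta> \<in> N \<rightarrow>\<^sub>M M" "distr N M \<beta> = M"
    "AE y in N. T (\<beta> y) = \<beta> (R y)" "\<forall>A\<in>\<F>. AE y in N. \<beta> y \<in> A \<longleftrightarrow> p y \<in> A"
proof -
  obtain b :: "'a \<Rightarrow> nat" where b [measurable]: "b \<in> M \<rightarrow>\<^sub>M count_space UNIV"
    and bF: "\<forall>A\<in>\<F>. \<forall>x\<in>space M. \<forall>y\<in>space M. b x = b y \<longrightarrow> (x \<in> A \<longleftrightarrow> y \<in> A)"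
    by (rule set_label[OF F])
  note [measurable] = p(1)
  have bp: "(\<lambda>y. b (p y)) \<in> N \<rightarrow>\<^sub>M count_space UNIV" by measurable
  have same: "measure M {x\<in>space M. b x < k} = measure N {y\<in>space N. b (p y) < k}" for k
  proof -
    have "measure M {x\<in>space M. b x < k} = measure (distr N M p) {x\<in>space M. b x < k}"
      by (simp only: p(2))
    also have "\<dots> = measure N (p -` {x\<in>space M. b x < k} \<inter> space N)"
      by (rule measure_distr) measurable
    also have "p -` {x\<in>space M. b x < k} \<inter> space N = {y\<in>space N. b (p y) < k}"
      using measurable_space[OF p(1)] by auto
    finally show ?thesis .
  qed
  obtain \<beta> \<beta>' where \<beta>: "\<beta> \<in> N \<rightarrow>\<^sub>M M" "\<beta>' \<in> M \<rightarrow>\<^sub>M N" "distr N M \<beta> = M" "distr M N \<beta>' = N"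
    "AE y in N. \<beta>' (\<beta> y) = y" "AE x in M. \<beta> (\<beta>' x) = x" "AE y in N. b (\<beta> y) = b (p y)"
    by (rule labelled_isomorphism[OF M N b bp same])
  let ?R' = "inv_into (space N) R"
  have R': "?R' \<in> transformations N" using R by (rule transformation_inv)
  have conj: "(\<lambda>x. \<beta> (Q (\<beta>' x))) \<in> M \<rightarrow>\<^sub>M M \<and> distr M M (\<lambda>x. \<beta> (Q (\<beta>' x))) = M"
    if Q: "Q \<in> transformations N" for Q
  proof
    note [measurable] = \<beta>(1,2) transformation_measurable[OF Q]
    show "(\<lambda>x. \<beta> (Q (\<beta>' x))) \<in> M \<rightarrow>\<^sub>M M" by measurable
    have "distr M M (\<lambda>x. \<beta> (Q (\<beta>' x))) = distr (distr (distr M N \<beta>') N Q) M \<beta>"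
      by (simp add: distr_distr comp_def)
    then show "distr M M (\<lambda>x. \<beta> (Q (\<beta>' x))) = M"
      by (simp add: \<beta>(3,4) transformation_distr[OF Q])
  qed
  have conj_inv: "AE x in M. \<beta> (Q' (\<beta>' (\<beta> (Q (\<beta>' x))))) = x"
    if Q: "Q \<in> transformations N" and QQ: "\<And>y. y \<in> space N \<Longrightarrow> Q' (Q y) = y" for Q Q'
  proof -
    have "AE x in M. \<beta>' (\<beta> (\<beta>' x)) = \<beta>' x" by (rule AE_preserving[OF \<beta>(5,2,4)])
    have "AE y in N. \<beta>' (\<beta> (Q y)) = Q y"
      by (rule AE_preserving[OF \<beta>(5) transformation_measurable[OF Q] transformation_distr[OF Q]])
    then have "AE x in M. \<beta>' (\<beta> (Q (\<beta>' x))) = Q (\<beta>' x)"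
      by (rule AE_preserving[OF _ \<beta>(2,4)])
    then show ?thesis
      using \<beta>(6) AE_space
    proof eventually_elim
      case (elim x)
      then show ?case using QQ[OF measurable_space[OF \<beta>(2)]] by simp
    qed
  qed
  obtain T where T: "T \<in> transformations M" "AE x in M. T x = \<beta> (R (\<beta>' x))"
    by (rule AE_invertible_imp_transformation[of "\<lambda>x. \<beta> (R (\<beta>' x))" M "\<lambda>x. \<beta> (?R' (\<beta>' x))"])
       (use conj[OF R] conj[OF R'] conj_inv[OF R, of ?R'] conj_inv[OF R', of R]
          transformation_inv_left[OF R] transformation_inv_right[OF R] in auto)
  show thesis
  proof (rule that[OF T(1) \<beta>(1,3)])
    show "AE y in N. T (\<beta> y) = \<beta> (R y)"
      using AE_preserving[OF T(2) \<beta>(1,3)] \<beta>(5) by eventually_elim simp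
    show "\<forall>A\<in>\<F>. AE y in N. \<beta> y \<in> A \<longleftrightarrow> p y \<in> A"
    proof
      fix A assume A: "A \<in> \<F>"
      show "AE y in N. \<beta> y \<in> A \<longleftrightarrow> p y \<in> A"
        using \<beta>(7) AE_space
      proof eventually_elim
        case (elim y)
        then show ?case
          using bF A measurable_space[OF \<beta>(1)] measurable_space[OF p(1)] by blast
      qed
    qed
  qed
qed

lemma transformation_pow_correlation:
  assumes T: "T \<in> transformations M" and A: "A \<in> sets M" and B: "B \<in> sets M"
  shows "measure M ((T ^^ i) ` A \<inter> B) = measure M {x\<in>space M. x \<in> A \<and> (T ^^ i) x \<in> B}"
proof -
  have Ti: "T ^^ i \<in> transformations M" using T by (rule transformation_pow)
  have [measurable]: "T ^^ i \<in> M \<rightarrow>\<^sub>M M" "A \<in> sets M" "B \<in> sets M"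
    using transformation_measurable[OF Ti] A B by auto
  have "(T ^^ i) ` {x\<in>space M. x \<in> A \<and> (T ^^ i) x \<in> B} = (T ^^ i) ` A \<inter> B"
    using sets.sets_into_space[OF A] by auto
  moreover have "{x\<in>space M. x \<in> A \<and> (T ^^ i) x \<in> B} \<in> sets M" by measurable
  ultimately show ?thesis
    using transformation_image_measure[OF Ti] by metis
qed

lemma measure_pair_uniform:
  fixes Z :: "'b measure" and n :: nat
  assumes "prob_space Z" "0 < n" and E: "E \<in> sets (Z \<Otimes>\<^sub>M uniform_count_measure {..<n})"
  shows "measure (Z \<Otimes>\<^sub>M uniform_count_measure {..<n}) E = (\<Sum>j<n. measure Z {z\<in>space Z. (z, j) \<in> E}) / n"
proof -
  interpret Z: prob_space Z by fact
  let ?K = "uniform_count_measure {..<n}"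
  interpret K: prob_space ?K using assms(2) by (intro prob_space_uniform_count_measure) auto
  interpret P: pair_prob_space Z ?K ..
  have [simp]: "sets ?K = Pow {..<n}" "space ?K = {..<n}"
    by (simp_all add: sets_uniform_count_measure space_uniform_count_measure)
  define S where "S j = {z\<in>space Z. (z, j) \<in> E}" for j
  have S: "S j \<in> sets Z" if "j < n" for j
  proof -
    have [measurable]: "(\<lambda>z. (z, j)) \<in> Z \<rightarrow>\<^sub>M Z \<Otimes>\<^sub>M ?K"
      using that by (intro measurable_Pair) auto
    have "S j = (\<lambda>z. (z, j)) -` E \<inter> space Z" by (auto simp: S_def)
    then show ?thesis using E by simp
  qed
  have "E \<subseteq> space Z \<times> {..<n}"
    using sets.sets_into_space[OF E] by (simp add: space_pair_measure)
  then have "E = (\<Union>j<n. S j \<times> {j})" by (auto simp: S_def)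
  moreover have "measure (Z \<Otimes>\<^sub>M ?K) (\<Union>j<n. S j \<times> {j}) = (\<Sum>j<n. measure (Z \<Otimes>\<^sub>M ?K) (S j \<times> {j}))"
    by (rule P.finite_measure_finite_Union) (use S in \<open>auto simp: disjoint_family_on_def intro!: pair_measureI\<close>)
  moreover have "measure (Z \<Otimes>\<^sub>M ?K) (S j \<times> {j}) = measure Z (S j) / n" if "j < n" for j
    using S[OF that] that K.emeasure_pair_measure_Times[of "S j" Z "{j}"]
    by (simp add: measure_def enn2real_mult emeasure_uniform_count_measure)
  ultimately show ?thesis by (simp add: S_def sum_divide_distrib)
qed

text \<open>The space \<open>N\<close> of \<open>realization\<close> is taken to be \<open>Z\<close> times a cycle of length \<open>n\<close>, with the rotation of the cycle
as the map \<open>R\<close>. The correlations of the resulting transformation on the given sets are read off from the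
letters.\<close>

lemma cyclic_realization:
  fixes M :: "'a measure" and Z :: "'b measure" and n :: nat
  assumes M: "prob_space M" "coded M U \<psi>" "\<And>x. x \<in> space M \<Longrightarrow> measure M {x} = 0"
    and Z: "prob_space Z" "coded Z V \<xi>" "\<And>x. x \<in> space Z \<Longrightarrow> measure Z {x} = 0"
    and n: "0 < n"
    and l: "\<And>j. j < n \<Longrightarrow> l j \<in> Z \<rightarrow>\<^sub>M M" "\<And>j. j < n \<Longrightarrow> distr Z M (l j) = M"
    and F: "finite \<F>" "\<F> \<subseteq> sets M"
  obtains T where "T \<in> transformations M"
    "\<forall>A\<in>\<F>. \<forall>B\<in>\<F>. \<forall>i. measure M ((T ^^ i) ` A \<inter> B) =
       (\<Sum>j<n. measure Z {z\<in>space Z. l j z \<in> A \<and> l ((j + i) mod n) z \<in> B}) / n"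
proof -
  interpret Z: prob_space Z by (rule Z)
  let ?K = "uniform_count_measure {..<n}"
  let ?N = "Z \<Otimes>\<^sub>M ?K"
  interpret K: prob_space ?K using n by (intro prob_space_uniform_count_measure) auto
  interpret P: pair_prob_space Z ?K ..
  have K [simp]: "sets ?K = Pow {..<n}" "space ?K = {..<n}"
    by (simp_all add: sets_uniform_count_measure space_uniform_count_measure)
  have spN: "space ?N = space Z \<times> {..<n}" by (simp add: space_pair_measure)
  define R where "R k = (\<lambda>(z, j). (z :: 'b, (j + k) mod n))" for k
  obtain V' \<xi>' where codedN: "coded ?N V' \<xi>'"
  proof -
    obtain W \<zeta> where "coded (count_space {..<n}) W \<zeta>"
      using coded_count_space[OF n] by blast
    then have "coded ?K W \<zeta>" by (rule coded_cong[rotated]) simp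
    then show thesis using coded_pair[OF Z(2)] that by blast
  qed
  have atomlessN: "measure ?N {y} = 0" if yN: "y \<in> space ?N" for y
  proof -
    obtain z j where y: "y = (z, j)" "z \<in> space Z" "j < n" using yN spN by auto
    have "measure ?N ({z} \<times> {j}) = 0"
      using Z(3)[OF y(2)] y(3) coded_singleton[OF Z(2) y(2)] K.emeasure_pair_measure_Times[of "{z}" Z "{j}"]
      by (simp add: measure_def enn2real_mult)
    then show ?thesis using y by simp
  qed
  have unrotate: "((j + b) mod n + a) mod n = j" if "j < n" "(a + b) mod n = 0" for a b j :: nat
  proof -
    have "((j + b) mod n + a) mod n = (j + (a + b)) mod n" by (simp add: mod_simps ac_simps)
    also have "\<dots> = j" using that by (metis add.right_neutral mod_add_right_eq mod_less)
    finally show ?thesis .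
  qed
  have distK: "distr ?K ?K (\<lambda>j. (j + 1) mod n) = ?K"
  proof (rule measure_eqI)
    fix E assume "E \<in> sets (distr ?K ?K (\<lambda>j. (j + 1) mod n))"
    then have E: "E \<subseteq> {..<n}" by simp
    let ?E = "(\<lambda>j. (j + 1) mod n) -` E \<inter> {..<n}"
    have bij: "bij_betw (\<lambda>j. (j + 1) mod n) {..<n} {..<n}"
    proof (rule bij_betw_byWitness[of _ "\<lambda>j. (j + (n - 1)) mod n"])
      show "\<forall>j\<in>{..<n}. ((j + 1) mod n + (n - 1)) mod n = j"
        using n by (intro ballI unrotate) auto
      show "\<forall>j\<in>{..<n}. ((j + (n - 1)) mod n + 1) mod n = j"
        using n by (intro ballI unrotate) auto
    qed (use n in auto)
    have "(\<lambda>j. (j + 1) mod n) ` ?E = E \<inter> (\<lambda>j. (j + 1) mod n) ` {..<n}"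
      by blast
    also have "\<dots> = E" using bij E by (auto simp: bij_betw_def)
    finally have "(\<lambda>j. (j + 1) mod n) ` ?E = E" .
    moreover have "inj_on (\<lambda>j. (j + 1) mod n) ?E"
      using bij by (auto simp: bij_betw_def intro: inj_on_subset)
    ultimately have "card ?E = card E" by (metis card_image)
    moreover have "(\<lambda>j. (j + 1) mod n) \<in> ?K \<rightarrow>\<^sub>M ?K" using n by (auto simp: measurable_def)
    ultimately show "emeasure (distr ?K ?K (\<lambda>j. (j + 1) mod n)) E = emeasure ?K E"
      using E by (simp add: emeasure_distr emeasure_uniform_count_measure)
  qed simp
  have Rm: "R k \<in> ?N \<rightarrow>\<^sub>M ?N" for k
  proof -
    have "(\<lambda>j. (j + k) mod n) \<in> ?K \<rightarrow>\<^sub>M ?K" using n by (auto simp: measurable_def)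
    then show ?thesis unfolding R_def by measurable
  qed
  have Rdist: "distr ?N ?N (R 1) = ?N"
  proof -
    have "(\<lambda>j. (j + 1) mod n) \<in> ?K \<rightarrow>\<^sub>M ?K" using n by (auto simp: measurable_def)
    then have "distr Z Z (\<lambda>z. z) \<Otimes>\<^sub>M distr ?K ?K (\<lambda>j. (j + 1) mod n) = distr ?N ?N (R 1)"
      unfolding R_def by (intro pair_measure_distr) (auto simp only: distK K.sigma_finite_measure_axioms measurable_ident_sets)
    then show ?thesis unfolding distK by simp
  qed
  have Rinv: "R a (R b y) = y" if yN: "y \<in> space ?N" and ab: "(a + b) mod n = 0" for a b y
  proof -
    obtain z j where y: "y = (z, j)" "j < n" using yN spN by auto
    then show ?thesis using unrotate[OF y(2) ab] by (simp add: R_def)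
  qed
  have R: "R 1 \<in> transformations ?N"
  proof -
    have b: "bij_betw (R 1) (space ?N) (space ?N)"
      by (rule bij_betw_byWitness[of _ "R (n - 1)"])
         (use n Rinv measurable_space[OF Rm] in auto)
    have "inv_into (space ?N) (R 1) \<in> ?N \<rightarrow>\<^sub>M ?N"
    proof (subst measurable_cong)
      fix y assume y: "y \<in> space ?N"
      have "R 1 (R (n - 1) y) = y" using Rinv[OF y] n by simp
      then show "inv_into (space ?N) (R 1) y = R (n - 1) y"
        using inv_into_f_f[OF bij_betw_imp_inj_on[OF b] measurable_space[OF Rm y]] by metis
    qed (rule Rm)
    then show ?thesis using b Rm Rdist by (simp add: transformations_def)
  qed
  have Rpow: "(R 1 ^^ i) (z, j) = (z, (j + i) mod n)" if "j < n" for i j z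
  proof (induction i)
    case (Suc i)
    then show ?case by (simp add: R_def mod_simps)
  qed (use that in simp)
  define p where "p = (\<lambda>(z, j). l j z)"
  have p: "p \<in> ?N \<rightarrow>\<^sub>M M"
  proof -
    have "(\<lambda>y. l (snd y) (fst y)) \<in> ?N \<rightarrow>\<^sub>M M"
    proof (rule measurable_compose_countable'[where I="{..<n}"])
      fix j assume j: "j \<in> {..<n}"
      then show "(\<lambda>y. l j (fst y)) \<in> ?N \<rightarrow>\<^sub>M M"
        using l(1)[of j] by (intro measurable_compose[OF measurable_fst]) auto
    next
      show "snd \<in> ?N \<rightarrow>\<^sub>M count_space {..<n}"
        using measurable_snd[of Z ?K] by (simp cong: measurable_cong_sets)
    qed simp
    then show ?thesis by (simp add: p_def case_prod_beta')
  qed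
  have avg: "measure ?N {y\<in>space ?N. Q y} = (\<Sum>j<n. measure Z {z\<in>space Z. Q (z, j)}) / n"
    if "{y\<in>space ?N. Q y} \<in> sets ?N" for Q
  proof -
    have "{z\<in>space Z. (z, j) \<in> {y\<in>space ?N. Q y}} = {z\<in>space Z. Q (z, j)}" if "j < n" for j
      using that spN by auto
    then show ?thesis using measure_pair_uniform[OF Z(1) n that] by simp
  qed
  have pdist: "distr ?N M p = M"
  proof (rule measure_eqI)
    fix A assume "A \<in> sets (distr ?N M p)"
    then have A: "A \<in> sets M" by simp
    interpret M: prob_space M by (rule M)
    have eq: "p -` A \<inter> space ?N = {y\<in>space ?N. p y \<in> A}" by auto
    have "measure ?N (p -` A \<inter> space ?N) = (\<Sum>j<n. measure Z {z\<in>space Z. p (z, j) \<in> A}) / n"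
      unfolding eq by (rule avg) (use measurable_sets[OF p A] eq in simp)
    also have "(\<Sum>j<n. measure Z {z\<in>space Z. p (z, j) \<in> A}) = (\<Sum>j<n. measure M A)"
    proof (rule sum.cong)
      fix j assume j: "j \<in> {..<n}"
      have "measure M A = measure (distr Z M (l j)) A" using l(2)[of j] j by simp
      also have "\<dots> = measure Z (l j -` A \<inter> space Z)"
        using l(1)[of j] j A by (simp add: measure_distr)
      finally show "measure Z {z\<in>space Z. p (z, j) \<in> A} = measure M A"
        by (simp add: p_def vimage_def Int_def conj_commute)
    qed simp
    finally show "emeasure (distr ?N M p) A = emeasure M A"
      using n p A by (simp add: emeasure_distr P.emeasure_eq_measure M.emeasure_eq_measure)
  qed simp
  obtain T \<beta> where T: "T \<in> transformations M" and \<beta>: "\<beta> \<in> ?N \<rightarrow>\<^sub>M M" "distr ?N M \<beta> = M"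
    "AE y in ?N. T (\<beta> y) = \<beta> (R 1 y)" "\<forall>A\<in>\<F>. AE y in ?N. \<beta> y \<in> A \<longleftrightarrow> p y \<in> A"
    by (rule realization[OF M P.prob_space_axioms codedN atomlessN R p pdist F])
  have Ri: "R 1 ^^ i \<in> ?N \<rightarrow>\<^sub>M ?N" "distr ?N ?N (R 1 ^^ i) = ?N" for i
    using preserving_pow[OF Rm Rdist] by auto
  have iter: "AE y in ?N. (T ^^ i) (\<beta> y) = \<beta> ((R 1 ^^ i) y)" for i
  proof (induction i)
    case (Suc i)
    have "AE y in ?N. T (\<beta> ((R 1 ^^ i) y)) = \<beta> (R 1 ((R 1 ^^ i) y))"
      by (rule AE_preserving[OF \<beta>(3) Ri])
    with Suc show ?case by eventually_elim simp
  qed simp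
  show thesis
  proof (rule that[OF T], intro ballI allI)
    fix A B i assume AB: "A \<in> \<F>" "B \<in> \<F>"
    then have [measurable]: "A \<in> sets M" "B \<in> sets M" using F by auto
    have [measurable]: "T ^^ i \<in> M \<rightarrow>\<^sub>M M"
      using transformation_measurable[OF transformation_pow[OF T]] .
    note [measurable] = \<beta>(1) p Ri(1)
    have "measure M ((T ^^ i) ` A \<inter> B) = measure M {x\<in>space M. x \<in> A \<and> (T ^^ i) x \<in> B}"
      by (rule transformation_pow_correlation[OF T]) measurable
    also have "\<dots> = measure (distr ?N M \<beta>) {x\<in>space M. x \<in> A \<and> (T ^^ i) x \<in> B}"
      by (simp only: \<beta>(2))
    also have "\<dots> = measure ?N (\<beta> -` {x\<in>space M. x \<in> A \<and> (T ^^ i) x \<in> B} \<inter> space ?N)"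
      by (rule measure_distr) measurable
    also have "\<dots> = measure ?N {y\<in>space ?N. p y \<in> A \<and> p ((R 1 ^^ i) y) \<in> B}"
    proof (rule measure_eq_AE)
      have "AE y in ?N. \<beta> ((R 1 ^^ i) y) \<in> B \<longleftrightarrow> p ((R 1 ^^ i) y) \<in> B"
        by (rule AE_preserving[OF _ Ri]) (use \<beta>(4) AB in blast)
      moreover have "AE y in ?N. \<beta> y \<in> A \<longleftrightarrow> p y \<in> A" using \<beta>(4) AB by blast
      ultimately show "AE y in ?N. y \<in> \<beta> -` {x\<in>space M. x \<in> A \<and> (T ^^ i) x \<in> B} \<inter> space ?N
          \<longleftrightarrow> y \<in> {y\<in>space ?N. p y \<in> A \<and> p ((R 1 ^^ i) y) \<in> B}"
        using iter[of i] AE_space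
        by eventually_elim (use measurable_space[OF \<beta>(1)] in auto)
    qed measurable
    also have "\<dots> = (\<Sum>j<n. measure Z {z\<in>space Z. p (z, j) \<in> A \<and> p ((R 1 ^^ i) (z, j)) \<in> B}) / n"
      by (rule avg) measurable
    also have "\<dots> = (\<Sum>j<n. measure Z {z\<in>space Z. l j z \<in> A \<and> l ((j + i) mod n) z \<in> B}) / n"
      by (intro arg_cong[of _ _ "\<lambda>s. s / real n"] sum.cong) (simp_all only: lessThan_iff Rpow p_def case_prod_conv)
    finally show "measure M ((T ^^ i) ` A \<inter> B) =
       (\<Sum>j<n. measure Z {z\<in>space Z. l j z \<in> A \<and> l ((j + i) mod n) z \<in> B}) / n" .
  qed
qed

section \<open>Limits of measure-preserving maps\<close>

lemma (in prob_space) measure_sym_diff_triangle: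
  assumes [measurable]: "A \<in> events" "B \<in> events" "C \<in> events"
  shows "prob (sym_diff A C) \<le> prob (sym_diff A B) + prob (sym_diff B C)"
proof -
  have "prob (sym_diff A C) \<le> prob (sym_diff A B \<union> sym_diff B C)"
    by (intro finite_measure_mono) auto
  also have "\<dots> \<le> prob (sym_diff A B) + prob (sym_diff B C)"
    by (intro measure_Un_le) auto
  finally show ?thesis .
qed

lemma (in prob_space) abs_measure_diff_le:
  assumes [measurable]: "A \<in> events" "B \<in> events"
  shows "\<bar>prob A - prob B\<bar> \<le> prob (sym_diff A B)"
proof -
  have "prob A \<le> prob (B \<union> sym_diff A B)" by (rule finite_measure_mono) auto
  moreover have "prob B \<le> prob (A \<union> sym_diff A B)" by (rule finite_measure_mono) auto
  moreover have "prob (B \<union> sym_diff A B) \<le> prob B + prob (sym_diff A B)"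
    by (rule measure_Un_le) auto
  moreover have "prob (A \<union> sym_diff A B) \<le> prob A + prob (sym_diff A B)"
    by (rule measure_Un_le) auto
  ultimately show ?thesis by linarith
qed

lemma (in prob_space) sym_diff_tendsto_0:
  assumes [measurable]: "\<And>j. B j \<in> events" "B' \<in> events"
    and ev: "AE x in M. \<forall>\<^sub>F j in sequentially. x \<in> B j \<longleftrightarrow> x \<in> B'"
  shows "(\<lambda>j. prob (sym_diff (B j) B')) \<longlonglongrightarrow> 0"
proof -
  have "(\<lambda>j. \<integral>x. indicator (sym_diff (B j) B') x \<partial>M) \<longlonglongrightarrow> (\<integral>x. (0::real) \<partial>M)"
  proof (rule integral_dominated_convergence[where w="\<lambda>_. 1"])
    show "AE x in M. (\<lambda>j. indicator (sym_diff (B j) B') x :: real) \<longlonglongrightarrow> 0"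
      using ev
    proof eventually_elim
      case (elim x)
      then have "\<forall>\<^sub>F j in sequentially. (indicator (sym_diff (B j) B') x :: real) = 0"
        by eventually_elim auto
      then show ?case by (rule tendsto_eventually)
    qed
    show "AE x in M. norm (indicator (sym_diff (B j) B') x :: real) \<le> 1" for j
      by (intro AE_I2) (auto simp: indicator_def)
  qed auto
  then show ?thesis by simp
qed

lemma (in prob_space) measure_tendsto_of_sym_diff:
  assumes "\<And>j. B j \<in> events" "B' \<in> events" "(\<lambda>j. prob (sym_diff (B j) B')) \<longlonglongrightarrow> 0"
  shows "(\<lambda>j. prob (B j)) \<longlonglongrightarrow> prob B'"
proof (rule LIM_zero_cancel)
  show "(\<lambda>j. prob (B j) - prob B') \<longlonglongrightarrow> 0"
  proof (rule Lim_null_comparison[OF always_eventually assms(3)], intro allI)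
    fix j
    show "norm (prob (B j) - prob B') \<le> prob (sym_diff (B j) B')"
      using abs_measure_diff_le[OF assms(1,2), of j] by simp
  qed
qed

lemma eventually_constant:
  fixes P :: "nat \<Rightarrow> bool"
  assumes "\<forall>\<^sub>F j in sequentially. P j \<longleftrightarrow> P (Suc j)"
  shows "\<forall>\<^sub>F j in sequentially. P j \<longleftrightarrow> (\<exists>N. \<forall>j\<ge>N. P j)"
proof -
  obtain N where N: "\<And>j. N \<le> j \<Longrightarrow> P j \<longleftrightarrow> P (Suc j)"
    using assms by (auto simp: eventually_sequentially)
  have const: "P j \<longleftrightarrow> P N" if "N \<le> j" for j
    using that
  proof (induction j rule: dec_induct)
    case (step j)
    then show ?case using N[of j] by simp
  qed simp
  have "P j \<longleftrightarrow> (\<exists>N. \<forall>j\<ge>N. P j)" if "N \<le> j" for j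
  proof
    assume "P j"
    then have "P N" using const[OF that] by blast
    then show "\<exists>N. \<forall>j\<ge>N. P j" using const by blast
  next
    assume "\<exists>N. \<forall>j\<ge>N. P j"
    then obtain N' where "\<forall>j\<ge>N'. P j" by blast
    then have "P (max N N')" by simp
    then show "P j" using const[OF max.cobounded1] const[OF that] by blast
  qed
  then show ?thesis by (auto simp: eventually_sequentially)
qed

lemma coded_sigma_sets:
  assumes "coded M U \<psi>"
  shows "sets M = sigma_sets (space M) (range U)"
proof
  have U: "range U \<subseteq> Pow (space M)" "range U \<subseteq> sets M"
    using assms sets.sets_into_space by (auto simp: coded_def)
  show "sigma_sets (space M) (range U) \<subseteq> sets M"
    using U(2) by (rule sets.sigma_sets_subset)
  define N where "N = sigma (space M) (range U)"
  have N: "space N = space M" "sets N = sigma_sets (space M) (range U)"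
    using U by (simp_all add: N_def)
  have "code U \<in> N \<rightarrow>\<^sub>M coins"
  proof (rule measurable_into_coins)
    fix i
    have [measurable]: "U i \<in> sets N" using N by auto
    show "Measurable.pred N (\<lambda>x. code U x i)" unfolding code_def by measurable
  qed
  then have m: "(\<lambda>x. \<psi> (code U x)) \<in> N \<rightarrow>\<^sub>M M"
    using assms by (auto simp: coded_def intro: measurable_compose)
  show "sets M \<subseteq> sigma_sets (space M) (range U)"
  proof
    fix A assume A: "A \<in> sets M"
    have "A = (\<lambda>x. \<psi> (code U x)) -` A \<inter> space N"
      using assms sets.sets_into_space[OF A] by (auto simp: coded_def N)
    then show "A \<in> sigma_sets (space M) (range U)"
      using measurable_sets[OF m A] N by simp
  qed
qed

lemma preserving_vimage_measure:
  assumes "f \<in> M \<rightarrow>\<^sub>M M" "distr M M f = M" "A \<in> sets M"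
  shows "measure M (f -` A \<inter> space M) = measure M A"
  using measure_distr[OF assms(1,3)] assms(2) by simp

text \<open>The sets for which preimages converge form a \<sigma>-algebra: a countable union is a finite union up
to small measure, uniformly in \<open>j\<close> because all the maps preserve the measure.\<close>

lemma (in prob_space) vimage_convergence_all_sets:
  assumes cod: "coded M U \<psi>"
    and T: "\<And>j. T j \<in> M \<rightarrow>\<^sub>M M" "\<And>j. distr M M (T j) = M"
    and S: "S \<in> M \<rightarrow>\<^sub>M M" "distr M M S = M"
    and conv: "\<And>i. (\<lambda>j::nat. prob (sym_diff (T j -` U i \<inter> space M) (S -` U i \<inter> space M))) \<longlonglongrightarrow> 0"
    and A: "A \<in> events"
  shows "(\<lambda>j. prob (sym_diff (T j -` A \<inter> space M) (S -` A \<inter> space M))) \<longlonglongrightarrow> 0"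
proof -
  define d where "d j A = prob (sym_diff (T j -` A \<inter> space M) (S -` A \<inter> space M))" for j A
  have "A \<in> sigma_sets (space M) (range U)" using A coded_sigma_sets[OF cod] by simp
  then have "(\<lambda>j. d j A) \<longlonglongrightarrow> 0"
  proof (induction rule: sigma_sets.induct)
    case (Basic a)
    then show ?case using conv by (auto simp: d_def)
  next
    case Empty
    show ?case by (simp add: d_def)
  next
    case (Compl a)
    have "sym_diff (T j -` (space M - a) \<inter> space M) (S -` (space M - a) \<inter> space M)
        = sym_diff (T j -` a \<inter> space M) (S -` a \<inter> space M)" for j
      using measurable_space[OF T(1)] measurable_space[OF S(1)] by auto
    then show ?case using Compl.IH by (simp add: d_def)
  next
    case (Union a)
    have a [measurable]: "a i \<in> events" for i
      using Union.hyps coded_sigma_sets[OF cod] by simp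
    define B where "B n = (\<Union>i. a i) - (\<Union>i<n. a i)" for n
    have B [measurable]: "B n \<in> events" for n unfolding B_def by measurable
    have "(\<lambda>n. prob (B n)) \<longlonglongrightarrow> prob (\<Inter>n. B n)"
      by (rule finite_Lim_measure_decseq) (auto simp: B_def decseq_def)
    moreover have "(\<Inter>n. B n) = {}" by (auto simp: B_def)
    ultimately have B0: "(\<lambda>n. prob (B n)) \<longlonglongrightarrow> 0" by simp
    have bound: "d j (\<Union>i. a i) \<le> (\<Sum>i<n. d j (a i)) + 2 * prob (B n)" for j n
    proof -
      let ?t = "\<lambda>A. T j -` A \<inter> space M" and ?s = "\<lambda>A. S -` A \<inter> space M"
      have [measurable]: "?t A \<in> events" "?s A \<in> events" if "A \<in> events" for A
        using that T(1) S(1) by auto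
      have "sym_diff (?t (\<Union>i. a i)) (?s (\<Union>i. a i))
          \<subseteq> (\<Union>i<n. sym_diff (?t (a i)) (?s (a i))) \<union> (?t (B n) \<union> ?s (B n))"
        by (auto simp: B_def)
      then have "d j (\<Union>i. a i) \<le> prob ((\<Union>i<n. sym_diff (?t (a i)) (?s (a i))) \<union> (?t (B n) \<union> ?s (B n)))"
        unfolding d_def by (rule finite_measure_mono) auto
      also have "\<dots> \<le> prob (\<Union>i<n. sym_diff (?t (a i)) (?s (a i))) + prob (?t (B n) \<union> ?s (B n))"
        by (rule measure_Un_le) auto
      also have "prob (\<Union>i<n. sym_diff (?t (a i)) (?s (a i))) \<le> (\<Sum>i<n. d j (a i))"
        unfolding d_def by (rule measure_UNION_le) auto
      also have "prob (?t (B n) \<union> ?s (B n)) \<le> prob (?t (B n)) + prob (?s (B n))"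
        by (rule measure_Un_le) auto
      also have "\<dots> = 2 * prob (B n)"
        using preserving_vimage_measure[OF T B] preserving_vimage_measure[OF S B] by simp
      finally show ?thesis by simp
    qed
    show ?case
    proof (rule tendstoI)
      fix e :: real assume "0 < e"
      then obtain n where n: "prob (B n) < e / 4"
        using order_tendstoD(2)[OF B0, of "e/4"] by (auto simp: eventually_sequentially)
      have "(\<lambda>j. \<Sum>i<n. d j (a i)) \<longlonglongrightarrow> (\<Sum>i<n. 0)"
        by (intro tendsto_sum Union.IH)
      then have "\<forall>\<^sub>F j in sequentially. (\<Sum>i<n. d j (a i)) < e / 4"
        using \<open>0 < e\<close> by (intro order_tendstoD(2)) auto
      then show "\<forall>\<^sub>F j in sequentially. dist (d j (\<Union> (range a))) 0 < e"
      proof eventually_elim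
        case (elim j)
        have "0 \<le> d j (\<Union>i. a i)" by (simp add: d_def)
        then show ?case using elim bound[of j n] n by simp
      qed
    qed
  qed
  then show ?thesis by (simp add: d_def)
qed

text \<open>By the Borel-Cantelli lemma, for almost every \<open>x\<close> every bit of the code of \<open>T j x\<close> is eventually constant.
Decoding the sequence of eventual bits gives the limit map. The eventual bits have the same distribution
as the code of a random point, since this is so for the codes of \<open>T j x\<close>; therefore they almost
surely are the code of a point.\<close>

lemma (in prob_space) limit_map:
  assumes cod: "coded M U \<psi>"
    and T: "\<And>j. T j \<in> M \<rightarrow>\<^sub>M M" "\<And>j. distr M M (T j) = M"
    and summ: "\<And>i. summable (\<lambda>j. prob (sym_diff (T j -` U i \<inter> space M) (T (Suc j) -` U i \<inter> space M)))"
  obtains S where "S \<in> M \<rightarrow>\<^sub>M M" "distr M M S = M"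
    "\<forall>A\<in>events. (\<lambda>j. prob (sym_diff (T j -` A \<inter> space M) (S -` A \<inter> space M))) \<longlonglongrightarrow> 0"
proof -
  have [measurable]: "U i \<in> events" for i using cod by (auto simp: coded_def)
  have [measurable]: "\<psi> \<in> coins \<rightarrow>\<^sub>M M" using cod by (simp add: coded_def)
  note [measurable] = T(1) measurable_code[OF cod]
  define e where "e x i \<longleftrightarrow> (\<exists>N. \<forall>j\<ge>N. T j x \<in> U i)" for x i
  have e [measurable]: "e \<in> M \<rightarrow>\<^sub>M coins"
    by (rule measurable_into_coins) (unfold e_def, measurable)
  have "AE x in M. \<forall>\<^sub>F j in sequentially. T j x \<in> U i \<longleftrightarrow> T (Suc j) x \<in> U i" for i
  proof -
    have "AE x in M. \<forall>\<^sub>F j in sequentially.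
        x \<in> space M - sym_diff (T j -` U i \<inter> space M) (T (Suc j) -` U i \<inter> space M)"
      by (rule borel_cantelli_AE1) (use summ in \<open>auto simp: emeasure_eq_measure\<close>)
    then show ?thesis
    proof eventually_elim
      case (elim x)
      then show ?case by eventually_elim auto
    qed
  qed
  then have "AE x in M. \<forall>i. \<forall>\<^sub>F j in sequentially. T j x \<in> U i \<longleftrightarrow> T (Suc j) x \<in> U i"
    by (simp add: AE_all_countable)
  then have ev: "AE x in M. \<forall>i. \<forall>\<^sub>F j in sequentially. T j x \<in> U i \<longleftrightarrow> e x i"
    unfolding e_def by eventually_elim (intro allI eventually_constant, blast)
  have dist_e: "distr M coins e = distr M coins (code U)"
  proof (rule measure_eqI_PiM_infinite)
    show "sets (distr M coins e) = sets (PiM UNIV (\<lambda>_. count_space UNIV))"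
      "sets (distr M coins (code U)) = sets (PiM UNIV (\<lambda>_. count_space UNIV))"
      by (simp_all add: coins_def)
    show "finite_measure (distr M coins e)"
      by (intro prob_space.finite_measure prob_space_distr) measurable
    fix X and J :: "nat set" assume J: "finite J"
    define B where "B = {s. \<forall>i\<in>J. s i \<in> (X i :: bool set)}"
    have B: "prod_emb UNIV (\<lambda>_. count_space UNIV) J (Pi\<^sub>E J X) = B"
      by (auto simp: B_def prod_emb_def restrict_def PiE_iff extensional_def)
    have Bm [measurable]: "B \<in> sets coins"
    proof -
      have "B = {s\<in>space coins. \<forall>i\<in>J. s i \<in> X i}" by (simp add: B_def)
      also have "\<dots> \<in> sets coins" using J by measurable
      finally show ?thesis .
    qed
    have "AE x in M. \<forall>\<^sub>F j in sequentially. x \<in> (\<lambda>x. code U (T j x)) -` B \<inter> space M \<longleftrightarrow> x \<in> e -` B \<inter> space M"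
      using ev
    proof eventually_elim
      case (elim x)
      then have "\<forall>\<^sub>F j in sequentially. \<forall>i\<in>J. T j x \<in> U i \<longleftrightarrow> e x i"
        using J by (simp add: eventually_ball_finite)
      then show ?case by eventually_elim (auto simp: B_def code_def)
    qed
    then have "(\<lambda>j. prob ((\<lambda>x. code U (T j x)) -` B \<inter> space M)) \<longlonglongrightarrow> prob (e -` B \<inter> space M)"
      by (intro measure_tendsto_of_sym_diff sym_diff_tendsto_0) measurable
    moreover have "prob ((\<lambda>x. code U (T j x)) -` B \<inter> space M) = prob (code U -` B \<inter> space M)" for j
    proof -
      have "(\<lambda>x. code U (T j x)) -` B \<inter> space M = T j -` (code U -` B \<inter> space M) \<inter> space M"
        using measurable_space[OF T(1)] by auto
      then show ?thesis
        using preserving_vimage_measure[OF T, of "code U -` B \<inter> space M"] by simp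
    qed
    ultimately have "prob (e -` B \<inter> space M) = prob (code U -` B \<inter> space M)"
      by (simp add: LIMSEQ_const_iff)
    then show "emeasure (distr M coins e) (prod_emb UNIV (\<lambda>_. count_space UNIV) J (Pi\<^sub>E J X))
        = emeasure (distr M coins (code U)) (prod_emb UNIV (\<lambda>_. count_space UNIV) J (Pi\<^sub>E J X))"
      unfolding B by (simp add: emeasure_distr emeasure_eq_measure)
  qed
  have "AE x in M. code U (\<psi> (code U x)) = code U x"
    using AE_space by eventually_elim (use cod in \<open>simp add: coded_def\<close>)
  moreover have "{s\<in>space coins. code U (\<psi> s) = s} \<in> sets coins"
    unfolding fun_eq_iff code_def by measurable
  ultimately have "AE s in distr M coins (code U). code U (\<psi> s) = s"
    by (subst AE_distr_iff) auto
  then have "AE s in distr M coins e. code U (\<psi> s) = s" by (simp only: dist_e)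
  then have S_code: "AE x in M. code U (\<psi> (e x)) = e x" by (rule AE_distrD[rotated]) measurable
  define S where "S x = \<psi> (e x)" for x
  have S: "S \<in> M \<rightarrow>\<^sub>M M" unfolding S_def by measurable
  have "distr M M S = distr (distr M coins e) M \<psi>"
    unfolding S_def by (subst distr_distr) (measurable, simp add: comp_def)
  also have "\<dots> = distr M M (\<lambda>x. \<psi> (code U x))"
    unfolding dist_e by (subst distr_distr) (measurable, simp add: comp_def)
  also have "\<dots> = distr M M (\<lambda>x. x)"
    by (rule distr_cong) (use cod in \<open>auto simp: coded_def\<close>)
  finally have dS: "distr M M S = M" by simp
  have "(\<lambda>j. prob (sym_diff (T j -` U i \<inter> space M) (S -` U i \<inter> space M))) \<longlonglongrightarrow> 0" for i
  proof (rule sym_diff_tendsto_0)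
    show "AE x in M. \<forall>\<^sub>F j in sequentially. x \<in> T j -` U i \<inter> space M \<longleftrightarrow> x \<in> S -` U i \<inter> space M"
      using ev S_code
    proof eventually_elim
      case (elim x)
      have "e x i \<longleftrightarrow> S x \<in> U i" using fun_cong[OF elim(2), of i] by (simp add: code_def S_def)
      moreover have "\<forall>\<^sub>F j in sequentially. T j x \<in> U i \<longleftrightarrow> e x i" using elim by blast
      ultimately show ?case by (auto elim: eventually_mono)
    qed
  qed (use S in auto)
  from vimage_convergence_all_sets[OF cod T S dS this]
  have "\<forall>A\<in>events. (\<lambda>j. prob (sym_diff (T j -` A \<inter> space M) (S -` A \<inter> space M))) \<longlonglongrightarrow> 0"
    by (rule ballI)
  with S dS show thesis by (rule that)
qed

section \<open>The Baire property of the weak topology\<close>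

text \<open>If \<open>W\<close> is the preimage of \<open>U i\<close> under \<open>S'\<close>, then \<open>W\<close> is the limit of \<open>T j ` U i\<close>; hence the preimage of
\<open>W\<close> under \<open>S\<close> is the limit of the preimages of \<open>T j ` U i\<close> under \<open>T j\<close>, all of which equal \<open>U i\<close>.\<close>

lemma (in prob_space) limit_maps_inverse:
  assumes cod: "coded M U \<psi>"
    and T: "\<And>j. T j \<in> transformations M"
    and S: "S \<in> M \<rightarrow>\<^sub>M M" "distr M M S = M"
      "\<forall>A\<in>events. (\<lambda>j::nat. prob (sym_diff (T j -` A \<inter> space M) (S -` A \<inter> space M))) \<longlonglongrightarrow> 0"
    and S': "S' \<in> M \<rightarrow>\<^sub>M M" "distr M M S' = M"
      "\<forall>A\<in>events. (\<lambda>j. prob (sym_diff (T j ` A) (S' -` A \<inter> space M))) \<longlonglongrightarrow> 0"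
  shows "AE x in M. S' (S x) = x"
proof -
  have U [measurable]: "U i \<in> events" for i using cod by (auto simp: coded_def)
  note [measurable] = S(1) S'(1) transformation_measurable[OF T]
  have "AE x in M. S' (S x) \<in> U i \<longleftrightarrow> x \<in> U i" for i
  proof -
    define W where "W = S' -` U i \<inter> space M"
    have W [measurable]: "W \<in> events" unfolding W_def by measurable
    have [measurable]: "T j ` U i \<in> events" for j
      using transformation_image_sets[OF T U] .
    let ?V = "S -` W \<inter> space M"
    have bound: "prob (sym_diff ?V (U i)) \<le>
        prob (sym_diff (T j -` W \<inter> space M) ?V) + prob (sym_diff (T j ` U i) W)" for j
    proof -
      have "prob (sym_diff ?V (U i)) \<le> prob (sym_diff ?V (T j -` W \<inter> space M))
          + prob (sym_diff (T j -` W \<inter> space M) (U i))"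
        by (rule measure_sym_diff_triangle) measurable
      also have "sym_diff ?V (T j -` W \<inter> space M) = sym_diff (T j -` W \<inter> space M) ?V" by auto
      also have "sym_diff (T j -` W \<inter> space M) (U i) = T j -` (sym_diff (T j ` U i) W) \<inter> space M"
      proof -
        have "T j -` (T j ` U i) \<inter> space M = U i"
          using transformation_mem_image_iff[OF T sets.sets_into_space[OF U[of i]], of _ j]
            sets.sets_into_space[OF U[of i]] by blast
        then show ?thesis by blast
      qed
      also have "prob \<dots> = prob (sym_diff (T j ` U i) W)"
        by (rule preserving_vimage_measure[OF transformation_measurable[OF T] transformation_distr[OF T]])
           measurable
      finally show ?thesis .
    qed
    have "(\<lambda>j. prob (sym_diff (T j -` W \<inter> space M) ?V) + prob (sym_diff (T j ` U i) W)) \<longlonglongrightarrow> 0 + 0"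
      using S(3)[rule_format, OF W] S'(3)[rule_format, OF U[of i], folded W_def]
      by (rule tendsto_add)
    then have "prob (sym_diff ?V (U i)) \<le> 0"
      using bound by (intro LIMSEQ_le_const) auto
    then have "AE x in M. x \<notin> sym_diff ?V (U i)"
      by (intro AE_not_in) (simp add: null_sets_def emeasure_eq_measure measure_le_0_iff)
    then show ?thesis
      using AE_space
    proof eventually_elim
      case (elim x)
      then show ?case using measurable_space[OF S(1)] by (auto simp: W_def)
    qed
  qed
  then have "AE x in M. \<forall>i. S' (S x) \<in> U i \<longleftrightarrow> x \<in> U i" by (simp add: AE_all_countable)
  then show ?thesis
    using AE_space
  proof eventually_elim
    case (elim x)
    then have "code U (S' (S x)) = code U x" by (simp add: code_def)
    moreover have "S' (S x) \<in> space M"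
      using elim measurable_space[OF S(1)] measurable_space[OF S'(1)] by blast
    ultimately show ?case using cod elim(2) unfolding coded_def by metis
  qed
qed

lemma transformation_inv_image:
  assumes T: "T \<in> transformations M" and A: "A \<subseteq> space M"
  shows "inv_into (space M) T ` A = T -` A \<inter> space M"
proof -
  have "x \<in> inv_into (space M) T ` A" if "x \<in> space M" "T x \<in> A" for x
    using transformation_inv_left[OF T that(1)] that(2) by (metis imageI)
  then show ?thesis
    using A transformation_inv_right[OF T] transformation_space[OF transformation_inv[OF T]] by auto
qed

lemma (in prob_space) weak_complete:
  assumes cod: "coded M U \<psi>"
    and T: "\<And>j. T j \<in> transformations M"
    and summ: "\<And>i. summable (\<lambda>j. prob (sym_diff (T j ` U i) (T (Suc j) ` U i)))"
    and summ': "\<And>i. summable (\<lambda>j. prob (sym_diff (inv_into (space M) (T j) ` U i)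
        (inv_into (space M) (T (Suc j)) ` U i)))"
  obtains R where "R \<in> transformations M"
    "\<forall>A\<in>events. (\<lambda>j. prob (sym_diff (T j ` A) (R ` A))) \<longlonglongrightarrow> 0"
proof -
  have U: "U i \<in> events" for i using cod by (auto simp: coded_def)
  let ?I = "\<lambda>j. inv_into (space M) (T j)"
  have I: "?I j \<in> transformations M" for j using T by (rule transformation_inv)
  have sp: "A \<subseteq> space M" if "A \<in> events" for A using that by (rule sets.sets_into_space)
  obtain S where S: "S \<in> M \<rightarrow>\<^sub>M M" "distr M M S = M"
    "\<forall>A\<in>events. (\<lambda>j. prob (sym_diff (T j -` A \<inter> space M) (S -` A \<inter> space M))) \<longlonglongrightarrow> 0"
  proof (rule limit_map[OF cod transformation_measurable[OF T] transformation_distr[OF T]])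
    show "summable (\<lambda>j. prob (sym_diff (T j -` U i \<inter> space M) (T (Suc j) -` U i \<inter> space M)))" for i
      using summ'[of i] by (simp add: transformation_inv_image[OF T sp[OF U]])
  qed
  obtain S' where S': "S' \<in> M \<rightarrow>\<^sub>M M" "distr M M S' = M"
    "\<forall>A\<in>events. (\<lambda>j. prob (sym_diff (?I j -` A \<inter> space M) (S' -` A \<inter> space M))) \<longlonglongrightarrow> 0"
  proof (rule limit_map[OF cod transformation_measurable[OF I] transformation_distr[OF I]])
    show "summable (\<lambda>j. prob (sym_diff (?I j -` U i \<inter> space M) (?I (Suc j) -` U i \<inter> space M)))" for i
      using summ[of i] by (simp add: transformation_image_vimage[OF T sp[OF U]])
  qed
  have S'img: "\<forall>A\<in>events. (\<lambda>j. prob (sym_diff (T j ` A) (S' -` A \<inter> space M))) \<longlonglongrightarrow> 0"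
    using S'(3) by (simp add: transformation_image_vimage[OF T sp])
  have Simg: "\<forall>A\<in>events. (\<lambda>j. prob (sym_diff (?I j ` A) (S -` A \<inter> space M))) \<longlonglongrightarrow> 0"
    using S(3) by (simp add: transformation_inv_image[OF T sp])
  have 1: "AE x in M. S' (S x) = x"
    by (rule limit_maps_inverse[OF cod T S S'(1,2) S'img])
  have 2: "AE x in M. S (S' x) = x"
    by (rule limit_maps_inverse[OF cod I S' S(1,2) Simg])
  obtain R where R: "R \<in> transformations M" "AE x in M. R x = S x"
    by (rule AE_invertible_imp_transformation[OF S(1,2) S'(1,2) 1 2])
  have RI: "inv_into (space M) R \<in> transformations M" using R(1) by (rule transformation_inv)
  have "AE x in M. S' (R x) = x" using 1 R(2) by eventually_elim simp
  then have "AE y in M. S' (R (inv_into (space M) R y)) = inv_into (space M) R y"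
    by (rule AE_preserving[OF _ transformation_measurable[OF RI] transformation_distr[OF RI]])
  then have S'R: "AE y in M. S' y = inv_into (space M) R y"
    using AE_space by eventually_elim (simp add: transformation_inv_right[OF R(1)])
  show thesis
  proof (rule that[OF R(1)], intro ballI)
    fix A assume A: "A \<in> events"
    have "prob (sym_diff (T j ` A) (R ` A)) = prob (sym_diff (T j ` A) (S' -` A \<inter> space M))" for j
    proof (rule measure_eq_AE)
      show "AE x in M. x \<in> sym_diff (T j ` A) (R ` A) \<longleftrightarrow> x \<in> sym_diff (T j ` A) (S' -` A \<inter> space M)"
        using S'R AE_space
        by eventually_elim (simp add: transformation_image_vimage[OF R(1) sp[OF A]])
      show "sym_diff (T j ` A) (R ` A) \<in> events" "sym_diff (T j ` A) (S' -` A \<inter> space M) \<in> events"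
        using transformation_image_sets[OF T A] transformation_image_sets[OF R(1) A]
          measurable_sets[OF S'(1) A] by auto
    qed
    then show "(\<lambda>j. prob (sym_diff (T j ` A) (R ` A))) \<longlonglongrightarrow> 0"
      using S'img A by simp
  qed
qed

definition near :: "'a measure \<Rightarrow> 'a set set \<Rightarrow> real \<Rightarrow> ('a \<Rightarrow> 'a) \<Rightarrow> ('a \<Rightarrow> 'a) \<Rightarrow> bool" where
  "near M \<F> e S T \<longleftrightarrow> (\<forall>A\<in>\<F>. measure M (sym_diff (S ` A) (T ` A)) < e)"

text \<open>Openness and density in the weak topology, expressed for properties of maps instead of sets of equivalence
classes. No invariance under almost everywhere equality is required: an open property has it
automatically (\<open>weakly_open_AE_cong\<close>).\<close>

definition weakly_open :: "'a measure \<Rightarrow> (('a \<Rightarrow> 'a) \<Rightarrow> bool) \<Rightarrow> bool" where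
  "weakly_open M P \<longleftrightarrow> (\<forall>T\<in>transformations M. P T \<longrightarrow>
     (\<exists>\<F> e. finite \<F> \<and> \<F> \<subseteq> sets M \<and> 0 < e \<and> (\<forall>S\<in>transformations M. near M \<F> e S T \<longrightarrow> P S)))"

definition weakly_dense :: "'a measure \<Rightarrow> (('a \<Rightarrow> 'a) \<Rightarrow> bool) \<Rightarrow> bool" where
  "weakly_dense M P \<longleftrightarrow> (\<forall>T\<in>transformations M. \<forall>\<F> e. finite \<F> \<longrightarrow> \<F> \<subseteq> sets M \<longrightarrow> 0 < e \<longrightarrow>
     (\<exists>S\<in>transformations M. P S \<and> near M \<F> e S T))"

text \<open>The usual nested construction. Besides the sets that the current open condition asks for, the finite family \<open>\<F>\<close> of
tested sets absorbs, step by step, the coding sets and their preimages under the current map. Testing a preimage \<open>B\<close> of \<open>U i\<close> controls inverses: applying the new map to the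
symmetric difference of the two preimages of \<open>U i\<close> shows that they differ by as much as the two images of \<open>B\<close>. Thus both the maps and their
inverses are Cauchy on the coding sets, and the tolerances decrease fast enough for the limit to
satisfy all the open conditions.\<close>

lemma (in prob_space) weak_Baire:
  assumes cod: "coded M U \<psi>"
    and op: "\<And>n::nat. weakly_open M (P n)" and de: "\<And>n. weakly_dense M (P n)"
  shows "weakly_dense M (\<lambda>T. \<forall>n. P n T)"
  unfolding weakly_dense_def
proof (intro ballI allI impI)
  fix T0 \<F>0 and e0 :: real
  assume T0: "T0 \<in> transformations M" and F0: "finite \<F>0" "\<F>0 \<subseteq> events" and e0: "0 < e0"
  have U: "U i \<in> events" for i using cod by (auto simp: coded_def)
  let ?I = "inv_into (space M)"
  define valid where "valid s \<longleftrightarrow> (case s of (T, \<F>, e) \<Rightarrow>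
      T \<in> transformations M \<and> finite \<F> \<and> \<F> \<subseteq> events \<and> 0 < e)"
    for s :: "('a \<Rightarrow> 'a) \<times> 'a set set \<times> real"
  define step where "step n s s' \<longleftrightarrow> (case s of (T, \<F>, e) \<Rightarrow> case s' of (T', \<F>', e') \<Rightarrow>
      near M \<F> (e / 2) T' T \<and> \<F> \<subseteq> \<F>' \<and> e' \<le> e / 2 \<and> (\<forall>i\<le>n. U i \<in> \<F>' \<and> ?I T' ` U i \<in> \<F>') \<and>
      (\<forall>S\<in>transformations M. (\<forall>A\<in>\<F>'. prob (sym_diff (S ` A) (T' ` A)) \<le> e') \<longrightarrow> P n S))"
    for n and s s' :: "('a \<Rightarrow> 'a) \<times> 'a set set \<times> real"
  have "\<exists>f. \<forall>n. (valid (f n) \<and> (n = 0 \<longrightarrow> f n = (T0, \<F>0, e0 / 2))) \<and> step n (f n) (f (Suc n))"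
  proof (rule dependent_nat_choice)
    show "\<exists>s. valid s \<and> ((0::nat) = 0 \<longrightarrow> s = (T0, \<F>0, e0 / 2))"
      by (rule exI[of _ "(T0, \<F>0, e0 / 2)"]) (use T0 F0 e0 in \<open>simp add: valid_def\<close>)
    fix s n assume "valid s \<and> (n = (0::nat) \<longrightarrow> s = (T0, \<F>0, e0 / 2))"
    then obtain T \<F> e where s: "s = (T, \<F>, e)" "T \<in> transformations M" "finite \<F>" "\<F> \<subseteq> events" "0 < e"
      by (auto simp: valid_def)
    obtain T' where T': "T' \<in> transformations M" "P n T'" "near M \<F> (e / 2) T' T"
      using de[of n, unfolded weakly_dense_def, rule_format, OF s(2,3,4), of "e / 2"] s(5) by auto
    obtain \<G> d where G: "finite \<G>" "\<G> \<subseteq> events" "0 < d"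
      "\<forall>S\<in>transformations M. near M \<G> d S T' \<longrightarrow> P n S"
      using op[of n, unfolded weakly_open_def, rule_format, OF T'(1,2)] by auto
    define \<F>' where "\<F>' = \<F> \<union> \<G> \<union> U ` {..n} \<union> (\<lambda>i. ?I T' ` U i) ` {..n}"
    \<comment> \<open>half of \<open>d\<close>, as the limit satisfies only non-strict inequalities\<close>
    define e' where "e' = min (e / 2) (d / 2)"
    have "valid (T', \<F>', e')"
      using T' s G U transformation_image_sets[OF transformation_inv[OF T'(1)] U]
      by (auto simp: valid_def \<F>'_def e'_def)
    moreover have "step n s (T', \<F>', e')"
    proof -
      have "P n S" if S: "S \<in> transformations M" "\<forall>A\<in>\<F>'. prob (sym_diff (S ` A) (T' ` A)) \<le> e'" for S
      proof -
        have "near M \<G> d S T'" unfolding near_def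
        proof
          fix A assume "A \<in> \<G>"
          then have "prob (sym_diff (S ` A) (T' ` A)) \<le> e'" using S(2) by (auto simp: \<F>'_def)
          also have "e' < d" using G(3) by (simp add: e'_def)
          finally show "prob (sym_diff (S ` A) (T' ` A)) < d" .
        qed
        then show ?thesis using G(4) S(1) by blast
      qed
      then show ?thesis using T'(3) s(1) by (auto simp: step_def \<F>'_def e'_def)
    qed
    ultimately show "\<exists>s'. (valid s' \<and> (Suc n = 0 \<longrightarrow> s' = (T0, \<F>0, e0 / 2))) \<and> step n s s'"
      by blast
  qed
  then obtain f where f: "\<And>n. valid (f n)" "f 0 = (T0, \<F>0, e0 / 2)" "\<And>n. step n (f n) (f (Suc n))"
    by blast
  define T \<F> e where "T n = fst (f n)" and "\<F> n = fst (snd (f n))" and "e n = snd (snd (f n))" for n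
  have fn: "f n = (T n, \<F> n, e n)" for n by (simp add: T_def \<F>_def e_def)
  have T: "T n \<in> transformations M" and F: "\<F> n \<subseteq> events" and e: "0 < e n" for n
    using f(1)[of n] by (auto simp: valid_def fn)
  have near_step: "prob (sym_diff (T (Suc n) ` A) (T n ` A)) < e n / 2" if "A \<in> \<F> n" for n A
    using f(3)[of n] that by (auto simp: step_def fn near_def)
  have FS: "\<F> n \<subseteq> \<F> (Suc n)" and eS: "e (Suc n) \<le> e n / 2" for n
    using f(3)[of n] by (auto simp: step_def fn)
  have UF: "U i \<in> \<F> (Suc n)" "?I (T (Suc n)) ` U i \<in> \<F> (Suc n)" if "i \<le> n" for i n
    using f(3)[of n] that by (auto simp: step_def fn)
  have PS: "P n S" if "S \<in> transformations M" "\<forall>A\<in>\<F> (Suc n). prob (sym_diff (S ` A) (T (Suc n) ` A)) \<le> e (Suc n)" for n S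
    using f(3)[of n] that by (auto simp: step_def fn)
  have Fmono: "\<F> k \<subseteq> \<F> l" if "k \<le> l" for k l
    using lift_Suc_mono_le[of \<F>, OF FS that] .
  have egeo: "e n \<le> e 0 * (1/2)^n" for n
  proof (induction n)
    case (Suc n)
    then show ?case using eS[of n] by simp
  qed simp
  have img: "T n ` A \<in> events" if "A \<in> events" for n A
    using transformation_image_sets[OF T that] .
  \<comment> \<open>The bound telescopes since each step costs at most \<open>e l / 2 \<le> e l - e (Suc l)\<close>.\<close>
  have tele: "prob (sym_diff (T l ` A) (T k ` A)) \<le> e k - e l" if A: "A \<in> \<F> k" and kl: "k \<le> l" for k l A
    using kl
  proof (induction l rule: dec_induct)
    case (step l)
    have "A \<in> \<F> l" using Fmono[OF step.hyps(1)] A by blast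
    then have "prob (sym_diff (T (Suc l) ` A) (T l ` A)) < e l / 2" by (rule near_step)
    moreover have "prob (sym_diff (T (Suc l) ` A) (T k ` A)) \<le>
        prob (sym_diff (T (Suc l) ` A) (T l ` A)) + prob (sym_diff (T l ` A) (T k ` A))"
      using A F by (intro measure_sym_diff_triangle img) auto
    ultimately show ?case using step.IH eS[of l] by linarith
  qed simp
  have geo: "summable (\<lambda>n. e 0 * (1/2)^n)" by (intro summable_mult summable_geometric) simp
  obtain R where R: "R \<in> transformations M"
    and lim: "\<forall>A\<in>events. (\<lambda>j. prob (sym_diff (T j ` A) (R ` A))) \<longlonglongrightarrow> 0"
  proof (rule weak_complete[OF cod T])
    fix i
    let ?D = "\<lambda>j. sym_diff (?I (T j) ` U i) (?I (T (Suc j)) ` U i)"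
    show "summable (\<lambda>j. prob (sym_diff (T j ` U i) (T (Suc j) ` U i)))"
    proof (rule summable_comparison_test'[OF geo, of "Suc i"])
      fix j assume "Suc i \<le> j"
      then have "U i \<in> \<F> j" using UF(1)[of i "j - 1"] by simp
      then have "prob (sym_diff (T (Suc j) ` U i) (T j ` U i)) < e j / 2" by (rule near_step)
      then show "norm (prob (sym_diff (T j ` U i) (T (Suc j) ` U i))) \<le> e 0 * (1/2)^j"
        using egeo[of j] e[of j] by (simp add: Un_commute)
    qed
    show "summable (\<lambda>j. prob (?D j))"
    proof (rule summable_comparison_test'[OF geo, of "Suc i"])
      fix j assume "Suc i \<le> j"
      then have "?I (T j) ` U i \<in> \<F> j" using UF(2)[of i "j - 1"] by simp
      then have cl: "prob (sym_diff (T (Suc j) ` ?I (T j) ` U i) (T j ` ?I (T j) ` U i)) < e j / 2"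
        by (rule near_step)
      have unimg: "T n ` ?I (T n) ` U i = U i" for n
        using sets.sets_into_space[OF U] transformation_inv_right[OF T, of _ n]
        by (force simp: image_iff)
      have Iev: "?I (T n) ` U i \<in> events" for n
        using transformation_image_sets[OF transformation_inv[OF T] U] .
      have "prob (?D j)
          = prob (T (Suc j) ` ?D j)"
        using transformation_image_measure[OF T] Iev by (metis sets.Un sets.Diff)
      also have "\<dots> = prob (sym_diff (T (Suc j) ` ?I (T j) ` U i) (U i))"
        using transformation_image_sym_diff[OF T sets.sets_into_space[OF Iev] sets.sets_into_space[OF Iev],
            of "Suc j" j "Suc j"] by (simp add: unimg)
      also have "\<dots> < e j / 2" using cl by (simp add: unimg)
      finally show "norm (prob (?D j)) \<le> e 0 * (1/2)^j"
        using egeo[of j] e[of j] by simp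
    qed
  qed
  have R_close: "prob (sym_diff (R ` A) (T k ` A)) \<le> e k" if A: "A \<in> \<F> k" for k A
  proof -
    have Aev: "A \<in> events" using A F by blast
    have "prob (sym_diff (R ` A) (T k ` A)) \<le> prob (sym_diff (T l ` A) (R ` A)) + e k" if "k \<le> l" for l
    proof -
      have "prob (sym_diff (R ` A) (T k ` A)) \<le>
          prob (sym_diff (R ` A) (T l ` A)) + prob (sym_diff (T l ` A) (T k ` A))"
        using Aev transformation_image_sets[OF R Aev] by (intro measure_sym_diff_triangle img) auto
      then show ?thesis using tele[OF A that] e[of l] by (simp add: Un_commute)
    qed
    moreover have "(\<lambda>l. prob (sym_diff (T l ` A) (R ` A)) + e k) \<longlonglongrightarrow> 0 + e k"
      using lim Aev by (intro tendsto_add) auto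
    ultimately show ?thesis by (intro LIMSEQ_le_const[of _ "e k"]) auto
  qed
  have "near M \<F>0 e0 R T0"
    unfolding near_def using R_close[of _ 0] f(2) fn[of 0] e0 by fastforce
  moreover have "P n R" for n by (rule PS[OF R]) (use R_close in blast)
  ultimately show "\<exists>S\<in>transformations M. (\<forall>n. P n S) \<and> near M \<F>0 e0 S T0"
    using R by blast
qed

lemma weak_nhd:
  assumes "prob_space M" and W: "openin (weak_topology M) W" and T: "T \<in> transformations M"
    and mem: "ae_eq M `` {T} \<in> W"
  obtains \<F> e where "finite \<F>" "\<F> \<subseteq> sets M" "0 < e"
    "\<forall>S\<in>transformations M. near M \<F> e S T \<longrightarrow> ae_eq M `` {S} \<in> W"
proof -
  interpret prob_space M by fact
  let ?B = "{weak_ball M T A e | T A e. T \<in> transformations M \<and> A \<in> sets M \<and> 0 < e}"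
  let ?nhd = "\<lambda>W. \<exists>\<F> e. finite \<F> \<and> \<F> \<subseteq> sets M \<and> 0 < e \<and>
      (\<forall>S\<in>transformations M. near M \<F> e S T \<longrightarrow> ae_eq M `` {S} \<in> W)"
  have "generate_topology_on ?B W"
    using W by (simp add: weak_topology_def openin_topology_generated_by_iff)
  then have "ae_eq M `` {T} \<in> W \<longrightarrow> ?nhd W"
  proof (induction)
    case Empty
    then show ?case by simp
  next
    case (Int a b)
    show ?case
    proof
      assume "ae_eq M `` {T} \<in> a \<inter> b"
      then obtain F1 e1 F2 e2 where "finite F1" "F1 \<subseteq> sets M" "0 < (e1::real)"
        "\<forall>S\<in>transformations M. near M F1 e1 S T \<longrightarrow> ae_eq M `` {S} \<in> a"
        "finite F2" "F2 \<subseteq> sets M" "0 < (e2::real)"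
        "\<forall>S\<in>transformations M. near M F2 e2 S T \<longrightarrow> ae_eq M `` {S} \<in> b"
        using Int.IH by auto
      then show "?nhd (a \<inter> b)"
        by (intro exI[of _ "F1 \<union> F2"] exI[of _ "min e1 e2"]) (auto simp: near_def)
    qed
  next
    case (UN K)
    show ?case
    proof
      assume "ae_eq M `` {T} \<in> \<Union> K"
      then obtain k where k: "k \<in> K" "ae_eq M `` {T} \<in> k" by blast
      from UN.IH[OF k(1)] k show "?nhd (\<Union> K)" by blast
    qed
  next
    case (Basis s)
    then obtain Q A e where Q: "Q \<in> transformations M" "A \<in> sets M" "0 < e" "s = weak_ball M Q A e"
      by blast
    show ?case
    proof
      assume "ae_eq M `` {T} \<in> s"
      then have lt: "prob (sym_diff (T ` A) (Q ` A)) < e"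
        using in_weak_ball_iff[OF T Q(1,2)] Q(4) by simp
      define d where "d = e - prob (sym_diff (T ` A) (Q ` A))"
      have "ae_eq M `` {S} \<in> s" if S: "S \<in> transformations M" "near M {A} d S T" for S
      proof -
        have "prob (sym_diff (S ` A) (Q ` A)) \<le> prob (sym_diff (S ` A) (T ` A)) + prob (sym_diff (T ` A) (Q ` A))"
          using Q S(1) T by (intro measure_sym_diff_triangle transformation_image_sets) auto
        also have "\<dots> < e" using S(2) by (simp add: near_def d_def)
        finally show ?thesis using in_weak_ball_iff[OF S(1) Q(1,2)] Q(4) by simp
      qed
      then show "?nhd s"
        using lt Q(2) by (intro exI[of _ "{A}"] exI[of _ d]) (auto simp: d_def)
    qed
  qed
  then show thesis using mem that by blast
qed

lemma weakly_open_imp_openin: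
  assumes "weakly_open M P"
  shows "openin (weak_topology M) {ae_eq M `` {T} | T. T \<in> transformations M \<and> P T}"
    (is "openin _ ?O")
proof (subst openin_subopen, intro ballI)
  fix C assume "C \<in> ?O"
  then obtain T where T: "T \<in> transformations M" "P T" "C = ae_eq M `` {T}" by blast
  then obtain \<F> e where F: "finite \<F>" "\<F> \<subseteq> sets M" "0 < e"
    "\<forall>S\<in>transformations M. near M \<F> e S T \<longrightarrow> P S"
    using assms[unfolded weakly_open_def, rule_format, OF T(1,2)] by auto
  define W where "W = topspace (weak_topology M) \<inter> (\<Inter>A\<in>\<F>. weak_ball M T A e)"
  have "openin (weak_topology M) (weak_ball M T A e)" if "A \<in> \<F>" for A
    unfolding weak_topology_def by (rule topology_generated_by_Basis) (use T F that in blast)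
  then have "openin (weak_topology M) W"
    unfolding W_def Int_commute[of "topspace _"] using F(1) by (intro openin_INT)
  moreover have "C \<in> W"
    using T F by (auto simp: W_def topspace_weak_topology in_weak_ball_iff intro: quotientI)
  moreover have "W \<subseteq> ?O"
  proof
    fix D assume D: "D \<in> W"
    then obtain S where S: "S \<in> transformations M" "D = ae_eq M `` {S}"
      by (auto simp: W_def topspace_weak_topology quotient_def)
    have "near M \<F> e S T"
      unfolding near_def using D S F(2) T(1) in_weak_ball_iff[OF S(1) T(1)]
      by (auto simp: W_def subset_iff)
    then show "D \<in> ?O" using F(4) S by blast
  qed
  ultimately show "\<exists>W. openin (weak_topology M) W \<and> C \<in> W \<and> W \<subseteq> ?O" by blast
qed

lemma weakly_open_AE_cong:
  assumes "weakly_open M P" and S: "S \<in> transformations M" "P S" and T: "(S, T) \<in> ae_eq M"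
  shows "P T"
proof -
  have TT: "T \<in> transformations M" "AE x in M. T x = S x"
    using T by (auto simp: ae_eq_def elim: eventually_mono)
  obtain \<F> e where F: "\<F> \<subseteq> sets M" "0 < e" "\<forall>S'\<in>transformations M. near M \<F> e S' S \<longrightarrow> P S'"
    using assms(1)[unfolded weakly_open_def, rule_format, OF S(1,2)] by auto
  have "measure M (sym_diff (T ` A) (S ` A)) = measure M {}" if A: "A \<in> sets M" for A
  proof (rule measure_eq_AE)
    show "AE x in M. x \<in> sym_diff (T ` A) (S ` A) \<longleftrightarrow> x \<in> {}"
      using AE_image_eq[OF TT(1) S(1) TT(2) A] by eventually_elim auto
  qed (use transformation_image_sets[OF TT(1) A] transformation_image_sets[OF S(1) A] in auto)
  then have "near M \<F> e T S" using F(1,2) by (auto simp: near_def)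
  then show ?thesis using F(3) TT(1) by blast
qed

text \<open>The \<open>G\<^sub>\<delta>\<close> set consists of the classes that, for each \<open>n\<close>, contain some map satisfying \<open>P n\<close>. By openness
every map in such a class satisfies every \<open>P n\<close>.\<close>

lemma typicalI:
  fixes M :: "'a measure"
  assumes "prob_space M" and cod: "coded M U \<psi>"
    and op: "\<And>n::nat. weakly_open M (P n)" and de: "\<And>n. weakly_dense M (P n)"
    and imp: "\<And>T. T \<in> transformations M \<Longrightarrow> (\<And>n. P n T) \<Longrightarrow> Q T"
  shows "typical M Q"
proof -
  interpret prob_space M by fact
  define O' where "O' n = {ae_eq M `` {T} | T. T \<in> transformations M \<and> P n T}" for n
  define G where "G = (\<Inter>n. O' n)"
  have open_O: "openin (weak_topology M) (O' n)" for n
    unfolding O'_def by (rule weakly_open_imp_openin[OF op])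
  have "gdelta_in (weak_topology M) G"
    unfolding G_def by (rule gdelta_in_Inter) (auto intro: open_imp_gdelta_in open_O)
  moreover have "weak_topology M closure_of G = topspace (weak_topology M)"
    unfolding dense_intersects_open
  proof (intro allI impI)
    fix W assume "openin (weak_topology M) W \<and> W \<noteq> {}"
    then obtain C where W: "openin (weak_topology M) W" "C \<in> W" by blast
    then have "C \<in> topspace (weak_topology M)" by (meson openin_subset subsetD)
    then obtain T where T: "T \<in> transformations M" "C = ae_eq M `` {T}"
      by (auto simp: topspace_weak_topology quotient_def)
    obtain \<F> e where F: "finite \<F>" "\<F> \<subseteq> events" "0 < e"
      "\<forall>S\<in>transformations M. near M \<F> e S T \<longrightarrow> ae_eq M `` {S} \<in> W"
      by (rule weak_nhd[OF prob_space_axioms W(1) T(1)]) (use W T in auto)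
    obtain S where S: "S \<in> transformations M" "\<forall>n. P n S" "near M \<F> e S T"
      using weak_Baire[where P=P, OF cod op de, unfolded weakly_dense_def, rule_format, OF T(1) F(1-3)] by auto
    then have "ae_eq M `` {S} \<in> G" "ae_eq M `` {S} \<in> W"
      using F(4) by (auto simp: G_def O'_def)
    then show "G \<inter> W \<noteq> {}" by blast
  qed
  moreover have "Q T" if C: "C \<in> G" and T: "T \<in> C" for C T
  proof (rule imp)
    have *: "T \<in> transformations M \<and> P n T" for n
    proof -
      obtain S where S: "S \<in> transformations M" "P n S" "C = ae_eq M `` {S}"
        using C by (auto simp: G_def O'_def)
      then have "(S, T) \<in> ae_eq M" using T by simp
      then show ?thesis using weakly_open_AE_cong[OF op S(1,2)] by (auto simp: ae_eq_def)
    qed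
    then show "T \<in> transformations M" "P n T" for n by auto
  qed
  ultimately show ?thesis unfolding typical_def by blast
qed

section \<open>Displacements and density\<close>

text \<open>Forward images are used throughout, since the weak topology is defined by them and composing with a further
power does not change displacements (\<open>displacement_shift\<close>).\<close>

definition displacement :: "'a measure \<Rightarrow> 'a set \<Rightarrow> ('a \<Rightarrow> 'a) \<Rightarrow> nat \<Rightarrow> nat \<Rightarrow> real" where
  "displacement M A T i j = measure M (sym_diff ((T ^^ i) ` A) ((T ^^ j) ` A))"

context prob_space
begin

text \<open>Passing from one power to the next adds at most the error of a single application to \<open>(T ^^ i) ` A\<close>, because \<open>S\<close>
preserves the measure of symmetric differences.\<close>

lemma power_image_continuous:
  assumes T: "T \<in> transformations M" and A: "A \<in> events" and d: "0 < d"
  obtains \<F> e where "finite \<F>" "\<F> \<subseteq> events" "0 < e"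
    "\<forall>S\<in>transformations M. near M \<F> e S T \<longrightarrow> (\<forall>i\<le>N. prob (sym_diff ((S ^^ i) ` A) ((T ^^ i) ` A)) < d)"
proof
  define e where "e = d / (real N + 1)"
  let ?F = "(\<lambda>i. (T ^^ i) ` A) ` {..N}"
  have img: "(S ^^ i) ` A \<in> events" if "S \<in> transformations M" for S i
    using transformation_image_sets[OF transformation_pow[OF that] A] .
  show "finite ?F" "?F \<subseteq> events" "0 < e" using img[OF T] d by (auto simp: e_def)
  show "\<forall>S\<in>transformations M. near M ?F e S T \<longrightarrow>
      (\<forall>i\<le>N. prob (sym_diff ((S ^^ i) ` A) ((T ^^ i) ` A)) < d)"
  proof (intro ballI impI allI)
    fix S i assume S: "S \<in> transformations M" and nr: "near M ?F e S T" and i: "i \<le> N"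
    have "prob (sym_diff ((S ^^ i) ` A) ((T ^^ i) ` A)) \<le> real i * e" if "i \<le> N" for i
      using that
    proof (induction i)
      case (Suc i)
      let ?s = "(S ^^ i) ` A" and ?t = "(T ^^ i) ` A"
      have sp: "?s \<subseteq> space M" "?t \<subseteq> space M"
        using img S T sets.sets_into_space by blast+
      have ev: "?s \<in> events" "?t \<in> events" using img S T by auto
      have "prob (sym_diff ((S ^^ Suc i) ` A) ((T ^^ Suc i) ` A)) = prob (sym_diff (S ` ?s) (T ` ?t))"
        by (simp add: image_comp)
      also have "\<dots> \<le> prob (sym_diff (S ` ?s) (S ` ?t)) + prob (sym_diff (S ` ?t) (T ` ?t))"
        using ev by (intro measure_sym_diff_triangle transformation_image_sets[OF S]
            transformation_image_sets[OF T]) auto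
      also have "sym_diff (S ` ?s) (S ` ?t) = S ` sym_diff ?s ?t"
        by (rule transformation_image_sym_diff[OF S sp])
      also have "prob \<dots> = prob (sym_diff ?s ?t)"
        by (rule transformation_image_measure[OF S]) (use ev in auto)
      also have "\<dots> \<le> real i * e" using Suc by simp
      also have "prob (sym_diff (S ` ?t) (T ` ?t)) \<le> e"
        using nr Suc.prems by (auto simp: near_def intro: less_imp_le)
      finally show ?case by (simp add: algebra_simps)
    qed simp
    from this[OF i] have "prob (sym_diff ((S ^^ i) ` A) ((T ^^ i) ` A)) \<le> real i * e" .
    also have "\<dots> < d"
    proof -
      have "real i * d < d * (real N + 1)" using i d by (simp add: algebra_simps mult_left_mono add_strict_increasing)
      then show ?thesis by (simp add: e_def divide_less_eq)
    qed
    finally show "prob (sym_diff ((S ^^ i) ` A) ((T ^^ i) ` A)) < d" .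
  qed
qed

lemma displacement_continuous:
  assumes T: "T \<in> transformations M" and A: "A \<in> events" and d: "0 < d"
  obtains \<F> e where "finite \<F>" "\<F> \<subseteq> events" "0 < e"
    "\<forall>S\<in>transformations M. near M \<F> e S T \<longrightarrow> \<bar>displacement M A S i j - displacement M A T i j\<bar> < d"
proof -
  obtain \<F> e where F: "finite \<F>" "\<F> \<subseteq> events" "0 < e"
    "\<forall>S\<in>transformations M. near M \<F> e S T \<longrightarrow> (\<forall>k\<le>max i j. prob (sym_diff ((S ^^ k) ` A) ((T ^^ k) ` A)) < d / 2)"
    by (rule power_image_continuous[OF T A, of "d / 2" "max i j"]) (use d in auto)
  have "\<bar>displacement M A S i j - displacement M A T i j\<bar> < d"
    if S: "S \<in> transformations M" "near M \<F> e S T" for S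
  proof -
    have ev: "(Q ^^ k) ` A \<in> events" if "Q \<in> {S, T}" for k Q
      using transformation_image_sets[OF transformation_pow A] S T that by blast
    have small: "prob (sym_diff ((S ^^ k) ` A) ((T ^^ k) ` A)) < d / 2" if "k = i \<or> k = j" for k
      using F(4) S that by auto
    have tri: "displacement M A Q i j \<le> prob (sym_diff ((Q ^^ i) ` A) ((Q' ^^ i) ` A))
        + displacement M A Q' i j + prob (sym_diff ((Q' ^^ j) ` A) ((Q ^^ j) ` A))"
      if "Q \<in> {S, T}" "Q' \<in> {S, T}" for Q Q'
    proof -
      have "displacement M A Q i j \<le> prob (sym_diff ((Q ^^ i) ` A) ((Q' ^^ i) ` A))
          + prob (sym_diff ((Q' ^^ i) ` A) ((Q ^^ j) ` A))"
        unfolding displacement_def by (intro measure_sym_diff_triangle ev that)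
      also have "prob (sym_diff ((Q' ^^ i) ` A) ((Q ^^ j) ` A)) \<le> displacement M A Q' i j
          + prob (sym_diff ((Q' ^^ j) ` A) ((Q ^^ j) ` A))"
        unfolding displacement_def by (intro measure_sym_diff_triangle ev that)
      finally show ?thesis by simp
    qed
    show ?thesis
      using tri[of S T] tri[of T S] small[of i] small[of j]
        Un_commute[of "(S ^^ i) ` A - (T ^^ i) ` A"] Un_commute[of "(S ^^ j) ` A - (T ^^ j) ` A"]
      by simp
  qed
  then show thesis using that F by blast
qed

lemma weakly_open_displacement:
  assumes A: "A \<in> events" and W: "open W"
  shows "weakly_open M (\<lambda>T. displacement M A T i j \<in> W)"
  unfolding weakly_open_def
proof (intro ballI impI)
  fix T assume T: "T \<in> transformations M" and "displacement M A T i j \<in> W"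
  then obtain d where d: "0 < d" "\<And>r. \<bar>r - displacement M A T i j\<bar> < d \<Longrightarrow> r \<in> W"
    using W by (auto simp: open_dist dist_real_def)
  obtain \<F> e where "finite \<F>" "\<F> \<subseteq> events" "0 < e" and "\<forall>S\<in>transformations M. near M \<F> e S T \<longrightarrow>
      \<bar>displacement M A S i j - displacement M A T i j\<bar> < d"
    by (rule displacement_continuous[OF T A d(1)])
  then show "\<exists>\<F> e. finite \<F> \<and> \<F> \<subseteq> events \<and> 0 < e \<and>
      (\<forall>S\<in>transformations M. near M \<F> e S T \<longrightarrow> displacement M A S i j \<in> W)"
    using d(2) by blast
qed

lemma weakly_open_displacement_less: "A \<in> events \<Longrightarrow> weakly_open M (\<lambda>T. displacement M A T i j < r)"
  using weakly_open_displacement[of A "{..<r}" i j] by simp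

lemma weakly_open_displacement_greater: "A \<in> events \<Longrightarrow> weakly_open M (\<lambda>T. r < displacement M A T i j)"
  using weakly_open_displacement[of A "{r<..}" i j] by simp

end

lemma weakly_open_ex:
  assumes "\<And>m. weakly_open M (P m)"
  shows "weakly_open M (\<lambda>T. \<exists>m. P m T)"
  unfolding weakly_open_def
proof (intro ballI impI)
  fix T assume T: "T \<in> transformations M" "\<exists>m. P m T"
  then obtain m where m: "P m T" by blast
  show "\<exists>\<F> e. finite \<F> \<and> \<F> \<subseteq> sets M \<and> 0 < e \<and>
      (\<forall>S\<in>transformations M. near M \<F> e S T \<longrightarrow> (\<exists>m. P m S))"
    using assms[of m, unfolded weakly_open_def, rule_format, OF T(1) m] by fast
qed

lemma weakly_open_disj:
  assumes "weakly_open M P" "weakly_open M Q"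
  shows "weakly_open M (\<lambda>T. P T \<or> Q T)"
proof -
  have "weakly_open M (\<lambda>T. \<exists>b. (if b then P else Q) T)"
    by (rule weakly_open_ex) (use assms in auto)
  moreover have "(\<exists>b. (if b then P else Q) T) \<longleftrightarrow> P T \<or> Q T" for T
    by (metis (full_types))
  ultimately show ?thesis by simp
qed

lemma weakly_open_conj:
  assumes "weakly_open M P" "weakly_open M Q"
  shows "weakly_open M (\<lambda>T. P T \<and> Q T)"
  unfolding weakly_open_def
proof (intro ballI impI)
  fix T assume T: "T \<in> transformations M" "P T \<and> Q T"
  obtain F1 e1 where 1: "finite F1" "F1 \<subseteq> sets M" "0 < (e1::real)"
    "\<forall>S\<in>transformations M. near M F1 e1 S T \<longrightarrow> P S"
    using assms(1)[unfolded weakly_open_def, rule_format, OF T(1)] T(2) by auto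
  obtain F2 e2 where 2: "finite F2" "F2 \<subseteq> sets M" "0 < (e2::real)"
    "\<forall>S\<in>transformations M. near M F2 e2 S T \<longrightarrow> Q S"
    using assms(2)[unfolded weakly_open_def, rule_format, OF T(1)] T(2) by auto
  have "near M F1 e1 S T \<and> near M F2 e2 S T" if "near M (F1 \<union> F2) (min e1 e2) S T" for S
    using that by (auto simp: near_def)
  then show "\<exists>\<F> e. finite \<F> \<and> \<F> \<subseteq> sets M \<and> 0 < e \<and>
      (\<forall>S\<in>transformations M. near M \<F> e S T \<longrightarrow> P S \<and> Q S)"
    using 1 2 by (intro exI[of _ "F1 \<union> F2"] exI[of _ "min e1 e2"]) auto
qed

lemma weakly_open_True: "weakly_open M (\<lambda>T. True)"
  unfolding weakly_open_def by (auto intro!: exI[of _ "{}"] exI[of _ 1])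

lemma weakly_open_ball:
  assumes "finite I" "\<And>i. i \<in> I \<Longrightarrow> weakly_open M (P i)"
  shows "weakly_open M (\<lambda>T. \<forall>i\<in>I. P i T)"
  using assms
proof (induction I rule: finite_induct)
  case (insert a I)
  then show ?case using weakly_open_conj[of M "P a" "\<lambda>T. \<forall>i\<in>I. P i T"] by simp
qed (simp add: weakly_open_True)

lemma (in prob_space) measure_sym_diff_eq:
  assumes [measurable]: "A \<in> events" "B \<in> events"
  shows "prob (sym_diff A B) = prob A + prob B - 2 * prob (A \<inter> B)"
proof -
  have "prob (sym_diff A B) = prob (A - B) + prob (B - A)"
    by (rule finite_measure_Union) auto
  then show ?thesis
    by (simp add: finite_measure_Diff' Int_commute)
qed

lemma (in prob_space) displacement_correlation:
  assumes T: "T \<in> transformations M" and A: "A \<in> events"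
  shows "displacement M A T i 0 = 2 * prob A - 2 * prob ((T ^^ i) ` A \<inter> A)"
  using measure_sym_diff_eq[OF transformation_image_sets[OF transformation_pow[OF T] A] A, of i]
    transformation_image_measure[OF transformation_pow[OF T] A, of i]
  by (simp add: displacement_def)

lemma displacement_shift:
  assumes T: "T \<in> transformations M" and A: "A \<in> sets M"
  shows "displacement M A T (i + k) (j + k) = displacement M A T i j"
proof -
  have Tk: "T ^^ k \<in> transformations M" using T by (rule transformation_pow)
  have ev: "(T ^^ n) ` A \<in> sets M" for n
    using transformation_image_sets[OF transformation_pow[OF T] A] .
  have "(T ^^ (n + k)) ` A = (T ^^ k) ` (T ^^ n) ` A" for n
    by (simp add: add.commute[of n] funpow_add image_comp)
  then have "sym_diff ((T ^^ (i + k)) ` A) ((T ^^ (j + k)) ` A) = (T ^^ k) ` sym_diff ((T ^^ i) ` A) ((T ^^ j) ` A)"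
    using transformation_image_sym_diff[OF Tk sets.sets_into_space[OF ev] sets.sets_into_space[OF ev]] by simp
  then show ?thesis
    using transformation_image_measure[OF Tk, of "sym_diff ((T ^^ i) ` A) ((T ^^ j) ` A)"] ev
    by (simp add: displacement_def)
qed

lemma sum_blocks:
  fixes f :: "nat \<Rightarrow> real"
  shows "(\<Sum>j<q * L. f j) = (\<Sum>a<q. \<Sum>t<L. f (a * L + t))"
proof -
  have block: "sum f {a * L..<a * L + L} = (\<Sum>t<L. f (a * L + t))" for a
    using sum.shift_bounds_nat_ivl[of f 0 "a * L" L] by (simp add: lessThan_atLeast0 add.commute)
  show ?thesis
    using sum.nat_group[of f L q] by (simp add: block)
qed

lemma sum_initial_residues:
  assumes "s \<le> L"
  shows "(\<Sum>j<q * L. of_bool (j mod L < s) :: real) = real q * real s"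
proof -
  have "(\<Sum>t<L. of_bool ((a * L + t) mod L < s) :: real) = real s" for a
  proof -
    have "(\<Sum>t<L. of_bool ((a * L + t) mod L < s) :: real) = (\<Sum>t<L. of_bool (t < s))"
      by (rule sum.cong) auto
    also have "\<dots> = real (card {t\<in>{..<L}. t < s})" by (simp add: sum_of_bool_eq Int_def)
    also have "{t\<in>{..<L}. t < s} = {..<s}" using assms by auto
    finally show ?thesis by simp
  qed
  then show ?thesis by (simp add: sum_blocks)
qed

text \<open>If \<open>n = q * L\<close> and the letters follow \<open>T\<close> except at the ends of the blocks of length \<open>L\<close>, then
\<open>R ` B\<close> and \<open>T ` B\<close> overlap up to \<open>1 / L\<close>.\<close>

lemma letters_near:
  fixes Z :: "'b measure"
  assumes "prob_space M" "0 < q" "0 < L" and n: "n = q * L"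
    and T: "T \<in> transformations M" and R: "R \<in> transformations M" and B: "B \<in> sets M"
    and l: "\<And>j. j < n \<Longrightarrow> l j \<in> Z \<rightarrow>\<^sub>M M" "\<And>j. j < n \<Longrightarrow> distr Z M (l j) = M"
    and next_l: "\<And>j z. Suc j < n \<Longrightarrow> Suc j mod L = Suc (j mod L) \<Longrightarrow> z \<in> space Z \<Longrightarrow> l (Suc j) z = T (l j z)"
    and corr: "measure M (R ` B \<inter> T ` B) =
       (\<Sum>j<n. measure Z {z\<in>space Z. l j z \<in> B \<and> l (Suc j mod n) z \<in> T ` B}) / n"
  shows "measure M (sym_diff (R ` B) (T ` B)) \<le> 2 / L"
proof -
  interpret prob_space M by fact
  let ?m = "\<lambda>j. measure Z {z\<in>space Z. l j z \<in> B \<and> l (Suc j mod n) z \<in> T ` B}"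
  have summand: "prob B - of_bool (\<not> j mod L < L - 1) \<le> ?m j" if j: "j < n" for j
  proof (cases "j mod L < L - 1")
    case True
    then have m: "Suc j mod L = Suc (j mod L)" by (simp add: mod_Suc)
    have "Suc j \<noteq> n"
    proof
      assume "Suc j = n"
      then have "Suc j mod L = 0" by (simp add: n)
      then show False using m by simp
    qed
    then have "Suc j < n" using j by simp
    then have "{z\<in>space Z. l j z \<in> B \<and> l (Suc j mod n) z \<in> T ` B} = l j -` B \<inter> space Z"
      using next_l[OF _ m] by auto
    also have "measure Z \<dots> = prob B"
      using measure_distr[OF l(1)[OF j] B] l(2)[OF j] by simp
    finally show ?thesis using True by simp
  next
    case False
    then show ?thesis using prob_le_1[of B] measure_nonneg[of Z] by (simp add: order_trans[of _ 0])
  qed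
  have cnt: "(\<Sum>j<n. of_bool (\<not> j mod L < L - 1) :: real) = real q"
  proof -
    have "(\<Sum>j<n. of_bool (\<not> j mod L < L - 1) :: real) = (\<Sum>j<n. 1 - of_bool (j mod L < L - 1))"
      by (rule sum.cong) auto
    also have "\<dots> = real n - real q * real (L - 1)"
      unfolding n sum_subtractf sum_initial_residues[OF diff_le_self] by simp
    also have "\<dots> = real q" using \<open>0 < L\<close> by (simp add: n of_nat_diff algebra_simps)
    finally show ?thesis .
  qed
  have "(\<Sum>j<n. prob B - of_bool (\<not> j mod L < L - 1)) \<le> (\<Sum>j<n. ?m j)"
    by (rule sum_mono) (use summand in simp)
  then have "real n * prob B - real q \<le> (\<Sum>j<n. ?m j)"
    by (simp only: sum_subtractf cnt) simp
  then have "(real n * prob B - real q) / n \<le> prob (R ` B \<inter> T ` B)"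
    unfolding corr by (rule divide_right_mono) simp
  then have "prob B - 1 / L \<le> prob (R ` B \<inter> T ` B)"
    using assms(2,3) by (simp add: n diff_divide_distrib)
  then show ?thesis
    using measure_sym_diff_eq[OF transformation_image_sets[OF R B] transformation_image_sets[OF T B]]
      transformation_image_measure[OF R B] transformation_image_measure[OF T B] by simp
qed

lemma block_shift:
  fixes x t q L :: nat
  assumes "t < L"
  shows "(x * L + t) mod (q * L) = (x mod q) * L + t"
  using assms mod_mult2_eq[of "x * L + t" L q] by (simp add: mult.commute)

lemma distr_fst_snd:
  assumes "prob_space M"
  shows "distr (M \<Otimes>\<^sub>M M) M fst = M" "distr (M \<Otimes>\<^sub>M M) M snd = M"
proof -
  interpret prob_space M by fact
  have "emeasure (distr (M \<Otimes>\<^sub>M M) M fst) B = emeasure M B"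
    "emeasure (distr (M \<Otimes>\<^sub>M M) M snd) B = emeasure M B" if B: "B \<in> events" for B
  proof -
    have eq: "fst -` B \<inter> space (M \<Otimes>\<^sub>M M) = B \<times> space M" "snd -` B \<inter> space (M \<Otimes>\<^sub>M M) = space M \<times> B"
      using sets.sets_into_space[OF B] by (auto simp: space_pair_measure)
    show "emeasure (distr (M \<Otimes>\<^sub>M M) M fst) B = emeasure M B"
      "emeasure (distr (M \<Otimes>\<^sub>M M) M snd) B = emeasure M B"
      using B by (simp_all add: emeasure_distr eq emeasure_pair_measure_Times emeasure_space_1)
  qed
  then show "distr (M \<Otimes>\<^sub>M M) M fst = M" "distr (M \<Otimes>\<^sub>M M) M snd = M"
    by (intro measure_eqI; simp)+
qed

text \<open>The value \<open>4 / q * (\<mu> A - (\<mu> A)\<^sup>2)\<close> is the one attained in the construction of \<open>weakly_dense_initial_step\<close>. All that matters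
later is that it is positive and the same for every \<open>i\<close>, so that the displacements cannot cancel
against the roots of unity.\<close>

definition initial_step :: "'a measure \<Rightarrow> 'a set \<Rightarrow> nat \<Rightarrow> nat \<Rightarrow> ('a \<Rightarrow> 'a) \<Rightarrow> bool" where
  "initial_step M A q l T \<longleftrightarrow> (\<exists>m. displacement M A T (q * m) 0 < (1/2)^l \<and>
     (\<forall>i\<in>{1..<q}. \<bar>displacement M A T (i * m) 0 - 4 / q * (measure M A - (measure M A)\<^sup>2)\<bar> < (1/2)^l))"

text \<open>Here \<open>T ^^ m\<close> is nearly of order \<open>q\<close> on \<open>A\<close> up to the error \<open>(1/2)^Suc l\<close>, and \<open>T ^^ m'\<close> halves the error. The implication
is written as a disjunction with a strict inequality, which makes it an open condition.\<close>

definition refinement_step :: "'a measure \<Rightarrow> 'a set \<Rightarrow> nat \<Rightarrow> nat \<Rightarrow> nat \<Rightarrow> ('a \<Rightarrow> 'a) \<Rightarrow> bool" where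
  "refinement_step M A q m l T \<longleftrightarrow> (1/2)^Suc l < displacement M A T (q * m) 0 \<or>
     (\<exists>m'. displacement M A T (q * m') 0 < (1/2)^Suc (Suc l) \<and>
       (\<forall>i\<in>{..<q}. displacement M A T (i * m') (i * m) < 2 * (1/2)^l))"

context prob_space
begin

lemma weakly_open_refinement_step:
  assumes "A \<in> events"
  shows "weakly_open M (refinement_step M A q m l)"
  unfolding refinement_step_def
  by (intro weakly_open_disj weakly_open_ex weakly_open_conj weakly_open_ball
      weakly_open_displacement_less weakly_open_displacement_greater assms finite_lessThan)

lemma weakly_open_initial_step:
  assumes "A \<in> events"
  shows "weakly_open M (initial_step M A q l)"
proof -
  have abs: "\<bar>d - c\<bar> < r \<longleftrightarrow> d < c + r \<and> c - r < d" for d c r :: real by auto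
  show ?thesis
    unfolding initial_step_def abs
    by (intro weakly_open_ex weakly_open_conj weakly_open_ball finite_atLeastLessThan
        weakly_open_displacement_less weakly_open_displacement_greater assms)
qed

context
  fixes U \<psi>
  assumes coded: "coded M U \<psi>" and atomless: "\<And>x. x \<in> space M \<Longrightarrow> prob {x} = 0"
begin

text \<open>The realization is made to respect the sets of \<open>\<F>\<close> together with their images under \<open>T\<close>, which yields closeness
to \<open>T\<close>, and the set \<open>A\<close>, which yields its correlations.\<close>

lemma block_realization:
  fixes Z :: "'b measure" and q L :: nat
  assumes Z: "prob_space Z" "coded Z V \<xi>" "\<And>z. z \<in> space Z \<Longrightarrow> measure Z {z} = 0"
    and T: "T \<in> transformations M" and F: "finite \<F>" "\<F> \<subseteq> events" and A: "A \<in> events"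
    and n: "n = q * L" "0 < q" "0 < L" and e: "2 / L < e"
    and l: "\<And>j. l j \<in> Z \<rightarrow>\<^sub>M M" "\<And>j. distr Z M (l j) = M"
    and next_l: "\<And>j z. Suc j mod L = Suc (j mod L) \<Longrightarrow> l (Suc j) z = T (l j z)"
  obtains R where "R \<in> transformations M" "near M \<F> e R T"
    "\<forall>i. prob ((R ^^ i) ` A \<inter> A) = (\<Sum>j<n. measure Z {z\<in>space Z. l j z \<in> A \<and> l ((j + i) mod n) z \<in> A}) / n"
proof -
  define \<G> where "\<G> = \<F> \<union> (\<lambda>B. T ` B) ` \<F> \<union> {A}"
  have G: "finite \<G>" "\<G> \<subseteq> events"
    using F A transformation_image_sets[OF T] by (auto simp: \<G>_def)
  have n0: "0 < n" using n by simp
  obtain R where R: "R \<in> transformations M" and corr: "\<forall>A\<in>\<G>. \<forall>B\<in>\<G>. \<forall>i. prob ((R ^^ i) ` A \<inter> B) =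
       (\<Sum>j<n. measure Z {z\<in>space Z. l j z \<in> A \<and> l ((j + i) mod n) z \<in> B}) / n"
    by (rule cyclic_realization[OF prob_space_axioms coded atomless Z n0 l G])
  have "near M \<F> e R T" unfolding near_def
  proof
    fix B assume B: "B \<in> \<F>"
    then have "prob (R ` B \<inter> T ` B) =
        (\<Sum>j<n. measure Z {z\<in>space Z. l j z \<in> B \<and> l (Suc j mod n) z \<in> T ` B}) / n"
      using corr[rule_format, of B "T ` B" 1] by (simp add: \<G>_def)
    then have "prob (sym_diff (R ` B) (T ` B)) \<le> 2 / L"
      using B F by (intro letters_near[where Z=Z and l=l, OF prob_space_axioms n(2,3,1) T R _ l next_l]) auto
    then show "prob (sym_diff (R ` B) (T ` B)) < e" using e by simp
  qed
  then show thesis using corr by (intro that[OF R]) (auto simp: \<G>_def)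
qed

text \<open>The cycle consists of \<open>q\<close> blocks of length \<open>L\<close>. Given a pair \<open>(x, y)\<close> from \<open>M \<Otimes>\<^sub>M M\<close>, the first block spells the orbit segment
of \<open>x\<close> and all others spell that of \<open>y\<close>. Advancing by \<open>L\<close> moves each block to the next one, so \<open>R ^^ L\<close>
has order \<open>q\<close>, and its powers correlate \<open>A\<close> with itself independently exactly when one of the two blocks compared is
the first one.\<close>

lemma weakly_dense_initial_step:
  assumes A: "A \<in> events" and q: "2 \<le> q"
  shows "weakly_dense M (initial_step M A q l)"
  unfolding weakly_dense_def
proof (intro ballI allI impI)
  fix T \<F> and e :: real
  assume T: "T \<in> transformations M" and F: "finite \<F>" "\<F> \<subseteq> events" and e: "0 < e"
  obtain L :: nat where L: "2 / e < L" using reals_Archimedean2 by blast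
  then have L0: "0 < L" using e by (metis divide_pos_pos of_nat_0_less_iff less_trans zero_less_numeral)
  have Le: "2 / L < e" using L L0 e by (simp add: field_simps)
  define n where "n = q * L"
  let ?Z = "M \<Otimes>\<^sub>M M"
  interpret P: pair_prob_space M M ..
  define l' where "l' j z = (T ^^ (j mod L)) (if j < L then fst z else snd z)" for j and z :: "'a \<times> 'a"
  have pow: "T ^^ k \<in> transformations M" for k using T by (rule transformation_pow)
  have powm: "T ^^ k \<in> M \<rightarrow>\<^sub>M M" "distr M M (T ^^ k) = M" for k
    using transformation_measurable[OF pow] transformation_distr[OF pow] by auto
  have l': "l' j \<in> ?Z \<rightarrow>\<^sub>M M" "distr ?Z M (l' j) = M" for j
  proof -
    define \<pi> where "\<pi> = (if j < L then fst else snd :: 'a \<times> 'a \<Rightarrow> 'a)"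
    have pi: "\<pi> \<in> ?Z \<rightarrow>\<^sub>M M" "distr ?Z M \<pi> = M"
      using distr_fst_snd[OF prob_space_axioms] by (auto simp: \<pi>_def)
    have eq: "l' j = T ^^ (j mod L) \<circ> \<pi>" by (auto simp: l'_def \<pi>_def)
    show "l' j \<in> ?Z \<rightarrow>\<^sub>M M" unfolding eq using pi(1) powm(1) by (rule measurable_comp)
    show "distr ?Z M (l' j) = M" unfolding eq using distr_distr[OF powm(1) pi(1)] pi(2) powm(2) by simp
  qed
  obtain V \<xi> where codZ: "coded ?Z V \<xi>" using coded_pair[OF coded coded] by blast
  have atomZ: "measure ?Z {z} = 0" if z: "z \<in> space ?Z" for z
  proof -
    obtain x y where xy: "z = (x, y)" "x \<in> space M" "y \<in> space M"
      using z by (auto simp: space_pair_measure)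
    have "{x} \<in> events" "{y} \<in> events" using coded_singleton[OF coded] xy by auto
    then have "measure ?Z ({x} \<times> {y}) = 0"
      using atomless[OF xy(2)] emeasure_pair_measure_Times[of "{x}" M "{y}"]
      by (simp add: measure_def enn2real_mult)
    then show ?thesis using xy by simp
  qed
  have next_l: "l' (Suc j) z = T (l' j z)" if j: "Suc j mod L = Suc (j mod L)" for j z
  proof -
    have "Suc j \<noteq> L" using j by auto
    then have "Suc j < L \<longleftrightarrow> j < L" by auto
    then show ?thesis by (simp add: l'_def j)
  qed
  have q0: "0 < q" using q by simp
  obtain R where R: "R \<in> transformations M" "near M \<F> e R T" and corr: "\<forall>i. prob ((R ^^ i) ` A \<inter> A) =
       (\<Sum>j<n. measure ?Z {z\<in>space ?Z. l' j z \<in> A \<and> l' ((j + i) mod n) z \<in> A}) / n"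
    by (rule block_realization[where l=l', OF P.prob_space_axioms codZ atomZ T F A n_def q0 L0 Le l' next_l])
  have "initial_step M A q l R"
  proof -
    define \<delta> where "\<delta> = prob A - (prob A)\<^sup>2"
    define differ where "differ i a \<longleftrightarrow> (a = 0) \<noteq> ((a + i) mod q = 0)" for i a
    define N where "N i = card {a\<in>{..<q}. differ i a}" for i
    have N: "(\<Sum>a<q. of_bool (differ i a) :: real) = N i" for i
      by (simp add: N_def sum_of_bool_eq Int_def)
    have disp: "displacement M A R (i * L) 0 = 2 / q * \<delta> * N i" for i
    proof -
      let ?g = "\<lambda>j. measure ?Z {z\<in>space ?Z. l' j z \<in> A \<and> l' ((j + i * L) mod n) z \<in> A}"
      have summand: "?g (a * L + t) = prob A - \<delta> * of_bool (differ i a)" if t: "t < L" for a t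
      proof -
        let ?b = "(a + i) mod q"
        define S where "S = (T ^^ t) -` A \<inter> space M"
        have S: "S \<in> events" "prob S = prob A"
          using powm[of t] A preserving_vimage_measure[OF powm A] by (auto simp: S_def)
        have Zt: "measure ?Z (S \<times> S) = (prob A)\<^sup>2" "measure ?Z (S \<times> space M) = prob A"
          "measure ?Z (space M \<times> S) = prob A"
          using S emeasure_pair_measure_Times[of _ M]
          by (simp_all add: measure_def enn2real_mult power2_eq_square emeasure_space_1)
        have "(a * L + t + i * L) mod n = ?b * L + t"
          using block_shift[OF t, of "a + i" q] by (simp add: n_def algebra_simps)
        moreover have "l' (c * L + t) z = (T ^^ t) (if c = 0 then fst z else snd z)" for c z
        proof -
          have "(c * L + t) mod L = t" using t by simp
          moreover have "c * L + t < L \<longleftrightarrow> c = 0" using t by (cases c) auto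
          ultimately show ?thesis by (simp add: l'_def)
        qed
        ultimately have "{z\<in>space ?Z. l' (a * L + t) z \<in> A \<and> l' ((a * L + t + i * L) mod n) z \<in> A} =
            (if a = 0 \<and> ?b = 0 then S \<times> space M else if a \<noteq> 0 \<and> ?b \<noteq> 0 then space M \<times> S else S \<times> S)"
          by (auto simp: S_def space_pair_measure)
        then show ?thesis using Zt by (simp add: of_bool_def differ_def \<delta>_def)
      qed
      have "(\<Sum>j<n. ?g j) = (\<Sum>a<q. \<Sum>t<L. ?g (a * L + t))"
        unfolding n_def by (rule sum_blocks)
      also have "\<dots> = (\<Sum>a<q. \<Sum>t<L. prob A - \<delta> * of_bool (differ i a))"
        by (intro sum.cong refl summand) simp
      also have "\<dots> = real L * (q * prob A - \<delta> * N i)"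
        by (simp add: sum_subtractf N flip: sum_distrib_left)
      finally have "prob ((R ^^ (i * L)) ` A \<inter> A) = real L * (q * prob A - \<delta> * N i) / n"
        using corr by simp
      also have "\<dots> = prob A - \<delta> * N i / q"
        using L0 q by (simp add: n_def field_simps)
      finally show ?thesis
        unfolding displacement_correlation[OF R(1) A] by (simp add: right_diff_distrib)
    qed
    have "N q = 0" by (simp add: N_def differ_def)
    then have "displacement M A R (q * L) 0 = 0" by (simp add: disp)
    moreover have "displacement M A R (i * L) 0 = 4 / q * \<delta>" if i: "i \<in> {1..<q}" for i
    proof -
      have "{a\<in>{..<q}. differ i a} = {0, q - i}"
      proof (intro set_eqI iffI)
        fix a assume a: "a \<in> {a\<in>{..<q}. differ i a}"
        show "a \<in> {0, q - i}"
        proof (cases "a + i < q")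
          case True
          then show ?thesis using a i by (auto simp: differ_def)
        next
          case False
          moreover have "a + i - q < q" using a i by auto
          ultimately have "(a + i) mod q = a + i - q" by (simp add: le_mod_geq)
          then show ?thesis using a i False by (auto simp: differ_def)
        qed
      qed (use i in \<open>auto simp: differ_def\<close>)
      then have "N i = 2" using i by (simp add: N_def card_insert_if)
      then show ?thesis by (simp add: disp)
    qed
    ultimately show ?thesis unfolding initial_step_def \<delta>_def[symmetric]
      by (intro exI[of _ L]) simp
  qed
  then show "\<exists>S\<in>transformations M. initial_step M A q l S \<and> near M \<F> e S T"
    using R by blast
qed

text \<open>Block number \<open>a\<close> now starts at the point \<open>T ^^ (a * m)\<close> of the orbit of \<open>z\<close>, so that advancing by a whole block of
length \<open>L\<close> has the same effect on letters as advancing by \<open>m\<close> steps. The only exceptions are a wrap-around from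
the last block to the first, where the letters differ by \<open>T ^^ (q * m)\<close>, which hardly moves \<open>A\<close>, and the few positions
near the start of a block. But \<open>R ^^ L\<close> is exactly of order \<open>q\<close>.\<close>

lemma weakly_dense_refinement_step:
  assumes A: "A \<in> events" and q: "2 \<le> q"
  shows "weakly_dense M (refinement_step M A q m l)"
  unfolding weakly_dense_def
proof (intro ballI allI impI)
  fix T \<F> and e :: real
  assume T: "T \<in> transformations M" and F: "finite \<F>" "\<F> \<subseteq> events" and e: "0 < e"
  show "\<exists>S\<in>transformations M. refinement_step M A q m l S \<and> near M \<F> e S T"
  proof (cases "(1/2)^Suc l < displacement M A T (q * m) 0")
    case True
    then have "refinement_step M A q m l T" by (simp add: refinement_step_def)
    moreover have "near M \<F> e T T" using e by (simp add: near_def)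
    ultimately show ?thesis using T by blast
  next
    case False
    obtain L :: nat where L: "max (2 / e) (2 * q * m * 2^l + q * m) < L" using reals_Archimedean2 by blast
    have "0 < L" "2 / L < e"
    proof -
      have "2 / e < L" using L by simp
      then show "0 < L" using e by (metis divide_pos_pos of_nat_0_less_iff less_trans zero_less_numeral)
      then show "2 / L < e" using \<open>2 / e < L\<close> e by (simp add: field_simps)
    qed
    have Lqm: "2 * real q * real m * 2^l + real q * real m < L" using L by simp
    have "real (q * m) \<le> 2 * real q * real m * 2^l + real q * real m" by simp
    then have "q * m < L" using Lqm by linarith
    have im: "i * m < L" if "i \<le> q" for i
      by (rule le_less_trans[OF mult_le_mono1[OF that] \<open>q * m < L\<close>])
    define n where "n = q * L"
    have n0: "0 < n" using q \<open>0 < L\<close> by (simp add: n_def)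
    \<comment> \<open>the time on the orbit of \<open>z\<close> that is spelled at position \<open>j\<close> of the cycle\<close>
    define x where "x j = (j div L) * m + j mod L" for j
    define l' where "l' j = T ^^ x j" for j
    have l': "l' j \<in> M \<rightarrow>\<^sub>M M" "distr M M (l' j) = M" for j
      using transformation_measurable transformation_distr transformation_pow[OF T] unfolding l'_def by blast+
    have next_l: "l' (Suc j) z = T (l' j z)" if j: "Suc j mod L = Suc (j mod L)" for j z
    proof -
      have "Suc j div L = j div L" using j by (simp add: div_Suc)
      then show ?thesis by (simp add: l'_def x_def j)
    qed
    have q0: "0 < q" using q by simp
    obtain R where R: "R \<in> transformations M" "near M \<F> e R T" and corr: "\<forall>i. prob ((R ^^ i) ` A \<inter> A) =
         (\<Sum>j<n. prob {z\<in>space M. l' j z \<in> A \<and> l' ((j + i) mod n) z \<in> A}) / n"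
      by (rule block_realization[where l=l', OF prob_space_axioms coded atomless T F A n_def q0 \<open>0 < L\<close> \<open>2 / L < e\<close> l' next_l])
    have "refinement_step M A q m l R"
    proof -
      have corrA: "prob ((R ^^ i) ` A \<inter> A) =
          (\<Sum>j<n. prob {z\<in>space M. l' j z \<in> A \<and> l' ((j + i) mod n) z \<in> A}) / n" for i
        using corr by blast
      have same: "prob {z\<in>space M. l' j z \<in> A \<and> l' j z \<in> A} = prob A" for j
        using preserving_vimage_measure[OF l'[of j] A] by (simp add: vimage_def Int_def conj_commute)
      have "(\<Sum>j<n. prob {z\<in>space M. l' j z \<in> A \<and> l' ((j + q * L) mod n) z \<in> A}) = (\<Sum>j<n. prob A)"
        by (rule sum.cong) (use same in \<open>simp_all add: n_def\<close>)
      then have "displacement M A R (q * L) 0 = 0"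
        using displacement_correlation[OF R(1) A, of "q * L"] corrA[of "q * L"] n0 by simp
      moreover have "displacement M A R (i * L) (i * m) < 2 * (1/2)^l" if i: "i < q" for i
      proof -
        \<comment> \<open>By shift invariance it suffices to compare \<open>A\<close> with its image under \<open>R ^^ k\<close>.\<close>
        define k where "k = i * L - i * m"
        have mL: "m \<le> L" using \<open>q * m < L\<close> q by (metis le_trans less_imp_le mult_le_mono1 nat_mult_1 one_le_numeral)
        have k: "i * L = k + i * m" using mL by (simp add: k_def)
        let ?g = "\<lambda>j. prob {z\<in>space M. l' j z \<in> A \<and> l' ((j + k) mod n) z \<in> A}"
        have lower: "prob A - (1/2)^Suc (Suc l) - of_bool (j mod L < i * m) \<le> ?g j" if j: "j < n" for j
        proof (cases "j mod L < i * m")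
          case True
          have "prob A - (1/2)^Suc (Suc l) - 1 \<le> 0"
            using prob_le_1[of A] zero_le_power[of "1/2::real" "Suc (Suc l)"] by linarith
          then show ?thesis using True by (simp add: order_trans[OF _ measure_nonneg])
        next
          case False
          note nj = False
          define a t where "a = j div L" and "t = j mod L - i * m"
          have t: "j = a * L + (t + i * m)" "t < L" "t + i * m < L"
            using False \<open>0 < L\<close> by (auto simp: a_def t_def less_imp_diff_less)
          have a: "a < q" using j \<open>0 < L\<close> by (simp add: a_def n_def less_mult_imp_div_less)
          have xj: "x j = a * m + (t + i * m)" using t False by (simp add: x_def a_def t_def)
          have jk: "(j + k) mod n = ((a + i) mod q) * L + t"
          proof -
            have "j + k = (a + i) * L + t" using t(1) k by (simp add: algebra_simps)
            then show ?thesis using block_shift[OF t(2), of "a + i" q] by (simp add: n_def)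
          qed
          have xjk: "x ((j + k) mod n) = ((a + i) mod q) * m + t"
            using t(2) \<open>0 < L\<close> by (simp add: jk x_def)
          show ?thesis
          proof (cases "a + i < q")
            case True
            then have "x ((j + k) mod n) = x j" using xj xjk by (simp add: algebra_simps)
            then have "l' ((j + k) mod n) = l' j" by (simp add: l'_def)
            moreover have "0 \<le> (1/2::real)^Suc (Suc l)" by simp
            ultimately show ?thesis using same[of j] nj by (simp del: power_Suc)
          next
            case False
            moreover have "a + i - q < q" using a i by auto
            \<comment> \<open>the wrap-around, which costs one application of \<open>T ^^ (q * m)\<close>\<close>
            ultimately have "a + i = (a + i) mod q + q" by (simp add: le_mod_geq)
            then have "x j = q * m + x ((j + k) mod n)" using xj xjk by (metis add.assoc add.commute add_mult_distrib)
            then have "l' j z = (T ^^ (q * m)) (l' ((j + k) mod n) z)" for z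
              by (simp add: l'_def funpow_add)
            then have "{z\<in>space M. l' j z \<in> A \<and> l' ((j + k) mod n) z \<in> A}
                = l' ((j + k) mod n) -` {y\<in>space M. y \<in> A \<and> (T ^^ (q * m)) y \<in> A} \<inter> space M"
              using measurable_space[OF l'(1)] by auto
            also have "prob \<dots> = prob {y\<in>space M. y \<in> A \<and> (T ^^ (q * m)) y \<in> A}"
            proof (rule preserving_vimage_measure[OF l'])
              have [measurable]: "T ^^ (q * m) \<in> M \<rightarrow>\<^sub>M M" "A \<in> events"
                using transformation_measurable[OF transformation_pow[OF T]] A by auto
              show "{y\<in>space M. y \<in> A \<and> (T ^^ (q * m)) y \<in> A} \<in> events" by measurable
            qed
            also have "\<dots> = prob ((T ^^ (q * m)) ` A \<inter> A)"
              by (rule transformation_pow_correlation[OF T A A, symmetric])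
            also have "\<dots> \<ge> prob A - (1/2)^Suc (Suc l)"
              using displacement_correlation[OF T A, of "q * m"] \<open>\<not> (1/2)^Suc l < displacement M A T (q * m) 0\<close> by simp
            finally show ?thesis by simp
          qed
        qed
        have "(\<Sum>j<n. prob A - (1/2)^Suc (Suc l) - of_bool (j mod L < i * m)) \<le> (\<Sum>j<n. ?g j)"
          by (rule sum_mono) (use lower in simp)
        also have "(\<Sum>j<n. prob A - (1/2)^Suc (Suc l) - of_bool (j mod L < i * m))
            = real n * (prob A - (1/2)^Suc (Suc l)) - real q * real (i * m)"
          unfolding n_def sum_subtractf sum_initial_residues[OF less_imp_le[OF im[OF less_imp_le[OF i]]]]
          by (simp add: algebra_simps)
        finally have "(real n * (prob A - (1/2)^Suc (Suc l)) - real q * real (i * m)) / n \<le> prob ((R ^^ k) ` A \<inter> A)"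
          unfolding corrA by (rule divide_right_mono) simp
        moreover have "(real n * (prob A - (1/2)^Suc (Suc l)) - real q * real (i * m)) / n
            = prob A - (1/2)^Suc (Suc l) - real (i * m) / L"
          using n0 by (simp add: n_def field_simps)
        ultimately have low: "prob A - (1/2)^Suc (Suc l) - real (i * m) / L \<le> prob ((R ^^ k) ` A \<inter> A)"
          by (simp only:)
        have "2 * (real (i * m) / L) < (1/2)^l"
        proof -
          have "2 * real (i * m) * 2^l \<le> 2 * real q * real m * 2^l"
            using i by (simp add: mult_right_mono)
          also have "\<dots> < L" using Lqm by (smt (verit) mult_nonneg_nonneg of_nat_0_le_iff)
          finally show ?thesis using \<open>0 < L\<close> by (simp add: field_simps power_divide)
        qed
        moreover have "(1/2::real)^Suc (Suc l) = (1/2)^l / 4" "0 < (1/2::real)^l" by simp_all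
        ultimately have "displacement M A R k 0 < 2 * (1/2)^l"
          using displacement_correlation[OF R(1) A, of k] low by linarith
        then show ?thesis
          using displacement_shift[OF R(1) A, of k "i * m" 0] by (simp add: k)
      qed
      ultimately show ?thesis unfolding refinement_step_def
        by (intro disjI2 exI[of _ L]) simp
    qed
    then show ?thesis using R by blast
  qed
qed

end

end

section \<open>Lebesgue functions from rigid eigenfunctions\<close>

lemma (in prob_space) set_limit:
  assumes B: "\<And>j. B j \<in> events" and geo: "\<And>j. prob (sym_diff (B j) (B (Suc j))) \<le> K * (1/2)^j"
  obtains B' where "B' \<in> events" "\<forall>j. prob (sym_diff (B j) B') \<le> 2 * K * (1/2)^j"
proof
  note [measurable] = B
  let ?B = "{x\<in>space M. \<exists>N. \<forall>j\<ge>N. x \<in> B j}"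
  show B' [measurable]: "?B \<in> events" by measurable
  have "summable (\<lambda>j. prob (sym_diff (B j) (B (Suc j))))"
    by (rule summable_comparison_test'[of "\<lambda>j. K * (1/2)^j" 0]) (use geo in auto)
  then have "AE x in M. \<forall>\<^sub>F j in sequentially. x \<in> space M - sym_diff (B j) (B (Suc j))"
    by (intro borel_cantelli_AE1) (auto simp: emeasure_eq_measure)
  then have "AE x in M. \<forall>\<^sub>F j in sequentially. x \<in> B j \<longleftrightarrow> x \<in> ?B"
    using AE_space
  proof eventually_elim
    case (elim x)
    have "\<forall>\<^sub>F j in sequentially. x \<in> B j \<longleftrightarrow> x \<in> B (Suc j)"
      using elim(1) by eventually_elim auto
    from eventually_constant[OF this] show ?case using elim(2) by simp
  qed
  then have lim: "(\<lambda>l. prob (sym_diff (B l) ?B)) \<longlonglongrightarrow> 0"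
    by (intro sym_diff_tendsto_0) measurable
  show "\<forall>j. prob (sym_diff (B j) ?B) \<le> 2 * K * (1/2)^j"
  proof
    fix j
    have tele: "prob (sym_diff (B j) (B l)) \<le> 2 * K * (1/2)^j - 2 * K * (1/2)^l" if "j \<le> l" for l
      using that
    proof (induction l rule: dec_induct)
      case (step l)
      have "prob (sym_diff (B j) (B (Suc l))) \<le> prob (sym_diff (B j) (B l)) + prob (sym_diff (B l) (B (Suc l)))"
        by (rule measure_sym_diff_triangle[OF B B B])
      then show ?case using step.IH geo[of l] by simp
    qed simp
    have K: "0 \<le> K" using order_trans[OF measure_nonneg geo[of 0]] by simp
    have "prob (sym_diff (B j) ?B) \<le> 2 * K * (1/2)^j + prob (sym_diff (B l) ?B)" if "j \<le> l" for l
    proof -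
      have "prob (sym_diff (B j) ?B) \<le> prob (sym_diff (B j) (B l)) + prob (sym_diff (B l) ?B)"
        by (rule measure_sym_diff_triangle[OF B B B'])
      moreover have "0 \<le> 2 * K * (1/2)^l" using K by simp
      ultimately show ?thesis using tele[OF that] by linarith
    qed
    moreover have "(\<lambda>l. 2 * K * (1/2)^j + prob (sym_diff (B l) ?B)) \<longlonglongrightarrow> 2 * K * (1/2)^j + 0"
      by (intro tendsto_add tendsto_const lim)
    ultimately show "prob (sym_diff (B j) ?B) \<le> 2 * K * (1/2)^j"
      by (intro LIMSEQ_le_const[of _ "2 * K * (1/2)^j"]) auto
  qed
qed

text \<open>The refinement steps are iterated, starting from the initial one and halving the error each time, so the successive powers
move \<open>A\<close> by summable amounts.\<close>

lemma (in prob_space) root_sequence: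
  assumes init: "\<And>l. initial_step M A q l T" and ref: "\<And>m l. refinement_step M A q m l T"
  obtains m :: "nat \<Rightarrow> nat" where
    "\<forall>i\<in>{1..<q}. \<bar>displacement M A T (i * m 0) 0 - 4 / q * (prob A - (prob A)\<^sup>2)\<bar> < (1/2)^l"
    "\<forall>j. displacement M A T (q * m j) 0 < (1/2)^(l + j)"
    "\<forall>j. \<forall>i<q. displacement M A T (i * m (Suc j)) (i * m j) < 2 * (1/2)^(l + j)"
proof -
  let ?near = "\<lambda>m r. \<forall>i\<in>{1..<q}. \<bar>displacement M A T (i * m) 0 - 4 / q * (prob A - (prob A)\<^sup>2)\<bar> < r"
  have "\<exists>m. \<forall>j. (displacement M A T (q * m j) 0 < (1/2)^Suc (l + j) \<and> (j = 0 \<longrightarrow> ?near (m j) ((1/2)^Suc l))) \<and>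
      (\<forall>i<q. displacement M A T (i * m (Suc j)) (i * m j) < 2 * (1/2)^(l + j))"
  proof (rule dependent_nat_choice)
    show "\<exists>m. displacement M A T (q * m) 0 < (1/2)^Suc (l + 0) \<and> ((0::nat) = 0 \<longrightarrow> ?near m ((1/2)^Suc l))"
      using init[of "Suc l"] unfolding initial_step_def by simp
    fix m j assume "displacement M A T (q * m) 0 < (1/2)^Suc (l + j) \<and> (j = 0 \<longrightarrow> ?near m ((1/2)^Suc l))"
    then obtain m' where "displacement M A T (q * m') 0 < (1/2)^Suc (Suc (l + j))"
      "\<forall>i\<in>{..<q}. displacement M A T (i * m') (i * m) < 2 * (1/2)^(l + j)"
      using ref[of m "l + j"] unfolding refinement_step_def by (meson less_asym)
    then show "\<exists>m'. (displacement M A T (q * m') 0 < (1/2)^Suc (l + Suc j) \<and> (Suc j = 0 \<longrightarrow> ?near m' ((1/2)^Suc l))) \<and>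
        (\<forall>i<q. displacement M A T (i * m') (i * m) < 2 * (1/2)^(l + j))"
      by (intro exI[of _ m']) simp
  qed
  then obtain m where m: "\<And>j. displacement M A T (q * m j) 0 < (1/2)^Suc (l + j)" "?near (m 0) ((1/2)^Suc l)"
    "\<And>j. \<forall>i<q. displacement M A T (i * m (Suc j)) (i * m j) < 2 * (1/2)^(l + j)"
    by blast
  have half: "(1/2::real)^Suc k \<le> (1/2)^k" for k by simp
  show thesis
  proof (rule that)
    show "?near (m 0) ((1/2)^l)"
      using m(2) half[of l] by (meson less_le_trans)
    show "\<forall>j. displacement M A T (q * m j) 0 < (1/2)^(l + j)"
      using m(1) half by (meson less_le_trans)
    show "\<forall>j. \<forall>i<q. displacement M A T (i * m (Suc j)) (i * m j) < 2 * (1/2)^(l + j)"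
      using m(3) by blast
  qed
qed

lemma sum_roots_zero:
  fixes v :: complex
  assumes "v ^ q = 1" "v \<noteq> 1"
  shows "(\<Sum>i<q. v ^ i) = 0"
  using assms by (simp add: geometric_sum)

text \<open>The integral over \<open>A\<close> of the combination is, up to the factor \<open>- 1 / 2\<close>, the combination of the measures of the
symmetric differences of \<open>B i\<close> and \<open>A\<close>. If those for \<open>i \<noteq> 0\<close> were all equal to \<open>C\<close>, it would be \<open>- C\<close>, because the roots of unity sum to \<open>0\<close>; so it
cannot vanish when they are close to \<open>C\<close>.\<close>

lemma (in prob_space) root_combination_nonzero:
  fixes v :: complex
  assumes q: "2 \<le> q" and v: "v ^ q = 1" "v \<noteq> 1" "norm v = 1"
    and A: "A \<in> events" and B: "\<And>i. i < q \<Longrightarrow> B i \<in> events" "\<And>i. i < q \<Longrightarrow> prob (B i) = prob A"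
    and B0: "prob (sym_diff (B 0) A) = 0"
    and C: "\<And>i. i \<in> {1..<q} \<Longrightarrow> real q * \<bar>prob (sym_diff (B i) A) - C\<bar> < C"
  shows "\<not> (AE x in M. (\<Sum>i<q. v ^ i * indicator (B i) x) = 0)"
proof
  assume zero: "AE x in M. (\<Sum>i<q. v ^ i * indicator (B i) x) = 0"
  define d where "d i = prob (sym_diff (B i) A)" for i
  have corr: "prob (B i \<inter> A) = prob A - d i / 2" if "i < q" for i
    using measure_sym_diff_eq[OF B(1)[OF that] A] B(2)[OF that]
    unfolding d_def by linarith
  have "AE x in M. (\<Sum>i<q. indicator (B i \<inter> A) x *\<^sub>R v ^ i) = 0"
    using zero
  proof eventually_elim
    case (elim x)
    have "indicator (B i \<inter> A) x *\<^sub>R v ^ i = (if x \<in> A then v ^ i * indicator (B i) x else 0)" for i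
      by (auto simp: indicator_def)
    then show ?case using elim by (cases "x \<in> A") simp_all
  qed
  then have "(\<integral>x. (\<Sum>i<q. indicator (B i \<inter> A) x *\<^sub>R v ^ i) \<partial>M) = 0"
    by (rule integral_eq_zero_AE)
  moreover have "has_bochner_integral M (\<lambda>x. \<Sum>i<q. indicator (B i \<inter> A) x *\<^sub>R v ^ i)
      (\<Sum>i<q. prob (B i \<inter> A) *\<^sub>R v ^ i)"
    using A B(1) by (intro has_bochner_integral_sum has_bochner_integral_indicator) (auto simp: emeasure_eq_measure)
  then have "(\<integral>x. (\<Sum>i<q. indicator (B i \<inter> A) x *\<^sub>R v ^ i) \<partial>M) = (\<Sum>i<q. prob (B i \<inter> A) *\<^sub>R v ^ i)"
    by (rule has_bochner_integral_integral_eq)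
  ultimately have "(\<Sum>i<q. prob (B i \<inter> A) *\<^sub>R v ^ i) = 0"
    by (simp only:)
  then have "(\<Sum>i<q. v ^ i * complex_of_real (prob (B i \<inter> A))) = 0"
    by (simp add: scaleR_conv_of_real mult.commute)
  then have "(\<Sum>i<q. v ^ i * complex_of_real (prob A - d i / 2)) = 0" by (simp add: corr)
  then have "prob A * (\<Sum>i<q. v ^ i) - (\<Sum>i<q. v ^ i * complex_of_real (d i)) / 2 = 0"
    by (simp add: algebra_simps sum_subtractf sum_distrib_left sum_divide_distrib)
  then have "(\<Sum>i<q. v ^ i * complex_of_real (d i)) = 0"
    using sum_roots_zero[OF v(1,2)] by simp
  moreover have split: "(\<Sum>i<q. g i) = g 0 + (\<Sum>i\<in>{1..<q}. g i)" for g :: "nat \<Rightarrow> complex"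
  proof -
    have "{..<q} = insert 0 {1..<q}" using q by auto
    then show ?thesis by simp
  qed
  moreover have "d 0 = 0" using B0 by (simp add: d_def)
  ultimately have d0: "(\<Sum>i\<in>{1..<q}. v ^ i * complex_of_real (d i)) = 0" by simp
  have "(\<Sum>i\<in>{1..<q}. v ^ i) = -1"
    using sum_roots_zero[OF v(1,2)] split[of "\<lambda>i. v ^ i"] by (simp add: add_eq_0_iff)
  moreover have "(\<Sum>i\<in>{1..<q}. v ^ i * complex_of_real (d i - C)) = - C * (\<Sum>i\<in>{1..<q}. v ^ i)"
    using d0 by (simp add: algebra_simps sum_subtractf sum_distrib_left sum_negf)
  ultimately have "complex_of_real C = (\<Sum>i\<in>{1..<q}. v ^ i * complex_of_real (d i - C))" by simp
  then have "\<bar>C\<bar> = norm (\<Sum>i\<in>{1..<q}. v ^ i * complex_of_real (d i - C))" by (metis norm_of_real)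
  also have "\<dots> \<le> (\<Sum>i\<in>{1..<q}. \<bar>d i - C\<bar>)"
    by (rule order_trans[OF norm_sum]) (simp add: norm_mult norm_power v(3) flip: of_real_diff)
  also have "\<dots> < (\<Sum>i\<in>{1..<q}. C / q)"
    using C q by (intro sum_strict_mono) (auto simp: d_def field_simps)
  also have "\<dots> \<le> C"
  proof -
    have "0 < C" using C[of 1] q by (auto intro: le_less_trans[rotated])
    then show ?thesis using q by (simp add: field_simps of_nat_diff)
  qed
  finally show False by simp
qed

definition int_power :: "'a measure \<Rightarrow> ('a \<Rightarrow> 'a) \<Rightarrow> int \<Rightarrow> 'a \<Rightarrow> 'a" where
  "int_power M T n = (if 0 \<le> n then T ^^ nat n else inv_into (space M) T ^^ nat (- n))"

lemma koopman_funpow: "(koopman T ^^ n) f x = f ((T ^^ n) x)"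
proof (induction n arbitrary: x)
  case (Suc n)
  have "(koopman T ^^ Suc n) f x = (koopman T ^^ n) f (T x)" by (simp add: koopman_def)
  also have "\<dots> = f ((T ^^ n) (T x))" by (rule Suc)
  finally show ?case by (simp add: funpow_swap1)
qed simp

lemma koopman_power_eq: "koopman_power M T n f x = f (int_power M T n x)"
  by (simp add: koopman_power_def int_power_def koopman_funpow)

lemma transformation_int_power: "T \<in> transformations M \<Longrightarrow> int_power M T n \<in> transformations M"
  by (simp add: int_power_def transformation_pow transformation_inv)

lemma funpow_commute_on:
  assumes "\<And>x. x \<in> X \<Longrightarrow> g x \<in> X" and "\<And>x. x \<in> X \<Longrightarrow> f (g x) = g (f x)" "x \<in> X"
  shows "f ((g ^^ n) x) = (g ^^ n) (f x)"
proof -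
  have "(g ^^ n) x \<in> X \<and> f ((g ^^ n) x) = (g ^^ n) (f x)"
    by (induction n) (use assms in auto)
  then show ?thesis by simp
qed

lemma int_power_commute:
  assumes T: "T \<in> transformations M" and x: "x \<in> space M"
  shows "int_power M T n ((T ^^ m) x) = (T ^^ m) (int_power M T n x)"
proof (rule funpow_commute_on[OF transformation_space[OF T] _ x])
  fix x assume x: "x \<in> space M"
  let ?I = "inv_into (space M) T"
  have "T ((?I ^^ k) x) = (?I ^^ k) (T x)" for k
  proof (rule funpow_commute_on[OF transformation_space[OF transformation_inv[OF T]] _ x])
    fix y assume "y \<in> space M"
    then show "T (?I y) = ?I (T y)"
      using transformation_inv_left[OF T] transformation_inv_right[OF T] by metis
  qed
  then show "int_power M T n (T x) = T (int_power M T n x)"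
    by (simp add: int_power_def funpow_swap1)
qed

lemma (in prob_space) bounded_in_L2:
  assumes "g \<in> borel_measurable M" "\<And>x. x \<in> space M \<Longrightarrow> norm (g x) \<le> K"
  shows "g \<in> L2 M"
proof -
  have "integrable M (\<lambda>x. (norm (g x))\<^sup>2)"
  proof (rule integrable_const_bound[of _ "K\<^sup>2"])
    show "AE x in M. norm ((norm (g x))\<^sup>2) \<le> K\<^sup>2"
      by (rule AE_I2) (use assms(2) in \<open>simp add: power_mono\<close>)
  qed (use assms(1) in measurable)
  then show ?thesis using assms(1) by (simp add: L2_def)
qed

text \<open>The integrand \<open>P\<close> satisfies \<open>P \<circ> T ^^ m j = v ^ (k - 1) * cnj v * P\<close> off the exceptional set and its preimages
under the powers of \<open>T\<close> involved, which together have small measure. As \<open>P\<close> and \<open>P \<circ> T ^^ m j\<close> have the same integral,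
this integral is \<open>0\<close>.\<close>

lemma (in prob_space) rigid_eigenfunction_lebesgue:
  fixes v :: complex and m :: "nat \<Rightarrow> nat"
  assumes T: "T \<in> transformations M" and f [measurable]: "f \<in> borel_measurable M"
    and fin: "finite (f ` space M)" and nz: "\<not> (AE x in M. f x = 0)"
    and rigid: "(\<lambda>j. prob {x\<in>space M. f ((T ^^ m j) x) \<noteq> v * f x}) \<longlonglongrightarrow> 0"
    and k: "2 \<le> k" and v: "v ^ (k - 1) * cnj v \<noteq> 1"
  shows "k_fold_lebesgue M T k f"
proof -
  obtain K where K: "\<And>x. x \<in> space M \<Longrightarrow> norm (f x) \<le> K"
    using finite_imp_bounded[OF fin] by (auto simp: bounded_iff)
  have K0: "0 \<le> K"
    using not_empty K norm_ge_zero order_trans by (metis ex_in_conv)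
  have "(\<forall>r\<in>{1..k}. (\<lambda>x. \<Prod>i=1..r-1. koopman_power M T (n i) f x) \<in> L2 M) \<and>
      (LINT x|M. (\<Prod>i=1..k-1. koopman_power M T (n i) f x) * cnj (f x)) = 0" for n :: "nat \<Rightarrow> int"
  proof -
    define g where "g i = int_power M T (n i)" for i
    have g: "g i \<in> transformations M" for i
      unfolding g_def using T by (rule transformation_int_power)
    have gm [measurable]: "g i \<in> M \<rightarrow>\<^sub>M M" and gd: "distr M M (g i) = M" for i
      using transformation_measurable[OF g] transformation_distr[OF g] by auto
    have gsp: "g i x \<in> space M" if "x \<in> space M" for i x using transformation_space[OF g that] .
    have kp: "koopman_power M T (n i) f x = f (g i x)" for i x
      by (simp add: koopman_power_eq g_def)
    have bnd: "norm (\<Prod>i\<in>I. f (g i x)) \<le> K ^ card I" if "x \<in> space M" for I :: "nat set" and x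
    proof -
      have "(\<Prod>i\<in>I. norm (f (g i x))) \<le> (\<Prod>i\<in>I. K)"
        by (rule prod_mono) (simp add: K[OF gsp[OF that]])
      then show ?thesis by (simp add: prod_norm)
    qed
    have L2: "(\<lambda>x. \<Prod>i=1..r-1. f (g i x)) \<in> L2 M" for r
      by (rule bounded_in_L2[where K="K ^ card {1..r-1}"]) (measurable, rule bnd)
    have [measurable]: "cnj \<in> borel_measurable borel"
      by (rule borel_measurable_continuous_onI[OF continuous_on_cnj[OF continuous_on_id]])
    define P where "P x = (\<Prod>i=1..k-1. f (g i x)) * cnj (f x)" for x
    have P [measurable]: "P \<in> borel_measurable M" unfolding P_def by measurable
    define c where "c = v ^ (k - 1) * cnj v"
    have Pb: "norm (P x) \<le> K ^ (k - 1) * K" if "x \<in> space M" for x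
      using bnd[OF that, of "{1..k-1}"] K[OF that] K0 by (simp add: P_def norm_mult mult_mono)
    have Pint: "integrable M P"
      by (rule integrable_const_bound[of _ "K ^ (k - 1) * K"]) (use Pb in \<open>auto intro!: AE_I2\<close>)
    define D where "D = (1 + norm c) * (K ^ (k - 1) * K)"
    have D0: "0 \<le> D" using K0 by (simp add: D_def)
    let ?I = "\<integral>x. P x \<partial>M" and ?E = "\<lambda>j. {x\<in>space M. f ((T ^^ m j) x) \<noteq> v * f x}"
    have est: "norm (?I - c * ?I) \<le>
        D * (real k * prob (?E j))" for j
    proof -
      let ?S = "T ^^ m j"
      have S: "?S \<in> transformations M" using T by (rule transformation_pow)
      have Sm [measurable]: "?S \<in> M \<rightarrow>\<^sub>M M" using S by (rule transformation_measurable)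
      define E where "E = {x\<in>space M. f (?S x) \<noteq> v * f x}"
      have E [measurable]: "E \<in> events" unfolding E_def by measurable
      define W where "W = E \<union> (\<Union>i\<in>{1..k-1}. g i -` E \<inter> space M)"
      have W [measurable]: "W \<in> events" unfolding W_def by measurable
      have "prob W \<le> prob E + prob (\<Union>i\<in>{1..k-1}. g i -` E \<inter> space M)"
        unfolding W_def by (rule measure_Un_le) measurable
      also have "prob (\<Union>i\<in>{1..k-1}. g i -` E \<inter> space M) \<le> (\<Sum>i\<in>{1..k-1}. prob (g i -` E \<inter> space M))"
        by (rule measure_UNION_le) measurable
      also have "\<dots> = real (k - 1) * prob E"
        using preserving_vimage_measure[OF gm gd E] by simp
      also have "prob E + real (k - 1) * prob E = real k * prob E"
        using k by (simp add: of_nat_diff algebra_simps)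
      finally have Wb: "prob W \<le> real k * prob E" by simp
      have PS: "P (?S x) = c * P x" if x: "x \<in> space M" "x \<notin> W" for x
      proof -
        have "f (g i (?S x)) = v * f (g i x)" if "i \<in> {1..k-1}" for i
        proof -
          have "g i x \<notin> E" using x that by (auto simp: W_def)
          then have "f (?S (g i x)) = v * f (g i x)" using gsp[OF x(1)] by (auto simp: E_def)
          then show ?thesis using int_power_commute[OF T x(1)] by (simp add: g_def)
        qed
        then have "(\<Prod>i=1..k-1. f (g i (?S x))) = (\<Prod>i=1..k-1. v * f (g i x))" by simp
        also have "\<dots> = v ^ (k - 1) * (\<Prod>i=1..k-1. f (g i x))" by (simp add: prod.distrib)
        finally show ?thesis using x by (auto simp: P_def W_def E_def c_def)
      qed
      have "?I = (\<integral>x. P (?S x) \<partial>M)"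
        using integral_distr[OF Sm P] transformation_distr[OF S] by simp
      moreover have PSint: "integrable M (\<lambda>x. P (?S x))"
        by (rule integrable_const_bound[of _ "K ^ (k - 1) * K"])
           (use Pb transformation_space[OF S] in \<open>auto intro!: AE_I2\<close>)
      ultimately have "?I - c * ?I = (\<integral>x. P (?S x) - c * P x \<partial>M)"
        using Pint by simp
      also have "norm \<dots> \<le> (\<integral>x. norm (P (?S x) - c * P x) \<partial>M)"
        by (rule integral_norm_bound)
      also have "\<dots> \<le> (\<integral>x. D * indicator W x \<partial>M)"
      proof (rule integral_mono)
        show "integrable M (\<lambda>x. norm (P (?S x) - c * P x))" using Pint PSint by simp
        show "integrable M (\<lambda>x. D * indicator W x)" by (simp add: emeasure_eq_measure)
        fix x assume x: "x \<in> space M"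
        show "norm (P (?S x) - c * P x) \<le> D * indicator W x"
        proof (cases "x \<in> W")
          case True
          have "norm (P (?S x) - c * P x) \<le> norm (P (?S x)) + norm c * norm (P x)"
            using norm_triangle_ineq4[of "P (?S x)" "c * P x"] by (simp add: norm_mult)
          also have "\<dots> \<le> K ^ (k - 1) * K + norm c * (K ^ (k - 1) * K)"
            using Pb[OF x] Pb[OF transformation_space[OF S x]] by (intro add_mono mult_left_mono) auto
          finally show ?thesis using True by (simp add: D_def algebra_simps)
        qed (use PS x in simp)
      qed
      also have "\<dots> = D * prob W" by simp
      also have "\<dots> \<le> D * (real k * prob E)" using Wb D0 by (rule mult_left_mono)
      finally show ?thesis by (simp add: E_def)
    qed
    have "(\<lambda>j. D * (real k * prob (?E j))) \<longlonglongrightarrow> D * (real k * 0)"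
      by (intro tendsto_mult tendsto_const rigid)
    then have "norm (?I - c * ?I) \<le> 0"
      by (intro LIMSEQ_le_const[of _ 0]) (use est in auto)
    then have "(1 - c) * ?I = 0" by (simp add: algebra_simps)
    then have "?I = 0" using v by (simp add: c_def)
    then show ?thesis using L2 by (simp add: kp P_def)
  qed
  moreover have "f \<in> L2 M" by (rule bounded_in_L2[OF f K])
  ultimately show ?thesis using k nz by (simp add: k_fold_lebesgue_def)
qed

text \<open>Let \<open>B i\<close> be the limit of the sets \<open>T ^^ (i * m j) ` A\<close>. Then \<open>T ^^ m j\<close> takes \<open>B i\<close> nearly to
\<open>B (Suc i mod q)\<close>, and the combination of the indicator functions with the powers of a primitive root of
unity is a rigid eigenfunction.\<close>

lemma (in prob_space) lebesgue_function_exists: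
  assumes T: "T \<in> transformations M" and A: "A \<in> events" "0 < prob A" "prob A < 1" and q: "2 \<le> q"
    and init: "\<And>l. initial_step M A q l T" and ref: "\<And>m l. refinement_step M A q m l T"
  shows "\<exists>f. k_fold_lebesgue M T (q + 1) f \<and> finite (f ` space M)"
proof -
  define C where "C = 4 / q * (prob A - (prob A)\<^sup>2)"
  have "(prob A)\<^sup>2 < prob A" using A(2,3) by (simp add: power2_eq_square)
  then have "0 < C / (real q * 5)" using q by (simp add: C_def)
  \<comment> \<open>The factor \<open>5\<close> is \<open>1\<close> for the initial step plus \<open>4\<close> for the distance of \<open>T ^^ (i * m 0) ` A\<close> to its limit.\<close>
  then obtain l where l: "(1/2)^l < C / (real q * 5)"
    using real_arch_pow_inv[of "C / (real q * 5)" "1/2"] by auto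
  obtain m :: "nat \<Rightarrow> nat" where m0: "\<forall>i\<in>{1..<q}. \<bar>displacement M A T (i * m 0) 0 - C\<bar> < (1/2)^l"
    and mq: "\<forall>j. displacement M A T (q * m j) 0 < (1/2)^(l + j)"
    and mi: "\<forall>j. \<forall>i<q. displacement M A T (i * m (Suc j)) (i * m j) < 2 * (1/2)^(l + j)"
    unfolding C_def by (rule root_sequence[OF init ref])
  have pow: "T ^^ k \<in> transformations M" for k using T by (rule transformation_pow)
  have img: "(T ^^ k) ` B \<in> events" if "B \<in> events" for k B
    using transformation_image_sets[OF pow that] .
  have "\<exists>B. B \<in> events \<and> (\<forall>j. prob (sym_diff ((T ^^ (i * m j)) ` A) B) \<le> 4 * (1/2)^(l + j))" if "i < q" for i
  proof -
    have "prob (sym_diff ((T ^^ (i * m j)) ` A) ((T ^^ (i * m (Suc j))) ` A)) \<le> 2 * (1/2)^l * (1/2)^j" for j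
    proof -
      have "displacement M A T (i * m (Suc j)) (i * m j) < 2 * (1/2)^(l + j)" using mi that by blast
      then show ?thesis by (simp add: displacement_def Un_commute power_add)
    qed
    from set_limit[OF img[OF A(1)] this]
    obtain B where "B \<in> events" "\<forall>j. prob (sym_diff ((T ^^ (i * m j)) ` A) B) \<le> 2 * (2 * (1/2)^l) * (1/2)^j" by blast
    then show ?thesis by (intro exI[of _ B]) (simp add: power_add mult.assoc)
  qed
  then obtain B where B: "\<And>i. i < q \<Longrightarrow> B i \<in> events"
    "\<And>i j. i < q \<Longrightarrow> prob (sym_diff ((T ^^ (i * m j)) ` A) (B i)) \<le> 4 * (1/2)^(l + j)" by metis
  have geo: "(\<lambda>j. c * (1/2)^(l + j)) \<longlonglongrightarrow> 0" for c :: real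
  proof -
    have "(\<lambda>j. c * (1/2)^l * (1/2::real)^j) \<longlonglongrightarrow> c * (1/2)^l * 0"
      by (intro tendsto_mult tendsto_const LIMSEQ_realpow_zero) auto
    then show ?thesis by (simp add: power_add mult.assoc)
  qed
  have lim: "(\<lambda>j. prob (sym_diff ((T ^^ (i * m j)) ` A) (B i))) \<longlonglongrightarrow> 0" if "i < q" for i
    by (rule tendsto_sandwich[OF _ _ tendsto_const geo[of 4]]) (use B(2)[OF that] in auto)
  have probB: "prob (B i) = prob A" if "i < q" for i
  proof -
    have "(\<lambda>j. prob ((T ^^ (i * m j)) ` A)) \<longlonglongrightarrow> prob (B i)"
      by (rule measure_tendsto_of_sym_diff[OF img[OF A(1)] B(1)[OF that] lim[OF that]])
    then show ?thesis
      using transformation_image_measure[OF pow A(1)] by (simp add: LIMSEQ_const_iff)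
  qed
  let ?d = "\<lambda>i j. prob (sym_diff ((T ^^ m j) ` B i) (B (Suc i mod q)))"
  have cyc: "(\<lambda>j. ?d i j) \<longlonglongrightarrow> 0" if i: "i < q" for i
  proof (rule tendsto_sandwich[OF _ _ tendsto_const geo[of 9]])
    have "?d i j \<le> 9 * (1/2)^(l + j)" for j
    proof -
      let ?S = "T ^^ m j" and ?A = "\<lambda>i. (T ^^ (i * m j)) ` A"
      have S: "?S ` ?A i = ?A (Suc i)" by (simp add: image_comp funpow_add)
      have "prob (sym_diff (?S ` B i) (?A (Suc i))) = prob (?S ` sym_diff (B i) (?A i))"
        using transformation_image_sym_diff[OF pow, of "B i" "?A i" "m j"] B(1)[OF i] img[OF A(1)]
          sets.sets_into_space S by metis
      also have "\<dots> = prob (sym_diff (B i) (?A i))"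
        by (rule transformation_image_measure[OF pow]) (use B(1)[OF i] img[OF A(1)] in auto)
      also have "\<dots> \<le> 4 * (1/2)^(l + j)" using B(2)[OF i, of j] by (simp add: Un_commute)
      finally have 1: "prob (sym_diff (?S ` B i) (?A (Suc i))) \<le> 4 * (1/2)^(l + j)" .
      have 2: "prob (sym_diff (?A (Suc i)) (B (Suc i mod q))) \<le> 5 * (1/2)^(l + j)"
      proof (cases "Suc i = q")
        case False
        then have "Suc i < q" using i by simp
        then have "prob (sym_diff (?A (Suc i)) (B (Suc i mod q))) \<le> 4 * (1/2)^(l + j)"
          using B(2)[of "Suc i" j] by simp
        then show ?thesis by (rule order_trans) simp
      next
        case True
        have "prob (sym_diff (?A q) (B 0)) \<le> prob (sym_diff (?A q) A) + prob (sym_diff A (B 0))"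
          using q by (intro measure_sym_diff_triangle img A(1) B(1)) auto
        also have "prob (sym_diff (?A q) A) \<le> (1/2)^(l + j)"
          using mq by (simp add: displacement_def less_imp_le)
        also have "prob (sym_diff A (B 0)) \<le> 4 * (1/2)^(l + j)" using B(2)[of 0 j] q by simp
        finally show ?thesis using True by simp
      qed
      have "?d i j \<le>
          prob (sym_diff (?S ` B i) (?A (Suc i))) + prob (sym_diff (?A (Suc i)) (B (Suc i mod q)))"
        using q by (intro measure_sym_diff_triangle img A(1) B(1) i) auto
      then show ?thesis using 1 2 by simp
    qed
    then show "\<forall>\<^sub>F j in sequentially. ?d i j \<le> 9 * (1/2)^(l + j)"
      by simp
  qed simp
  define v where "v = cis (2 * pi / q)"
  have vq: "v ^ q = 1" using q Complex.DeMoivre[of "2 * pi / q" q] by (simp add: v_def cis_2pi)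
  have v1: "v \<noteq> 1"
  proof
    assume "v = 1"
    then have "cos (2 * pi / q) = 1" by (simp add: v_def complex_eq_iff)
    then obtain z :: int where "2 * pi / q = of_int z * 2 * pi" by (auto simp: cos_one_2pi_int)
    then have "1 = of_int z * real q" using q by (simp add: field_simps)
    then have "1 = z * int q" by (metis of_int_1 of_int_eq_iff of_int_mult of_int_of_nat_eq)
    then have "int q dvd 1" by (metis dvd_triv_right)
    then show False using q by simp
  qed
  have vn: "norm v = 1" by (simp add: v_def)
  define f where "f x = (\<Sum>i<q. v ^ i * indicator (B i) x)" for x
  have f: "f \<in> borel_measurable M" unfolding f_def
    by (intro borel_measurable_sum borel_measurable_times borel_measurable_const borel_measurable_indicator B(1)) simp
  have fin: "finite (f ` space M)"
  proof (rule finite_subset)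
    show "f ` space M \<subseteq> (\<lambda>J. \<Sum>i\<in>J. v ^ i) ` Pow {..<q}"
    proof
      fix y assume "y \<in> f ` space M"
      then obtain x where "y = f x" by blast
      also have "f x = (\<Sum>i<q. if x \<in> B i then v ^ i else 0)"
        unfolding f_def by (rule sum.cong) (auto simp: indicator_def)
      also have "\<dots> = (\<Sum>i\<in>{i\<in>{..<q}. x \<in> B i}. v ^ i)"
        by (rule sum.inter_filter[symmetric]) simp
      finally show "y \<in> (\<lambda>J. \<Sum>i\<in>J. v ^ i) ` Pow {..<q}" by blast
    qed
  qed simp
  have nz: "\<not> (AE x in M. f x = 0)"
    unfolding f_def
  proof (rule root_combination_nonzero[OF q vq v1 vn A(1) B(1) probB])
    have "prob (sym_diff (B 0) A) \<le> 0"
    proof (rule LIMSEQ_le_const[OF geo[of 4]], intro exI allI impI)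
      show "prob (sym_diff (B 0) A) \<le> 4 * (1/2)^(l + j)" for j
        using B(2)[of 0 j] q by (simp add: Un_commute)
    qed
    then show "prob (sym_diff (B 0) A) = 0" by (simp add: measure_le_0_iff)
    fix i assume i: "i \<in> {1..<q}"
    let ?A = "(T ^^ (i * m 0)) ` A"
    have d: "\<bar>prob (sym_diff (B i) A) - displacement M A T (i * m 0) 0\<bar> \<le> prob (sym_diff ?A (B i))"
    proof -
      have "prob (sym_diff (B i) A) \<le> prob (sym_diff (B i) ?A) + prob (sym_diff ?A A)"
        "prob (sym_diff ?A A) \<le> prob (sym_diff ?A (B i)) + prob (sym_diff (B i) A)"
        using i by (intro measure_sym_diff_triangle img A(1) B(1); simp)+
      then show ?thesis by (simp add: displacement_def Un_commute abs_le_iff)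
    qed
    have "\<bar>prob (sym_diff (B i) A) - C\<bar> < 5 * (1/2)^l"
      using d B(2)[of i 0] m0 i by fastforce
    then have "real q * \<bar>prob (sym_diff (B i) A) - C\<bar> < real q * (5 * (1/2)^l)"
      using q by (intro mult_strict_left_mono) auto
    also have "\<dots> < C" using l q by (simp add: field_simps)
    finally show "real q * \<bar>prob (sym_diff (B i) A) - C\<bar> < C" .
  qed auto
  let ?e = "\<lambda>j. prob {x\<in>space M. f ((T ^^ m j) x) \<noteq> v * f x}"
  have rigid: "(\<lambda>j. ?e j) \<longlonglongrightarrow> 0"
  proof (rule tendsto_sandwich[OF _ _ tendsto_const])
    show "(\<lambda>j. \<Sum>i<q. ?d i j) \<longlonglongrightarrow> 0"
      using tendsto_sum[of "{..<q}", OF cyc] by simp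
    have "?e j \<le>
        (\<Sum>i<q. ?d i j)" for j
    proof -
      let ?S = "T ^^ m j"
      have Sm: "?S \<in> M \<rightarrow>\<^sub>M M" using pow by (rule transformation_measurable)
      define E where "E i = ?S -` (sym_diff (?S ` B i) (B (Suc i mod q))) \<inter> space M" for i
      have ev: "sym_diff (?S ` B i) (B (Suc i mod q)) \<in> events" if "i < q" for i
        using B(1)[OF that] B(1)[of "Suc i mod q"] q img by auto
      have Eev: "E i \<in> events" if "i < q" for i
        unfolding E_def using Sm ev[OF that] by (rule measurable_sets)
      have "{x\<in>space M. f (?S x) \<noteq> v * f x} \<subseteq> (\<Union>i<q. E i)"
      proof (rule subsetI, rule ccontr)
        fix x assume x: "x \<in> {x\<in>space M. f (?S x) \<noteq> v * f x}" and nE: "x \<notin> (\<Union>i<q. E i)"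
        have ind: "indicator (B (Suc i mod q)) (?S x) = (indicator (B i) x :: complex)" if "i < q" for i
        proof -
          have "?S x \<in> ?S ` B i \<longleftrightarrow> ?S x \<in> B (Suc i mod q)"
            using nE x that by (auto simp: E_def)
          moreover have "?S x \<in> ?S ` B i \<longleftrightarrow> x \<in> B i"
            using transformation_mem_image_iff[OF pow sets.sets_into_space[OF B(1)[OF that]]] x by simp
          ultimately show ?thesis by (simp add: indicator_def)
        qed
        have bij: "bij_betw (\<lambda>i. Suc i mod q) {..<q} {..<q}"
        proof (rule bij_betw_byWitness[of _ "\<lambda>i. (i + (q - 1)) mod q"])
          show "\<forall>i\<in>{..<q}. (Suc i mod q + (q - 1)) mod q = i"
            using q by (auto simp: mod_Suc)
          show "\<forall>i\<in>{..<q}. Suc ((i + (q - 1)) mod q) mod q = i"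
            using q by (auto simp: mod_simps)
        qed (use q in auto)
        have "f (?S x) = (\<Sum>i<q. v ^ (Suc i mod q) * indicator (B (Suc i mod q)) (?S x))"
          unfolding f_def by (rule sum.reindex_bij_betw[OF bij, symmetric])
        also have "\<dots> = (\<Sum>i<q. v ^ Suc i * indicator (B i) x)"
        proof (rule sum.cong)
          fix i assume "i \<in> {..<q}"
          then have i: "i < q" by simp
          have "v ^ (Suc i mod q) = v ^ Suc i"
            using i vq by (cases "Suc i = q") (auto simp del: power_Suc)
          then show "v ^ (Suc i mod q) * indicator (B (Suc i mod q)) (?S x) = v ^ Suc i * indicator (B i) x"
            using ind[OF i] by simp
        qed simp
        also have "\<dots> = v * f x"
          unfolding f_def sum_distrib_left by (simp only: power_Suc mult.assoc)
        finally show False using x by simp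
      qed
      then have "?e j \<le> prob (\<Union>i<q. E i)"
        by (rule finite_measure_mono) (use Eev in auto)
      also have "\<dots> \<le> (\<Sum>i<q. prob (E i))"
        by (rule measure_UNION_le) (use Eev in auto)
      also have "\<dots> = (\<Sum>i<q. ?d i j)"
        unfolding E_def using preserving_vimage_measure[OF Sm transformation_distr[OF pow] ev] by simp
      finally show ?thesis .
    qed
    then show "\<forall>\<^sub>F j in sequentially. ?e j \<le>
        (\<Sum>i<q. ?d i j)" by simp
  qed simp
  have "k_fold_lebesgue M T (q + 1) f"
  proof (rule rigid_eigenfunction_lebesgue[OF T f fin nz rigid])
    show "v ^ (q + 1 - 1) * cnj v \<noteq> 1"
      using v1 vq by auto
  qed (use q in simp)
  then show ?thesis using fin by blast
qed

lemma (in prob_space) non_atomic_singleton: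
  assumes na: "non_atomic M" and x: "{x} \<in> events"
  shows "prob {x} = 0"
proof (rule ccontr)
  assume "prob {x} \<noteq> 0"
  then have "0 < emeasure M {x}" by (simp add: emeasure_eq_measure zero_less_measure_iff)
  then obtain B where "B \<subseteq> {x}" "0 < emeasure M B" "emeasure M B < emeasure M {x}"
    using na x unfolding non_atomic_def by blast
  then show False by (auto simp: subset_singleton_iff)
qed

theorem theorem1p8:
  fixes M :: "'a measure"
  assumes "prob_space M" and "standard_borel M" and "non_atomic M"
  shows "typical M (\<lambda>T. \<forall>k\<ge>3. \<exists>f. k_fold_lebesgue M T k f \<and> finite (f ` space M))"
proof -
  interpret prob_space M by fact
  obtain U \<psi> where cod: "coded M U \<psi>"
    using standard_borel_imp_coded[OF assms(2) not_empty] by blast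
  have atomless: "prob {x} = 0" if "x \<in> space M" for x
    using non_atomic_singleton[OF assms(3) coded_singleton[OF cod that]] .
  obtain A where A: "A \<in> events" "0 < prob A" "prob A < 1"
  proof -
    have "0 < emeasure M (space M)" by (simp add: emeasure_space_1)
    then obtain A where "A \<in> events" "0 < emeasure M A" "emeasure M A < emeasure M (space M)"
      using assms(3) unfolding non_atomic_def by blast
    then show thesis using that by (simp add: emeasure_eq_measure prob_space)
  qed
  \<comment> \<open>All conditions, for all orders \<open>q + 2\<close>, are enumerated in one sequence; \<open>m = 0\<close> stands for the initial step.\<close>
  define P where "P n = (case prod_decode n of (q, r) \<Rightarrow> case prod_decode r of (m, l) \<Rightarrow>
      if m = 0 then initial_step M A (q + 2) l else refinement_step M A (q + 2) (m - 1) l)" for n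
  show ?thesis
  proof (rule typicalI[OF assms(1) cod])
    show "weakly_open M (P n)" for n
      unfolding P_def using weakly_open_initial_step[OF A(1)] weakly_open_refinement_step[OF A(1)]
      by (auto split: prod.split)
    show "weakly_dense M (P n)" for n
      unfolding P_def using weakly_dense_initial_step[OF cod atomless A(1)]
        weakly_dense_refinement_step[OF cod atomless A(1)]
      by (auto split: prod.split)
    fix T assume T: "T \<in> transformations M" and PT: "\<And>n. P n T"
    show "\<forall>k\<ge>3. \<exists>f. k_fold_lebesgue M T k f \<and> finite (f ` space M)"
    proof (intro allI impI)
      fix k :: nat assume k: "3 \<le> k"
      have q: "2 \<le> k - 1" "k - 3 + 2 = k - 1" "k - 1 + 1 = k" using k by auto
      have "initial_step M A (k - 1) l T" for l
        using PT[of "prod_encode (k - 3, prod_encode (0, l))"] q by (simp add: P_def)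
      moreover have "refinement_step M A (k - 1) m l T" for m l
        using PT[of "prod_encode (k - 3, prod_encode (Suc m, l))"] q by (simp add: P_def)
      ultimately show "\<exists>f. k_fold_lebesgue M T k f \<and> finite (f ` space M)"
        using lebesgue_function_exists[OF T A q(1)] unfolding q(3) by blast
    qed
  qed
qed

end
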